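(* Let $u\in C(\mathbb{R}:H^1(\mathbb{R}))\cap L^\infty(\mathbb{R}:H^1(\mathbb{R}))$ be the global solution of the initial value problem $$\partial_t u - \mathcal{H}\partial_x^2 u + u\,\partial_x u = 0,\quad x,t\in\mathbb{R},\qquad u(x,0)=u_0(x)\in H^1(\mathbb{R}).$$ Then for any constants $C_1>0$ and $\eta>0$, $$\lim_{t\to\infty}\|u(t)\|_{L^2(\{x\le -C_1 t\log^{1+\eta}t\})}=0.$$
   Context: $\mathcal{H}$ denotes the Hilbert transform, $\mathcal{H}f(x)=\mathrm{p.v.}\frac{1}{\pi}\int_{\mathbb{R}}\frac{f(y)}{x-y}\,dy$; $u$ is real-valued. *)

theory Defs
  imports "HOL-Analysis.Analysis"
begin

text \<open>Smooth (C-infinity) functions of one real variable: differentiable everywhere,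
  continuous, with smooth derivative (coinductively: derivatives of all orders exist).\<close>
coinductive smooth1 :: "(real \<Rightarrow> real) \<Rightarrow> bool" where
  "\<lbrakk> continuous_on UNIV f; \<forall>x. (f has_real_derivative f' x) (at x); smooth1 f' \<rbrakk>
   \<Longrightarrow> smooth1 f"

definition test_fun1 :: "(real \<Rightarrow> real) \<Rightarrow> bool" where
  "test_fun1 \<phi> \<longleftrightarrow> smooth1 \<phi> \<and> (\<exists>R. \<forall>x. R < \<bar>x\<bar> \<longrightarrow> \<phi> x = 0)"

coinductive smooth2 :: "(real \<Rightarrow> real \<Rightarrow> real) \<Rightarrow> bool" where
  "\<lbrakk> continuous_on UNIV (\<lambda>(x,t). f x t);
     \<forall>x t. ((\<lambda>y. f y t) has_real_derivative fx x t) (at x);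
     \<forall>x t. ((\<lambda>s. f x s) has_real_derivative ft x t) (at t);
     smooth2 fx; smooth2 ft \<rbrakk>
   \<Longrightarrow> smooth2 f"

definition test_fun2 :: "(real \<Rightarrow> real \<Rightarrow> real) \<Rightarrow> bool" where
  "test_fun2 \<phi> \<longleftrightarrow> smooth2 \<phi> \<and> (\<exists>R. \<forall>x t. R < \<bar>x\<bar> \<or> R < \<bar>t\<bar> \<longrightarrow> \<phi> x t = 0)"

definition L2 :: "(real \<Rightarrow> real) \<Rightarrow> bool" where
  "L2 f \<longleftrightarrow> f \<in> borel_measurable lborel \<and> integrable lborel (\<lambda>x. (f x)^2)"

definition L2_norm :: "(real \<Rightarrow> real) \<Rightarrow> real" where
  "L2_norm f = sqrt (LINT x|lborel. (f x)^2)"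

definition weak_deriv :: "(real \<Rightarrow> real) \<Rightarrow> (real \<Rightarrow> real) \<Rightarrow> bool" where
  "weak_deriv f g \<longleftrightarrow> (\<forall>\<phi>. test_fun1 \<phi> \<longrightarrow>
      (LINT x|lborel. f x * deriv \<phi> x) = - (LINT x|lborel. g x * \<phi> x))"

definition H1 :: "(real \<Rightarrow> real) \<Rightarrow> bool" where
  "H1 f \<longleftrightarrow> L2 f \<and> (\<exists>g. L2 g \<and> weak_deriv f g)"

definition H1_norm :: "(real \<Rightarrow> real) \<Rightarrow> real" where
  "H1_norm f = sqrt ((L2_norm f)^2 + (L2_norm (SOME g. L2 g \<and> weak_deriv f g))^2)"

definition hilbert :: "(real \<Rightarrow> real) \<Rightarrow> real \<Rightarrow> real" where
  "hilbert f x = Lim (at_right 0)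
     (\<lambda>\<epsilon>. (1/pi) * (LINT y:{y. \<epsilon> < \<bar>x - y\<bar>}|lborel. f y / (x - y)))"

definition C_Linf_H1 :: "(real \<Rightarrow> real \<Rightarrow> real) \<Rightarrow> bool" where
  "C_Linf_H1 u \<longleftrightarrow>
     (\<forall>t. H1 (\<lambda>x. u x t)) \<and>
     (\<forall>t. ((\<lambda>s. H1_norm (\<lambda>x. u x s - u x t)) \<longlongrightarrow> 0) (at t)) \<and>
     (\<exists>M. \<forall>t. H1_norm (\<lambda>x. u x t) \<le> M)"

definition BO_weak_solution :: "(real \<Rightarrow> real \<Rightarrow> real) \<Rightarrow> bool" where
  "BO_weak_solution u \<longleftrightarrow> (\<forall>\<phi>. test_fun2 \<phi> \<longrightarrow>
     (LINT t|lborel. LINT x|lborel.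
        - u x t * deriv (\<lambda>s. \<phi> x s) t
        - hilbert (\<lambda>y. u y t) x * deriv (deriv (\<lambda>y. \<phi> y t)) x
        - (u x t)^2 / 2 * deriv (\<lambda>y. \<phi> y t) x) = 0)"

end

theory Submission
  imports Defs "HOL-Complex_Analysis.Complex_Analysis" "HOL-Real_Asymp.Real_Asymp"
begin

text \<open>
The energy is weighted with \<open>\<phi>(x) = x^2 / (x^2 + m^2)\<close>, and \<open>m\<close> stays fixed while the solution
evolves from time \<open>0\<close> to time \<open>T\<close>; the claim is that \<open>\<integral> \<phi> u^2\<close> grows by at most a constant times
\<open>T / m\<close>. With \<open>m = C1 T log^(1+\<eta>) T\<close> this increment tends to zero, and so does the initial weighted
energy because \<open>m\<close> tends to infinity, while \<open>\<phi> \<ge> 1/2\<close> on the half-line in question.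

The choice of a rational weight makes the dispersive term explicit. Let \<open>v\<close> be the Poisson smoothing of
\<open>u\<close> and \<open>w\<close> its conjugate, so that \<open>v + i w\<close> is the restriction of a function \<open>F\<close> holomorphic in a
half-plane. The dangerous contribution \<open>\<integral> v_x w_x m^2 / (x^2 + m^2)\<close> is the imaginary part of a Poisson
integral of \<open>F'^2\<close>, which equals a multiple of \<open>F'(i m)^2\<close> and is \<open>O(m^(-2))\<close>; letting \<open>m\<close> tend to
infinity in the same formula gives the isometry \<open>|w_x| = |v_x|\<close> in \<open>L^2\<close>. No commutator estimate and no
prior \<open>L^2\<close> theory of the Hilbert transform is needed. The smoothing scale \<open>e\<close> is sent to zero at the end.
\<close>

section \<open>Smooth functions and cutoffs\<close>

text \<open>The solution is only \<open>H1\<close> in space and satisfies the equation only weakly,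
  so its weighted energy cannot be differentiated in time as it stands. The Poisson kernel is the
  right smoothing because the Hilbert transform turns it into the conjugate kernel
  \<open>qk\<close>: both space derivatives of the dispersive term land on an explicit kernel, and
  of \<open>hilbert\<close> itself only the supremum, also of its differences in time, has to be
  controlled. The price is that smoothing does not commute with squaring. The defect, smoothed
  square minus square of the smoothed function, is nonnegative and at most a multiple of
  \<open>pk_modulus e\<close>, so it disappears when \<open>e\<close> tends to zero with
  \<open>m\<close> and \<open>T\<close> held fixed. Apart from the defect, integration by parts
  leaves terms that carry the slope of the weight, at most \<open>1 / m\<close>, and the weighted
  product \<open>v_x w_x\<close>. There the weight is split as \<open>1 - m^2 / (x^2 + m^2)\<close>:
  the constant contributes nothing, since \<open>v_x\<close> and \<open>w_x\<close> are orthogonal,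
  and the remainder is small because the square of the Cauchy integral decays like the inverse cube
  of the height in the half-plane.\<close>

lemma smooth1I:
  assumes "P f"
    and "\<And>f. P f \<Longrightarrow> \<exists>f'. (\<forall>x. (f has_real_derivative f' x) (at x)) \<and> P f'"
  shows "smooth1 f"
  using assms(1)
proof (coinduction arbitrary: f rule: smooth1.coinduct)
  case (smooth1 f)
  then obtain f' where f': "\<forall>x. (f has_real_derivative f' x) (at x)" "P f'"
    using assms(2) by blast
  then have "continuous_on UNIV f"
    by (meson DERIV_continuous continuous_at_imp_continuous_on)
  then show ?case using f' by blast
qed

lemma smooth1_has_derivative:
  assumes "smooth1 f"
  obtains f' where "\<And>x. (f has_real_derivative f' x) (at x)" "smooth1 f'" "deriv f = f'"
proof -
  from assms obtain f' where "\<And>x. (f has_real_derivative f' x) (at x)" "smooth1 f'"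
    by (cases) blast
  moreover then have "deriv f = f'" by (auto intro: DERIV_imp_deriv)
  ultimately show ?thesis using that by blast
qed

lemma smooth1_deriv:
  assumes "smooth1 f"
  shows "smooth1 (deriv f)" "(f has_real_derivative deriv f x) (at x)"
  using smooth1_has_derivative[OF assms] by metis+

lemma smooth1_continuous: "smooth1 f \<Longrightarrow> continuous_on UNIV f"
  by (erule smooth1.cases) auto

lemma smooth1_measurable: "smooth1 f \<Longrightarrow> f \<in> borel_measurable borel"
  by (intro borel_measurable_continuous_onI smooth1_continuous)

lemma smooth1_const: "smooth1 (\<lambda>x. c)"
  by (rule smooth1I[where P = "\<lambda>f. \<exists>c. f = (\<lambda>x. c)"]) (auto intro!: derivative_eq_intros exI)

text \<open>Closure properties of \<open>smooth1\<close> need coinduction up to algebraic operations; this predicate is the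
corresponding invariant.\<close>
inductive smooth_closure :: "(real \<Rightarrow> real) \<Rightarrow> bool" where
  base: "smooth1 f \<Longrightarrow> smooth_closure f"
| add: "smooth_closure f \<Longrightarrow> smooth_closure g \<Longrightarrow> smooth_closure (\<lambda>x. f x + g x)"
| mult: "smooth_closure f \<Longrightarrow> smooth_closure g \<Longrightarrow> smooth_closure (\<lambda>x. f x * g x)"
| affine: "smooth_closure f \<Longrightarrow> smooth_closure (\<lambda>x. f (a * x + b))"
| inverse: "smooth_closure f \<Longrightarrow> (\<And>x. f x \<noteq> 0) \<Longrightarrow> smooth_closure (\<lambda>x. inverse (f x))"

lemma smooth_closure_deriv:
  "smooth_closure f \<Longrightarrow> \<exists>f'. (\<forall>x. (f has_real_derivative f' x) (at x)) \<and> smooth_closure f'"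
proof (induction rule: smooth_closure.induct)
  case (base f)
  obtain f' where "\<And>x. (f has_real_derivative f' x) (at x)" "smooth1 f'"
    by (rule smooth1_has_derivative[OF base]) blast
  then show ?case using smooth_closure.base by blast
next
  case (add f g)
  then obtain f' g' where *: "\<And>x. (f has_real_derivative f' x) (at x)" "smooth_closure f'"
    "\<And>x. (g has_real_derivative g' x) (at x)" "smooth_closure g'" by blast
  show ?case
    by (rule exI[of _ "\<lambda>x. f' x + g' x"]) (simp add: * DERIV_add smooth_closure.add)
next
  case (mult f g)
  then obtain f' g' where *: "\<And>x. (f has_real_derivative f' x) (at x)" "smooth_closure f'"
    "\<And>x. (g has_real_derivative g' x) (at x)" "smooth_closure g'" by blast
  show ?case
    by (rule exI[of _ "\<lambda>x. f' x * g x + g' x * f x"])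
       (simp add: * DERIV_mult smooth_closure.add smooth_closure.mult mult.hyps)
next
  case (affine f a b)
  then obtain f' where f': "\<And>x. (f has_real_derivative f' x) (at x)" "smooth_closure f'" by blast
  have "((\<lambda>x. a * x + b) has_real_derivative a) (at x)" for x
    by (auto intro!: derivative_eq_intros)
  then have "((\<lambda>x. f (a * x + b)) has_real_derivative f' (a * x + b) * a) (at x)" for x
    by (rule DERIV_chain2[OF f'(1)])
  moreover have "smooth_closure (\<lambda>x. f' (a * x + b) * a)"
    by (rule smooth_closure.mult[OF smooth_closure.affine[OF f'(2)] smooth_closure.base[OF smooth1_const]])
  ultimately show ?case by (intro exI[of _ "\<lambda>x. f' (a * x + b) * a"] conjI allI)
next
  case (inverse f)
  then obtain f' where f': "\<And>x. (f has_real_derivative f' x) (at x)" "smooth_closure f'" by blast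
  have "((\<lambda>x. inverse (f x)) has_real_derivative - 1 * (inverse (f x) * (f' x * inverse (f x)))) (at x)" for x
    using DERIV_inverse'[OF f'(1) inverse.hyps(2)] by (simp add: mult.assoc)
  moreover have "smooth_closure (\<lambda>x. - 1 * (inverse (f x) * (f' x * inverse (f x))))"
    by (rule smooth_closure.mult[OF smooth_closure.base[OF smooth1_const]
          smooth_closure.mult[OF _ smooth_closure.mult[OF f'(2)]]];
        rule smooth_closure.inverse[OF inverse.hyps])
  ultimately show ?case
    by (intro exI[of _ "\<lambda>x. - 1 * (inverse (f x) * (f' x * inverse (f x)))"] conjI allI)
qed

lemma smooth1_closure: "smooth_closure f \<Longrightarrow> smooth1 f"
  by (erule smooth1I[where P = smooth_closure]) (rule smooth_closure_deriv)

lemma smooth1_add: "smooth1 f \<Longrightarrow> smooth1 g \<Longrightarrow> smooth1 (\<lambda>x. f x + g x)"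
  by (rule smooth1_closure[OF smooth_closure.add[OF smooth_closure.base smooth_closure.base]])

lemma smooth1_mult: "smooth1 f \<Longrightarrow> smooth1 g \<Longrightarrow> smooth1 (\<lambda>x. f x * g x)"
  by (rule smooth1_closure[OF smooth_closure.mult[OF smooth_closure.base smooth_closure.base]])

lemma smooth1_affine: "smooth1 f \<Longrightarrow> smooth1 (\<lambda>x. f (a * x + b))"
  by (rule smooth1_closure[OF smooth_closure.affine[OF smooth_closure.base]])

lemma smooth1_inverse: "smooth1 f \<Longrightarrow> (\<And>x. f x \<noteq> 0) \<Longrightarrow> smooth1 (\<lambda>x. inverse (f x))"
  by (rule smooth1_closure[OF smooth_closure.inverse[OF smooth_closure.base]])

lemma smooth1_cmult: "smooth1 f \<Longrightarrow> smooth1 (\<lambda>x. c * f x)"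
  by (intro smooth1_mult smooth1_const)
lemma smooth1_diff: "smooth1 f \<Longrightarrow> smooth1 g \<Longrightarrow> smooth1 (\<lambda>x. f x - g x)"
  using smooth1_add[OF _ smooth1_cmult[of g "-1"], of f] by simp

text \<open>Both partial derivatives of a product \<open>a x * b t\<close> are again such products,
  so these products form a bisimulation. Separated test functions are the only space-time test
  functions that the weak formulation is tested with later.\<close>

lemma smooth2_prod:
  assumes "smooth1 a" "smooth1 b"
  shows "smooth2 (\<lambda>x t. a x * b t)"
  using assms
proof (coinduction arbitrary: a b rule: smooth2.coinduct)
  case (smooth2 a b)
  obtain a' where a': "\<And>x. (a has_real_derivative a' x) (at x)" "smooth1 a'"
    using smooth1_has_derivative[OF smooth2(1)] by metis
  obtain b' where b': "\<And>x. (b has_real_derivative b' x) (at x)" "smooth1 b'"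
    using smooth1_has_derivative[OF smooth2(2)] by metis
  have ca: "continuous_on UNIV a" and cb: "continuous_on UNIV b"
    using smooth2 smooth1_continuous by auto
  have "continuous_on UNIV (\<lambda>(x,t). a x * b t)"
    unfolding case_prod_beta
    by (intro continuous_intros continuous_on_compose2[OF ca] continuous_on_compose2[OF cb]) auto
  moreover have "((\<lambda>y. a y * b t) has_real_derivative a' x * b t) (at x)" for x t
    using a' by (auto intro!: derivative_eq_intros)
  moreover have "((\<lambda>s. a x * b s) has_real_derivative a x * b' t) (at t)" for x t
    using b' by (auto intro!: derivative_eq_intros)
  moreover have "\<exists>c d. (\<lambda>x t. a' x * b t) = (\<lambda>x t. c x * d t) \<and> smooth1 c \<and> smooth1 d"
    "\<exists>c d. (\<lambda>x t. a x * b' t) = (\<lambda>x t. c x * d t) \<and> smooth1 c \<and> smooth1 d"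
    using a'(2) b'(2) smooth2 by (auto intro: exI)
  ultimately show ?case
    by (intro exI[of _ "\<lambda>x t. a x * b t"] exI[of _ "\<lambda>x t. a' x * b t"]
        exI[of _ "\<lambda>x t. a x * b' t"] conjI allI disjI1) simp_all
qed

lemma test_fun2_prod:
  assumes "test_fun1 a" "test_fun1 b"
  shows "test_fun2 (\<lambda>x t. a x * b t)"
proof -
  obtain R1 R2 where "\<And>x. R1 < \<bar>x\<bar> \<Longrightarrow> a x = 0" "\<And>x. R2 < \<bar>x\<bar> \<Longrightarrow> b x = 0"
    using assms unfolding test_fun1_def by blast
  then have "\<forall>x t. max R1 R2 < \<bar>x\<bar> \<or> max R1 R2 < \<bar>t\<bar> \<longrightarrow> a x * b t = 0" by auto
  then show ?thesis using assms smooth2_prod unfolding test_fun1_def test_fun2_def by blast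
qed

section \<open>Smooth cutoffs built from the flat function exp(-1/x)\<close>

definition flat_exp :: "real poly \<Rightarrow> real \<Rightarrow> real" where
  "flat_exp p x = (if x > 0 then poly p (1/x) * exp (- (1/x)) else 0)"

lemma poly_exp_minus_tendsto: "((\<lambda>y::real. poly p y * exp (- y)) \<longlongrightarrow> 0) at_top"
proof -
  have "((\<lambda>y::real. \<Sum>i\<le>degree p. coeff p i * (y ^ i / exp y)) \<longlongrightarrow> (\<Sum>i\<le>degree p. coeff p i * 0)) at_top"
    by (intro tendsto_sum tendsto_mult tendsto_const tendsto_power_div_exp_0)
  then show ?thesis
    by (simp add: poly_altdef exp_minus field_simps sum_distrib_right sum_distrib_left sum_divide_distrib)
qed

text \<open>With \<open>y = 1/x\<close> one has \<open>d/dx = - y^2 d/dy\<close>, hence the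
  polynomial \<open>y^2 (p - p')\<close>. Carrying a polynomial in \<open>1/x\<close> along makes
  the family closed under differentiation, which is the invariant needed for coinductive
  smoothness.\<close>

lemma flat_exp_deriv:
  "(flat_exp p has_real_derivative flat_exp ([:0,0,1:] * (p - pderiv p)) x) (at x)"
proof -
  consider "x > 0" | "x < 0" | "x = 0" by linarith
  then show ?thesis
  proof cases
    case 1
    have "((\<lambda>x. poly p (1/x) * exp (- (1/x))) has_real_derivative
        flat_exp ([:0,0,1:] * (p - pderiv p)) x) (at x)"
      using 1 by (auto intro!: derivative_eq_intros DERIV_chain2[OF poly_DERIV]
          simp: flat_exp_def field_simps power2_eq_square)
    moreover have ev: "eventually (\<lambda>y. poly p (1/y) * exp (- (1/y)) = flat_exp p y) (nhds x)"
      using eventually_nhds_in_open[of "{0<..}" x] 1 by (auto simp: flat_exp_def elim!: eventually_mono)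
    ultimately show ?thesis by (simp add: DERIV_cong_ev[OF refl ev refl])
  next
    case 2
    have "((\<lambda>x. 0) has_real_derivative flat_exp ([:0,0,1:] * (p - pderiv p)) x) (at x)"
      using 2 by (simp add: flat_exp_def)
    moreover have ev: "eventually (\<lambda>y. 0 = flat_exp p y) (nhds x)"
      using eventually_nhds_in_open[of "{..<0}" x] 2 by (auto simp: flat_exp_def elim!: eventually_mono)
    ultimately show ?thesis by (simp add: DERIV_cong_ev[OF refl ev refl])
  next
    case 3
    \<comment> \<open>\<open>pCons 0 p\<close> is the polynomial \<open>y p(y)\<close>: the extra
      factor \<open>y = 1/h\<close> is the denominator of the difference quotient at
      \<open>0\<close>.\<close>
    have "((\<lambda>h. poly (pCons 0 p) (inverse h) * exp (- inverse h)) \<longlongrightarrow> 0) (at_right 0)"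
      using filterlim_compose[OF poly_exp_minus_tendsto[of "pCons 0 p"] filterlim_inverse_at_top_right] by simp
    moreover have "eventually (\<lambda>h. poly (pCons 0 p) (inverse h) * exp (- inverse h) = flat_exp p h / h) (at_right 0)"
      using eventually_at_right_less[of "0::real"]
      by eventually_elim (auto simp: flat_exp_def field_simps)
    ultimately have r: "((\<lambda>h. flat_exp p h / h) \<longlongrightarrow> 0) (at_right 0)"
      by (rule Lim_transform_eventually)
    have "eventually (\<lambda>h. 0 = flat_exp p h / h) (at_left 0)"
      using eventually_at_left_real[of "-1" "0::real"] by (auto simp: flat_exp_def elim!: eventually_mono)
    then have l: "((\<lambda>h. flat_exp p h / h) \<longlongrightarrow> 0) (at_left 0)"
      by (rule Lim_transform_eventually[OF tendsto_const])
    from l r have "((\<lambda>h. flat_exp p h / h) \<longlongrightarrow> 0) (at 0)"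
      by (rule filterlim_split_at_real)
    moreover have "flat_exp p 0 = 0" "flat_exp ([:0,0,1:] * (p - pderiv p)) 0 = 0"
      by (simp_all add: flat_exp_def)
    ultimately show ?thesis unfolding 3 DERIV_def by simp
  qed
qed

lemma smooth1_flat_exp: "smooth1 (flat_exp p)"
  by (rule smooth1I[where P = "\<lambda>f. \<exists>p. f = flat_exp p"]) (use flat_exp_deriv in blast)+

text \<open>The usual smooth transition from \<open>0\<close> to \<open>1\<close> on the interval
  from \<open>-1\<close> to \<open>1\<close>. The denominator is positive because
  \<open>1 + x\<close> and \<open>1 - x\<close> are never both nonpositive.\<close>

definition step :: "real \<Rightarrow> real" where
  "step x = flat_exp 1 (1 + x) * inverse (flat_exp 1 (1 + x) + flat_exp 1 (1 - x))"

lemma flat_exp_1: "flat_exp 1 x \<ge> 0" "flat_exp 1 x = 0 \<longleftrightarrow> x \<le> 0"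
  by (auto simp: flat_exp_def)

lemma step_denom: "flat_exp 1 (1 + x) + flat_exp 1 (1 - x) > 0"
proof -
  have "flat_exp 1 (1 + x) \<noteq> 0 \<or> flat_exp 1 (1 - x) \<noteq> 0" unfolding flat_exp_1 by linarith
  then show ?thesis using flat_exp_1(1)[of "1+x"] flat_exp_1(1)[of "1-x"] by linarith
qed

lemma smooth1_step: "smooth1 step"
proof -
  have 1: "smooth1 (\<lambda>x. flat_exp 1 (1 + x))" "smooth1 (\<lambda>x. flat_exp 1 (1 - x))"
    using smooth1_affine[OF smooth1_flat_exp, of 1 1 1] smooth1_affine[OF smooth1_flat_exp, of 1 "-1" 1]
    by (simp_all add: add.commute)
  show ?thesis unfolding step_def
    by (rule smooth1_mult[OF 1(1) smooth1_inverse[OF smooth1_add[OF 1]]]) (metis step_denom less_irrefl)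
qed

lemma step_bounds: "0 \<le> step x" "step x \<le> 1"
  using flat_exp_1(1)[of "1+x"] flat_exp_1(1)[of "1-x"] step_denom[of x]
  by (auto simp: step_def field_simps)

lemma step_left: "x \<le> -1 \<Longrightarrow> step x = 0"
  using flat_exp_1(2)[of "1+x"] by (simp add: step_def)

lemma step_right: "x \<ge> 1 \<Longrightarrow> step x = 1"
  using flat_exp_1(2)[of "1-x"] step_denom[of x] by (auto simp: step_def field_simps)

text \<open>A smooth approximation of the indicator of \<open>{a..b}\<close> for
  \<open>a < b\<close>, with transitions of half-width \<open>1 / n\<close> at both ends. The
  arguments are spelled as \<open>c * x + d\<close> to match \<open>smooth1_affine\<close>.\<close>

definition plateau :: "real \<Rightarrow> real \<Rightarrow> nat \<Rightarrow> real \<Rightarrow> real" where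
  "plateau a b n x = step (real n * x + (- real n * a)) - step (real n * x + (- real n * b))"

lemma plateau_bound: "\<bar>plateau a b n x\<bar> \<le> 1"
  unfolding plateau_def using step_bounds by (smt (verit))

text \<open>The enlargement by \<open>1\<close> does not depend on \<open>n\<close>, which supplies
  one dominating function for the whole sequence.\<close>

lemma plateau_outside:
  assumes "n \<ge> 1" "x < min a b - 1 \<or> x > max a b + 1"
  shows "plateau a b n x = 0"
proof -
  have n: "real n \<ge> 1" using assms by simp
  show ?thesis using assms(2)
  proof
    assume "x < min a b - 1"
    then have "real n * (a - x) \<ge> 1" "real n * (b - x) \<ge> 1"
      using mult_mono[OF n, of 1 "a - x"] mult_mono[OF n, of 1 "b - x"] by auto
    then show ?thesis by (simp add: plateau_def step_left algebra_simps)
  next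
    assume "x > max a b + 1"
    then have "real n * (x - a) \<ge> 1" "real n * (x - b) \<ge> 1"
      using mult_mono[OF n, of 1 "x - a"] mult_mono[OF n, of 1 "x - b"] by auto
    then show ?thesis by (simp add: plateau_def step_right algebra_simps)
  qed
qed

lemma test_fun1_plateau:
  assumes "n \<ge> 1" shows "test_fun1 (plateau a b n)"
proof -
  have "smooth1 (plateau a b n)"
    unfolding plateau_def by (intro smooth1_diff smooth1_affine[OF smooth1_step])
  moreover have "\<forall>x. \<bar>a\<bar> + \<bar>b\<bar> + 1 < \<bar>x\<bar> \<longrightarrow> plateau a b n x = 0"
    by (intro allI impI plateau_outside[OF assms]) linarith
  ultimately show ?thesis unfolding test_fun1_def by blast
qed

lemma step_dilate_tendsto:
  assumes "x \<noteq> a"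
  shows "(\<lambda>n. step (real n * x + (- real n * a))) \<longlonglongrightarrow> (if a < x then 1 else 0)"
proof (rule tendsto_eventually)
  obtain N :: nat where N: "1 < real N * \<bar>x - a\<bar>"
    using reals_Archimedean3[of "\<bar>x - a\<bar>"] assms by auto
  show "\<forall>\<^sub>F n in sequentially. step (real n * x + - real n * a) = (if a < x then 1 else 0)"
  proof (rule eventually_sequentiallyI[of N])
    fix n assume "n \<ge> N"
    then have "1 \<le> real n * \<bar>x - a\<bar>"
      using N mult_right_mono[of "real N" "real n" "\<bar>x - a\<bar>"] by simp
    then show "step (real n * x + - real n * a) = (if a < x then 1 else 0)"
    proof (cases "a < x")
      case True
      then show ?thesis using \<open>1 \<le> _\<close> by (simp add: step_right algebra_simps)
    next
      case False
      then show ?thesis using \<open>1 \<le> _\<close> by (simp add: step_left algebra_simps)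
    qed
  qed
qed

lemma plateau_tendsto:
  assumes "a < b" "x \<noteq> a" "x \<noteq> b"
  shows "(\<lambda>n. plateau a b n x) \<longlonglongrightarrow> indicator {a..b} x"
proof -
  have "(\<lambda>n. plateau a b n x) \<longlonglongrightarrow> (if a < x then 1 else 0) - (if b < x then 1 else 0)"
    unfolding plateau_def using assms by (intro tendsto_diff step_dilate_tendsto)
  also have "(if a < x then 1 else 0) - (if b < x then 1 else 0) = (indicator {a..b} x :: real)"
    using assms by (auto simp: indicator_def)
  finally show ?thesis .
qed

section \<open>Weak derivatives\<close>

lemma integrable_prod_mult:
  fixes f g :: "real \<Rightarrow> 'a::{real_normed_field,banach,second_countable_topology}"
  assumes f: "integrable lborel f" and g: "integrable lborel g"
  shows "integrable (lborel \<Otimes>\<^sub>M lborel) (\<lambda>(x,y). f x * g y)"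
proof (rule lborel_pair.Fubini_integrable)
  have [measurable]: "f \<in> borel_measurable borel" "g \<in> borel_measurable borel"
    using borel_measurable_integrable[OF f] borel_measurable_integrable[OF g] by simp_all
  show "(\<lambda>(x,y). f x * g y) \<in> borel_measurable (lborel \<Otimes>\<^sub>M lborel)" by measurable
  show "integrable lborel (\<lambda>x. LBINT y. norm (case (x,y) of (x,y) \<Rightarrow> f x * g y))"
    using f by (simp add: norm_mult)
  show "AE x in lborel. integrable lborel (\<lambda>y. case (x,y) of (x,y) \<Rightarrow> f x * g y)"
    using g by simp
qed

text \<open>Closed intervals form an intersection-stable generator of the Borel sets, so by the
  pi-lambda theorem the integral vanishes over every Borel set, in particular over the sets where
  \<open>k\<close> is positive and where it is negative.\<close>

lemma AE_zero_if_Icc_integrals_zero: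
  fixes k :: "real \<Rightarrow> real"
  assumes k: "integrable lborel k"
    and z: "\<And>a b. a < b \<Longrightarrow> (LINT x:{a..b}|lborel. k x) = 0"
  shows "AE x in lborel. k x = 0"
proof -
  have [measurable]: "k \<in> borel_measurable borel"
    using borel_measurable_integrable[OF k] by simp
  have si: "set_integrable lborel A k" if "A \<in> sets borel" for A
    using integrable_mult_indicator[OF _ k, of A] that by (simp add: set_integrable_def)
  \<comment> \<open>The generator used below runs over all pairs \<open>(a, b)\<close>, so empty and
    one-point intervals have to be covered as well.\<close>
  have z': "(LINT x:{a..b}|lborel. k x) = 0" for a b
  proof (cases "a < b")
    case False
    have "AE x in lborel. indicator {a..b} x *\<^sub>R k x = 0"
      using AE_lborel_singleton[of a] by eventually_elim (use False in \<open>auto simp: indicator_def\<close>)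
    then show ?thesis unfolding set_lebesgue_integral_def
      by (subst integral_cong_AE[where g = "\<lambda>x. 0"]) auto
  qed (rule z)
  \<comment> \<open>The complement case of the induction subtracts from the integral over the whole
    line.\<close>
  have all: "(LBINT x. k x) = 0"
  proof (rule LIMSEQ_unique)
    show "(\<lambda>n. LBINT x. indicator {- real n..real n} x *\<^sub>R k x) \<longlonglongrightarrow> (LBINT x. k x)"
    proof (rule integral_dominated_convergence[where w = "\<lambda>x. norm (k x)"])
      show "AE x in lborel. (\<lambda>n. indicator {- real n..real n} x *\<^sub>R k x) \<longlonglongrightarrow> k x"
      proof (rule AE_I2, rule tendsto_eventually)
        fix x
        obtain N :: nat where "\<bar>x\<bar> \<le> real N" using real_arch_simple by blast
        then show "\<forall>\<^sub>F n in sequentially. indicator {- real n..real n} x *\<^sub>R k x = k x"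
          by (intro eventually_sequentiallyI[of N]) (auto simp: indicator_def)
      qed
    qed (use k in \<open>auto simp: indicator_def\<close>)
    show "(\<lambda>n. LBINT x. indicator {- real n..real n} x *\<^sub>R k x) \<longlonglongrightarrow> 0"
      using z' by (simp add: set_lebesgue_integral_def)
  qed
  have main: "(LINT x:A|lborel. k x) = 0" if A: "A \<in> sets borel" for A
  proof -
    have A': "A \<in> sigma_sets UNIV (range (\<lambda>(a,b). {a..b::real}))"
      using A unfolding borel_eq_atLeastAtMost by simp
    have st: "Int_stable (range (\<lambda>(a,b). {a..b::real}))"
    proof (rule Int_stableI)
      fix A B assume "A \<in> range (\<lambda>(a,b). {a..b::real})" "B \<in> range (\<lambda>(a,b). {a..b::real})"
      then obtain a b c d where "A = {a..b}" "B = {c..d}" by auto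
      then show "A \<inter> B \<in> range (\<lambda>(a,b). {a..b::real})"
        by (intro image_eqI[where x = "(max a c, min b d)"]) auto
    qed
    have sub: "range (\<lambda>(a,b). {a..b::real}) \<subseteq> Pow UNIV" by simp
    from st sub A' show ?thesis
    proof (induction rule: sigma_sets_induct_disjoint)
      case (basic A)
      then show ?case using z' by auto
    next
      case empty
      then show ?case by (simp add: set_lebesgue_integral_def)
    next
      case (compl A)
      then have mA[measurable]: "A \<in> sets borel" unfolding borel_eq_atLeastAtMost by simp
      have "(LINT x:A \<union> (UNIV - A)|lborel. k x) = (LINT x:A|lborel. k x) + (LINT x:UNIV - A|lborel. k x)"
        by (intro set_integral_Un si) auto
      then show ?case using compl all by (simp add: set_lebesgue_integral_def)
    next
      case (union A)
      then have mA: "\<And>i. A i \<in> sets borel" unfolding borel_eq_atLeastAtMost by auto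
      have "(LINT x:(\<Union>i. A i)|lborel. k x) = (\<Sum>i. (LINT x:(A i)|lborel. k x))"
        using union(1) mA by (intro lebesgue_integral_countable_add si) (auto simp: disjoint_family_on_def)
      then show ?case using union by simp
    qed
  qed
  have "AE x in lborel. indicator {x. k x > 0} x *\<^sub>R k x = 0"
    using main[of "{x. k x > 0}"] si[of "{x. k x > 0}"]
    by (subst integral_nonneg_eq_0_iff_AE[symmetric])
       (auto simp: set_lebesgue_integral_def set_integrable_def indicator_def)
  moreover have "AE x in lborel. - (indicator {x. k x < 0} x *\<^sub>R k x) = 0"
    using main[of "{x. k x < 0}"] si[of "{x. k x < 0}"]
    by (subst integral_nonneg_eq_0_iff_AE[symmetric])
       (auto simp: set_lebesgue_integral_def set_integrable_def indicator_def)
  ultimately show ?thesis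
    by eventually_elim (auto simp: indicator_def split: if_splits)
qed

section \<open>Locally integrable functions and their pairing with test functions\<close>

definition loc_int :: "(real \<Rightarrow> real) \<Rightarrow> bool" where
  "loc_int f \<longleftrightarrow> f \<in> borel_measurable borel \<and> (\<forall>a b. integrable lborel (\<lambda>x. indicator {a..b} x * f x))"

lemma loc_int_meas: "loc_int f \<Longrightarrow> f \<in> borel_measurable borel"
  by (simp add: loc_int_def)

lemma loc_int_diff: "loc_int f \<Longrightarrow> loc_int g \<Longrightarrow> loc_int (\<lambda>x. f x - g x)"
  unfolding loc_int_def by (auto simp: right_diff_distrib)

lemma loc_int_continuous:
  assumes "continuous_on UNIV f" shows "loc_int f"
proof -
  have "integrable lborel (\<lambda>x. indicator {a..b} x * f x)" for a b
    using borel_integrable_atLeastAtMost'[of a b f] continuous_on_subset[OF assms]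
    by (auto simp: set_integrable_def)
  then show ?thesis unfolding loc_int_def using assms by (auto intro: borel_measurable_continuous_onI)
qed

lemma loc_int_const: "loc_int (\<lambda>x. c)"
  by (intro loc_int_continuous continuous_on_const)

lemma integrable_indicator_Icc: "integrable lborel (indicator {a..b::real} :: real \<Rightarrow> real)"
  by (rule integrable_real_indicator) (auto simp: emeasure_lborel_Icc_eq)

lemma loc_int_mult_bounded:
  assumes f: "loc_int f" and [measurable]: "g \<in> borel_measurable borel"
    and b: "\<And>x. \<bar>g x\<bar> \<le> B" and z: "\<And>x. x < a \<or> x > b \<Longrightarrow> g x = 0"
  shows "integrable lborel (\<lambda>x. f x * g x)"
proof (rule Bochner_Integration.integrable_bound)
  have [measurable]: "f \<in> borel_measurable borel" using f by (rule loc_int_meas)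
  show "integrable lborel (\<lambda>x. B * (indicator {a..b} x * f x))"
    using f unfolding loc_int_def by auto
  show "(\<lambda>x. f x * g x) \<in> borel_measurable lborel" by measurable
  have "B \<ge> 0" using b[of 0] by linarith
  have "norm (f x * g x) \<le> norm (B * (indicator {a..b} x * f x))" for x
  proof (cases "x \<in> {a..b}")
    case True
    then show ?thesis using b[of x] mult_left_mono[OF b[of x], of "\<bar>f x\<bar>"] \<open>B \<ge> 0\<close>
      by (simp add: abs_mult mult.commute)
  next
    case False
    then show ?thesis using z[of x] by auto
  qed
  then show "AE x in lborel. norm (f x * g x) \<le> norm (B * (indicator {a..b} x * f x))" by simp
qed

lemma continuous_compact_support_bounded:
  fixes \<theta> :: "real \<Rightarrow> real"
  assumes "continuous_on UNIV \<theta>" "\<And>x. R < \<bar>x\<bar> \<Longrightarrow> \<theta> x = 0"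
  obtains B where "\<And>x. \<bar>\<theta> x\<bar> \<le> B"
proof -
  have "bounded (\<theta> ` {-R..R})"
    by (intro compact_imp_bounded compact_continuous_image continuous_on_subset[OF assms(1)]) auto
  then obtain B where B: "\<And>x. x \<in> {-R..R} \<Longrightarrow> \<bar>\<theta> x\<bar> \<le> B"
    unfolding bounded_iff by force
  have "\<bar>\<theta> x\<bar> \<le> max B 0" for x
  proof (cases "R < \<bar>x\<bar>")
    case False
    then have "x \<in> {-R..R}" by auto
    then show ?thesis using B[of x] by simp
  qed (simp add: assms(2))
  then show ?thesis using that by blast
qed

lemma test_fun1_bounded:
  assumes "test_fun1 \<theta>"
  obtains B R where "\<And>x. \<bar>\<theta> x\<bar> \<le> B" "\<And>x. R < \<bar>x\<bar> \<Longrightarrow> \<theta> x = 0" "R > 0"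
proof -
  from assms obtain R where R: "\<And>x. R < \<bar>x\<bar> \<Longrightarrow> \<theta> x = 0" and s: "smooth1 \<theta>"
    unfolding test_fun1_def by blast
  obtain B where "\<And>x. \<bar>\<theta> x\<bar> \<le> B"
    by (rule continuous_compact_support_bounded[OF smooth1_continuous[OF s] R]) auto
  then show ?thesis using that[of B "max R 1"] R by auto
qed

lemma test_fun1_measurable: "test_fun1 \<theta> \<Longrightarrow> \<theta> \<in> borel_measurable borel"
  unfolding test_fun1_def using smooth1_measurable by blast

lemma test_fun1_deriv: assumes "test_fun1 \<phi>" shows "test_fun1 (deriv \<phi>)"
proof -
  from assms obtain R where R: "\<And>x. R < \<bar>x\<bar> \<Longrightarrow> \<phi> x = 0" and s: "smooth1 \<phi>"
    unfolding test_fun1_def by blast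
  have "deriv \<phi> x = 0" if "R < \<bar>x\<bar>" for x
  proof (rule DERIV_imp_deriv)
    have "open {x::real. R < \<bar>x\<bar>}" by (intro open_Collect_less continuous_intros)
    then have "eventually (\<lambda>y. \<phi> y = 0) (nhds x)"
      using that R by (auto dest!: eventually_nhds_in_open[of _ x] elim!: eventually_mono)
    then show "(\<phi> has_real_derivative 0) (at x)"
      by (subst DERIV_cong_ev[OF refl _ refl, where g = "\<lambda>x. 0"]) auto
  qed
  then show ?thesis unfolding test_fun1_def using smooth1_deriv(1)[OF s] by blast
qed

lemma loc_int_test_integrable:
  assumes "loc_int f" "test_fun1 \<theta>" shows "integrable lborel (\<lambda>x. f x * \<theta> x)"
proof -
  obtain B R where B: "\<And>x. \<bar>\<theta> x\<bar> \<le> B" "\<And>x. R < \<bar>x\<bar> \<Longrightarrow> \<theta> x = 0" "R > 0"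
    by (rule test_fun1_bounded[OF assms(2)]) blast
  show ?thesis
    by (rule loc_int_mult_bounded[OF assms(1) test_fun1_measurable[OF assms(2)] B(1), where a = "-R" and b = R])
       (use B in auto)
qed

lemma integral_plateau_tendsto:
  assumes f: "loc_int f" and ab: "a < b"
  shows "(\<lambda>n. LBINT x. f x * plateau a b (Suc n) x) \<longlonglongrightarrow> (LINT x:{a..b}|lborel. f x)"
  unfolding set_lebesgue_integral_def
proof (rule integral_dominated_convergence[where w = "\<lambda>x. norm (indicator {a-1..b+1} x * f x)"])
  have [measurable]: "f \<in> borel_measurable borel" using f by (rule loc_int_meas)
  have [measurable]: "plateau a b (Suc n) \<in> borel_measurable borel" for n
    by (rule test_fun1_measurable[OF test_fun1_plateau]) simp
  show "(\<lambda>x. indicator {a..b} x *\<^sub>R f x) \<in> borel_measurable lborel" by measurable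
  show "(\<lambda>x. f x * plateau a b (Suc n) x) \<in> borel_measurable lborel" for n by measurable
  show "integrable lborel (\<lambda>x. norm (indicator {a-1..b+1} x * f x))"
    using f unfolding loc_int_def by (intro integrable_norm) blast
  show "AE x in lborel. (\<lambda>n. f x * plateau a b (Suc n) x) \<longlonglongrightarrow> indicator {a..b} x *\<^sub>R f x"
    using AE_lborel_singleton[of a] AE_lborel_singleton[of b]
  proof eventually_elim
    case (elim x)
    from tendsto_mult[OF tendsto_const LIMSEQ_Suc[OF plateau_tendsto[OF ab]], of x "f x"] elim
    show ?case by (simp add: mult.commute)
  qed
  have "norm (f x * plateau a b (Suc n) x) \<le> norm (indicator {a-1..b+1} x * f x)" for n x
  proof (cases "x \<in> {a-1..b+1}")
    case True
    then show ?thesis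
      using mult_left_mono[OF plateau_bound[of a b "Suc n" x], of "\<bar>f x\<bar>"] by (simp add: abs_mult)
  next
    case False
    then show ?thesis using plateau_outside[of "Suc n" x a b] ab by auto
  qed
  then show "AE x in lborel. norm (f x * plateau a b (Suc n) x) \<le> norm (indicator {a-1..b+1} x * f x)" for n
    by simp
qed

text \<open>The fundamental lemma of the calculus of variations. Plateaus recover the integrals over
  intervals; since \<open>k\<close> is only locally integrable, the interval criterion is applied to
  its truncations, and countably many null sets are united.\<close>

lemma AE_zero_if_test_integrals_zero:
  assumes k: "loc_int k" and z: "\<And>\<theta>. test_fun1 \<theta> \<Longrightarrow> (LBINT x. k x * \<theta> x) = 0"
  shows "AE x in lborel. k x = 0"
proof -
  have zero: "(LINT x:{a..b}|lborel. k x) = 0" if "a < b" for a b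
  proof (rule LIMSEQ_unique[OF integral_plateau_tendsto[OF k that]])
    show "(\<lambda>n. LBINT x. k x * plateau a b (Suc n) x) \<longlonglongrightarrow> 0"
      using z[OF test_fun1_plateau] by simp
  qed
  have "AE x in lborel. indicator {- real n..real n} x * k x = 0" for n
  proof (rule AE_zero_if_Icc_integrals_zero)
    show "integrable lborel (\<lambda>x. indicator {- real n..real n} x * k x)"
      using k unfolding loc_int_def by blast
    fix a b :: real assume "a < b"
    have "(LINT x:{a..b}|lborel. indicator {- real n..real n} x * k x)
        = (LINT x:{max a (- real n)..min b (real n)}|lborel. k x)"
      unfolding set_lebesgue_integral_def
      by (intro Bochner_Integration.integral_cong) (auto simp: indicator_def)
    also have "\<dots> = 0"
    proof (cases "max a (- real n) < min b (real n)")
      case False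
      have "AE x in lborel. indicator {max a (- real n)..min b (real n)} x *\<^sub>R k x = 0"
        using AE_lborel_singleton[of "max a (- real n)"]
        by eventually_elim (use False in \<open>auto simp: indicator_def\<close>)
      then show ?thesis unfolding set_lebesgue_integral_def
        using loc_int_meas[OF k] by (subst integral_cong_AE[where g = "\<lambda>x. 0"]) auto
    qed (rule zero)
    finally show "(LINT x:{a..b}|lborel. indicator {- real n..real n} x * k x) = 0" .
  qed
  then have "AE x in lborel. \<forall>n. indicator {- real n..real n} x * k x = 0"
    by (subst AE_all_countable) simp
  then show ?thesis
  proof eventually_elim
    case (elim x)
    obtain N :: nat where "\<bar>x\<bar> \<le> real N" using real_arch_simple by blast
    then show ?case using elim[rule_format, of N] by (auto simp: indicator_def)
  qed
qed

lemma integral_Ioc_deriv: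
  assumes "a \<le> b" "smooth1 F"
  shows "(LBINT x. indicator {a..b} x * deriv F x) = F b - F a"
proof -
  have "(F has_vector_derivative deriv F x) (at x within {a..b})" for x
    by (rule has_vector_derivative_at_within[OF
          has_real_derivative_iff_has_vector_derivative[THEN iffD1, OF smooth1_deriv(2)[OF assms(2)]]])
  then have "(LBINT x. indicator {a..b} x *\<^sub>R deriv F x) = F b - F a"
    using assms smooth1_deriv(1)[OF assms(2)]
    by (intro integral_FTC_atLeastAtMost) (auto intro: continuous_on_subset[OF smooth1_continuous])
  then show ?thesis by simp
qed

text \<open>An antiderivative normalised to vanish at \<open>-R-1\<close>, left of the support,
  vanishes everywhere further left; the zero integral is exactly what makes it vanish on the right
  too.\<close>

lemma test_fun1_antideriv:
  assumes "test_fun1 \<theta>" "(LBINT x. \<theta> x) = 0"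
  obtains \<phi> where "test_fun1 \<phi>" "deriv \<phi> = \<theta>"
proof -
  obtain B R where B: "\<And>x. \<bar>\<theta> x\<bar> \<le> B" "\<And>x. R < \<bar>x\<bar> \<Longrightarrow> \<theta> x = 0" "R > 0"
    by (rule test_fun1_bounded[OF assms(1)]) blast
  have s: "smooth1 \<theta>" using assms unfolding test_fun1_def by blast
  have "isCont \<theta> x" for x
    using smooth1_continuous[OF s] by (simp add: continuous_on_eq_continuous_at)
  then obtain T where T: "\<And>x. (T has_real_derivative \<theta> x) (at x)"
    using einterval_antiderivative[of "-\<infinity>" "\<infinity>" \<theta>]
    by (auto simp: has_real_derivative_iff_has_vector_derivative)
  define \<phi> where "\<phi> = (\<lambda>x. T x - T (-R - 1))"
  have d: "(\<phi> has_real_derivative \<theta> x) (at x)" for x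
    unfolding \<phi>_def by (auto intro!: derivative_eq_intros T)
  have sm: "smooth1 \<phi>"
    by (rule smooth1.intros[OF _ _ s])
       (use d in \<open>auto intro: DERIV_continuous continuous_at_imp_continuous_on\<close>)
  have dd: "deriv \<phi> = \<theta>" using d by (auto intro: DERIV_imp_deriv)
  have "\<phi> x = 0" if "R + 1 < \<bar>x\<bar>" for x
  proof (cases "x < 0")
    case True
    have "\<phi> (-R-1) - \<phi> x = (LBINT y. indicator {x..-R-1} y * \<theta> y)"
      using integral_Ioc_deriv[of x "-R-1" \<phi>] sm dd True that by simp
    also have "\<dots> = (\<integral>y. 0 \<partial>(lborel :: real measure))"
      using B by (intro Bochner_Integration.integral_cong) (auto simp: indicator_def)
    finally show ?thesis by (simp add: \<phi>_def)
  next
    case False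
    have "\<phi> x - \<phi> (-R-1) = (LBINT y. indicator {-R-1..x} y * \<theta> y)"
      using integral_Ioc_deriv[of "-R-1" x \<phi>] sm dd False that B by simp
    also have "\<dots> = (LBINT y. \<theta> y)"
    proof (intro Bochner_Integration.integral_cong refl)
      fix y
      show "indicator {-R-1..x} y * \<theta> y = \<theta> y"
        using False that B(2)[of y] by (cases "R < \<bar>y\<bar>") (auto simp: indicator_def)
    qed
    finally show ?thesis using assms by (simp add: \<phi>_def)
  qed
  then have "test_fun1 \<phi>" unfolding test_fun1_def using sm by blast
  then show ?thesis using that dd by blast
qed

lemma test_fun1_lincomb:
  assumes "test_fun1 f" "test_fun1 g" shows "test_fun1 (\<lambda>x. f x - c * g x)"
proof -
  obtain R1 R2 where "\<And>x. R1 < \<bar>x\<bar> \<Longrightarrow> f x = 0" "\<And>x. R2 < \<bar>x\<bar> \<Longrightarrow> g x = 0"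
    using assms unfolding test_fun1_def by blast
  then have "\<forall>x. max R1 R2 < \<bar>x\<bar> \<longrightarrow> f x - c * g x = 0" by auto
  moreover have "smooth1 (\<lambda>x. f x - c * g x)"
    using assms unfolding test_fun1_def by (intro smooth1_diff smooth1_cmult) auto
  ultimately show ?thesis unfolding test_fun1_def by blast
qed

lemma ex_test_fun1_integral_1: "\<exists>\<theta>. test_fun1 \<theta> \<and> (LBINT x. \<theta> x) = 1"
proof -
  have "(\<lambda>n. LBINT x. 1 * plateau 0 1 (Suc n) x) \<longlonglongrightarrow> (LINT x:{0..1::real}|lborel. 1)"
    by (rule integral_plateau_tendsto[OF loc_int_const]) simp
  also have "(LINT x:{0..1::real}|lborel. 1::real) = 1"
    by (simp add: set_lebesgue_integral_def)
  finally have "\<forall>\<^sub>F n in sequentially. (LBINT x. plateau 0 1 (Suc n) x) > 0"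
    by (intro order_tendstoD(1)[of _ 1]) simp_all
  then obtain n where n: "(LBINT x. plateau 0 1 (Suc n) x) > 0"
    using eventually_happens'[OF sequentially_bot] by blast
  define I where "I = (LBINT x. plateau 0 1 (Suc n) x)"
  have tf: "test_fun1 (plateau 0 1 (Suc n))" by (rule test_fun1_plateau) simp
  \<comment> \<open>Division by \<open>I\<close>, disguised as a linear combination so that
    \<open>test_fun1_lincomb\<close> applies.\<close>
  have "test_fun1 (\<lambda>x. plateau 0 1 (Suc n) x - (1 - 1 / I) * plateau 0 1 (Suc n) x)"
    by (rule test_fun1_lincomb[OF tf tf])
  moreover have "(\<lambda>x. plateau 0 1 (Suc n) x - (1 - 1 / I) * plateau 0 1 (Suc n) x) = (\<lambda>x. plateau 0 1 (Suc n) x / I)"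
    by (auto simp: algebra_simps)
  ultimately show ?thesis using n unfolding I_def[symmetric] by (intro exI[of _ "\<lambda>x. plateau 0 1 (Suc n) x / I"]) (simp add: I_def)
qed

text \<open>The du Bois-Reymond argument: with a fixed \<open>\<theta>0\<close> of integral one,
  \<open>\<theta> - I \<theta>0\<close> has integral zero and is therefore the derivative of a test
  function. Hence \<open>h\<close> acts on every \<open>\<theta>\<close> as the constant
  \<open>c\<close>, its pairing with \<open>\<theta>0\<close>.\<close>

lemma weak_deriv_zero_const:
  assumes h: "loc_int h" and z: "\<And>\<phi>. test_fun1 \<phi> \<Longrightarrow> (LBINT x. h x * deriv \<phi> x) = 0"
  shows "\<exists>c. AE x in lborel. h x = c"
proof -
  obtain \<theta>0 where t0: "test_fun1 \<theta>0" "(LBINT x. \<theta>0 x) = 1" using ex_test_fun1_integral_1 by blast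
  define c where "c = (LBINT x. h x * \<theta>0 x)"
  have "AE x in lborel. h x - c = 0"
  proof (rule AE_zero_if_test_integrals_zero)
    show "loc_int (\<lambda>x. h x - c)" by (intro loc_int_diff h loc_int_const)
    fix \<theta> assume t: "test_fun1 \<theta>"
    define I where "I = (LBINT x. \<theta> x)"
    have it: "integrable lborel \<theta>" "integrable lborel \<theta>0"
      using loc_int_test_integrable[OF loc_int_const t, of 1] loc_int_test_integrable[OF loc_int_const t0(1), of 1] by simp_all
    have iht: "integrable lborel (\<lambda>x. h x * \<theta> x)" "integrable lborel (\<lambda>x. h x * \<theta>0 x)"
      using loc_int_test_integrable[OF h] t t0 by auto
    have "(LBINT x. \<theta> x - I * \<theta>0 x) = 0" using it t0 by (simp add: I_def)
    then obtain \<phi> where p: "test_fun1 \<phi>" "deriv \<phi> = (\<lambda>x. \<theta> x - I * \<theta>0 x)"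
      using test_fun1_antideriv[OF test_fun1_lincomb[OF t t0(1)]] by metis
    have "0 = (LBINT x. h x * (\<theta> x - I * \<theta>0 x))" using z[OF p(1)] p(2) by simp
    also have "\<dots> = (LBINT x. h x * \<theta> x - I * (h x * \<theta>0 x))"
      by (intro Bochner_Integration.integral_cong) (auto simp: algebra_simps)
    also have "\<dots> = (LBINT x. h x * \<theta> x) - I * c" using iht by (simp add: c_def)
    also have "\<dots> = (LBINT x. (h x - c) * \<theta> x)"
      using iht it by (simp add: left_diff_distrib I_def)
    finally show "(LBINT x. (h x - c) * \<theta> x) = 0" by simp
  qed
  then show ?thesis by (intro exI[of _ c]) simp
qed

text \<open>The difference of the two indicators turns the integral into the oriented integral from \<open>0\<close> to \<open>x\<close>.\<close>
definition prim :: "(real \<Rightarrow> real) \<Rightarrow> real \<Rightarrow> real" where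
  "prim g x = (LBINT y. (of_bool (y \<le> x) - of_bool (y \<le> 0)) * g y)"

lemma prim_integrable:
  assumes "loc_int g"
  shows "integrable lborel (\<lambda>y. (of_bool (y \<le> x) - of_bool (y \<le> 0)) * g y)"
proof -
  have "integrable lborel (\<lambda>y. g y * (of_bool (y \<le> x) - of_bool (y \<le> 0)))"
    by (rule loc_int_mult_bounded[OF assms, where B = 1 and a = "min x 0" and b = "max x 0"]) auto
  then show ?thesis by (simp add: mult.commute)
qed

lemma prim_diff:
  assumes g: "loc_int g" and "a \<le> b"
  shows "prim g b - prim g a = (LINT y:{a..b}|lborel. g y)"
proof -
  have [measurable]: "g \<in> borel_measurable borel" using g by (rule loc_int_meas)
  have "prim g b - prim g a = (LBINT y. (of_bool (y \<le> b) - of_bool (y \<le> 0)) * g y - (of_bool (y \<le> a) - of_bool (y \<le> 0)) * g y)"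
    unfolding prim_def by (rule Bochner_Integration.integral_diff[symmetric]) (rule prim_integrable[OF g])+
  also have "\<dots> = (LINT y:{a..b}|lborel. g y)"
    unfolding set_lebesgue_integral_def
  proof (rule integral_cong_AE)
    show "AE y in lborel. (of_bool (y \<le> b) - of_bool (y \<le> 0)) * g y - (of_bool (y \<le> a) - of_bool (y \<le> 0)) * g y = indicator {a..b} y *\<^sub>R g y"
      using AE_lborel_singleton[of a] by eventually_elim (use assms(2) in \<open>auto simp: indicator_def\<close>)
  qed measurable
  finally show ?thesis .
qed

lemma prim_measurable [measurable]:
  assumes [measurable]: "g \<in> borel_measurable borel" shows "prim g \<in> borel_measurable borel"
proof -
  have "(\<lambda>x. LBINT y. (of_bool (y \<le> x) - of_bool (y \<le> 0)) * g y) \<in> borel_measurable borel"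
    by (rule lborel.borel_measurable_lebesgue_integral) measurable
  then show ?thesis unfolding prim_def[abs_def] .
qed

lemma integral_deriv_test:
  assumes "test_fun1 \<phi>"
  shows "(LBINT x. of_bool (y \<le> x) * deriv \<phi> x) = - \<phi> y" "(LBINT x. deriv \<phi> x) = 0"
proof -
  from assms obtain R where R: "\<And>x. R < \<bar>x\<bar> \<Longrightarrow> \<phi> x = 0" and s: "smooth1 \<phi>"
    unfolding test_fun1_def by blast
  from test_fun1_deriv[OF assms] obtain R' where R': "\<And>x. R' < \<bar>x\<bar> \<Longrightarrow> deriv \<phi> x = 0"
    unfolding test_fun1_def by blast
  define M where "M = \<bar>R\<bar> + \<bar>R'\<bar> + \<bar>y\<bar> + 1"
  have "(LBINT x. of_bool (y \<le> x) * deriv \<phi> x) = (LBINT x. indicator {y..M} x * deriv \<phi> x)"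
    by (intro Bochner_Integration.integral_cong) (auto simp: indicator_def M_def intro!: R')
  also have "\<dots> = \<phi> M - \<phi> y" by (rule integral_Ioc_deriv[OF _ s]) (auto simp: M_def)
  finally show "(LBINT x. of_bool (y \<le> x) * deriv \<phi> x) = - \<phi> y"
    using R[of M] by (simp add: M_def)
  have "(LBINT x. deriv \<phi> x) = (LBINT x. indicator {-M..M} x * deriv \<phi> x)"
    by (intro Bochner_Integration.integral_cong) (auto simp: indicator_def M_def intro!: R')
  also have "\<dots> = \<phi> M - \<phi> (-M)" by (rule integral_Ioc_deriv[OF _ s]) (auto simp: M_def)
  finally show "(LBINT x. deriv \<phi> x) = 0"
    using R[of M] R[of "-M"] by (simp add: M_def)
qed

text \<open>Fubini: for fixed \<open>y\<close>, integrating \<open>deriv \<phi>\<close> over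
  \<open>x \<ge> y\<close> gives \<open>- \<phi> y\<close>, while the part of the kernel that does
  not depend on \<open>x\<close> meets the integral of \<open>deriv \<phi>\<close> over the line,
  which is zero.\<close>

lemma weak_deriv_prim:
  assumes g: "loc_int g" shows "weak_deriv (prim g) g"
  unfolding weak_deriv_def
proof (intro allI impI)
  fix \<phi> assume p: "test_fun1 \<phi>"
  note p' = test_fun1_deriv[OF p]
  have [measurable]: "g \<in> borel_measurable borel" "deriv \<phi> \<in> borel_measurable borel"
    using loc_int_meas[OF g] test_fun1_measurable[OF p'] by auto
  obtain B R where R: "\<And>x. \<bar>deriv \<phi> x\<bar> \<le> B" "\<And>x. R < \<bar>x\<bar> \<Longrightarrow> deriv \<phi> x = 0" "R > 0"
    by (rule test_fun1_bounded[OF p']) blast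
  define K where "K = (\<lambda>x y. (of_bool (y \<le> x) - of_bool (y \<le> 0)) * g y * deriv \<phi> x)"
  have iK: "integrable (lborel \<Otimes>\<^sub>M lborel) (case_prod K)"
  proof (rule Bochner_Integration.integrable_bound)
    show "integrable (lborel \<Otimes>\<^sub>M lborel) (\<lambda>(x,y). deriv \<phi> x * (indicator {-R..R} y * g y))"
      using loc_int_test_integrable[OF loc_int_const p', of 1] g
      by (intro integrable_prod_mult) (auto simp: loc_int_def)
    show "case_prod K \<in> borel_measurable (lborel \<Otimes>\<^sub>M lborel)" unfolding K_def by measurable
    have "norm (K x y) \<le> norm (deriv \<phi> x * (indicator {-R..R} y * g y))" for x y
    proof (cases "R < \<bar>x\<bar>")
      case False
      then show ?thesis by (auto simp: K_def indicator_def abs_mult)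
    qed (simp add: K_def R)
    then show "AE p in lborel \<Otimes>\<^sub>M lborel. norm (case_prod K p) \<le> norm (case p of (x,y) \<Rightarrow> deriv \<phi> x * (indicator {-R..R} y * g y))"
      by auto
  qed
  have "(LBINT x. prim g x * deriv \<phi> x) = (LBINT x. (LBINT y. K x y))"
    unfolding prim_def K_def by (intro Bochner_Integration.integral_cong refl) (simp add: mult.assoc[symmetric])
  also have "\<dots> = (LBINT y. (LBINT x. K x y))"
    by (rule lborel_pair.Fubini_integral[OF iK, symmetric])
  also have "\<dots> = (LBINT y. - (g y * \<phi> y))"
  proof (intro Bochner_Integration.integral_cong refl)
    fix y
    have i: "integrable lborel (\<lambda>x. of_bool (y \<le> x) * deriv \<phi> x)" "integrable lborel (deriv \<phi>)"
    proof -
      show j: "integrable lborel (deriv \<phi>)"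
        using loc_int_test_integrable[OF loc_int_const p', of 1] by simp
      show "integrable lborel (\<lambda>x. of_bool (y \<le> x) * deriv \<phi> x)"
        by (rule Bochner_Integration.integrable_bound[OF j]) auto
    qed
    have "(LBINT x. K x y) = (LBINT x. g y * (of_bool (y \<le> x) * deriv \<phi> x) - (of_bool (y \<le> 0) * g y) * deriv \<phi> x)"
      unfolding K_def by (intro Bochner_Integration.integral_cong refl) (simp add: algebra_simps)
    also have "\<dots> = - (g y * \<phi> y)"
      using i integral_deriv_test[OF p] by simp
    finally show "(LBINT x. K x y) = - (g y * \<phi> y)" .
  qed
  finally show "(LBINT x. prim g x * deriv \<phi> x) = - (LBINT x. g x * \<phi> x)" by simp
qed

lemma loc_int_prim:
  assumes g: "loc_int g" shows "loc_int (prim g)"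
proof -
  have [measurable]: "g \<in> borel_measurable borel" using g by (rule loc_int_meas)
  have "integrable lborel (\<lambda>x. indicator {a..b} x * prim g x)" for a b
  proof -
    \<comment> \<open>The interval contains \<open>0\<close>, \<open>a\<close> and \<open>b\<close>,
      so \<open>D\<close> bounds \<open>prim g\<close> uniformly on \<open>{a..b}\<close>.\<close>
    define D where "D = (LBINT y. \<bar>indicator {-(\<bar>a\<bar>+\<bar>b\<bar>)..\<bar>a\<bar>+\<bar>b\<bar>} y * g y\<bar>)"
    have bd: "\<bar>prim g x\<bar> \<le> D" if "x \<in> {a..b}" for x
      unfolding prim_def D_def
    proof (rule order_trans[OF integral_abs_bound integral_mono])
      show "integrable lborel (\<lambda>y. \<bar>(of_bool (y \<le> x) - of_bool (y \<le> 0)) * g y\<bar>)"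
        using prim_integrable[OF g] by (rule integrable_abs)
      show "integrable lborel (\<lambda>y. \<bar>indicator {-(\<bar>a\<bar>+\<bar>b\<bar>)..\<bar>a\<bar>+\<bar>b\<bar>} y * g y\<bar>)"
        using g by (auto simp: loc_int_def)
      fix y
      have "of_bool (y \<le> x) - of_bool (y \<le> 0) = (0::real)" if "y \<notin> {-(\<bar>a\<bar>+\<bar>b\<bar>)..\<bar>a\<bar>+\<bar>b\<bar>}"
      proof -
        have "y \<le> x \<longleftrightarrow> y \<le> 0" using that \<open>x \<in> {a..b}\<close> by auto
        then show ?thesis by simp
      qed
      moreover have "\<bar>of_bool (y \<le> x) - of_bool (y \<le> 0)\<bar> \<le> (1::real)" by simp
      ultimately show "\<bar>(of_bool (y \<le> x) - of_bool (y \<le> 0)) * g y\<bar> \<le> \<bar>indicator {-(\<bar>a\<bar>+\<bar>b\<bar>)..\<bar>a\<bar>+\<bar>b\<bar>} y * g y\<bar>"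
        by (cases "y \<in> {-(\<bar>a\<bar>+\<bar>b\<bar>)..\<bar>a\<bar>+\<bar>b\<bar>}") (simp_all add: abs_mult mult_left_le_one_le)
    qed
    show ?thesis
    proof (rule Bochner_Integration.integrable_bound[of _ "\<lambda>x. D * indicator {a..b} x"])
      show "AE x in lborel. norm (indicator {a..b} x * prim g x) \<le> norm (D * indicator {a..b} x)"
        using bd by (intro AE_I2) (auto simp: indicator_def intro: order_trans[OF _ abs_ge_self])
    qed (auto intro: integrable_indicator_Icc)
  qed
  then show ?thesis unfolding loc_int_def by auto
qed

lemma weak_deriv_imp_prim:
  assumes "weak_deriv f g" and f: "loc_int f" and g: "loc_int g"
  shows "\<exists>c. AE x in lborel. f x = c + prim g x"
proof -
  have "\<exists>c. AE x in lborel. f x - prim g x = c"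
  proof (rule weak_deriv_zero_const)
    show "loc_int (\<lambda>x. f x - prim g x)" by (intro loc_int_diff f loc_int_prim g)
    fix \<phi> assume p: "test_fun1 \<phi>"
    show "(LBINT x. (f x - prim g x) * deriv \<phi> x) = 0"
      using loc_int_test_integrable[OF f test_fun1_deriv[OF p]]
        loc_int_test_integrable[OF loc_int_prim[OF g] test_fun1_deriv[OF p]]
        assms(1) weak_deriv_prim[OF g] p
      by (simp add: left_diff_distrib weak_deriv_def)
  qed
  then show ?thesis by (auto simp: diff_eq_eq)
qed

section \<open>Square-integrable functions and Sobolev representatives\<close>

lemma FTC_nonneg_Ioi:
  fixes f F :: "real \<Rightarrow> real"
  assumes F: "\<And>x. a < x \<Longrightarrow> (F has_real_derivative f x) (at x)"
    and f: "\<And>x. a < x \<Longrightarrow> isCont f x" and nonneg: "\<And>x. a < x \<Longrightarrow> 0 \<le> f x"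
    and A: "(F \<longlongrightarrow> A) (at_right a)" and B: "(F \<longlongrightarrow> B) at_top"
  shows "integrable lborel (\<lambda>x. indicator {a<..} x * f x)"
    and "(LBINT x. indicator {a<..} x * f x) = B - A"
proof -
  have 1: "set_integrable lborel (einterval a \<infinity>) f"
    by (rule interval_integral_FTC_nonneg(1)[where F = F and A = A and B = B])
       (use assms in \<open>auto simp: ereal_tendsto_simps\<close>)
  have 2: "(LBINT x=a..\<infinity>. f x) = B - A"
    by (rule interval_integral_FTC_nonneg(2)) (use assms in \<open>auto simp: ereal_tendsto_simps\<close>)
  show "integrable lborel (\<lambda>x. indicator {a<..} x * f x)"
    using 1 by (simp add: set_integrable_def)
  show "(LBINT x. indicator {a<..} x * f x) = B - A"
    using 2 by (simp add: interval_integral_to_infinity_eq set_lebesgue_integral_def)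
qed

lemma FTC_nonneg_Ioo:
  fixes f F :: "real \<Rightarrow> real"
  assumes "a < b" and F: "\<And>x. a < x \<Longrightarrow> x < b \<Longrightarrow> (F has_real_derivative f x) (at x)"
    and f: "\<And>x. a < x \<Longrightarrow> x < b \<Longrightarrow> isCont f x" and nonneg: "\<And>x. a < x \<Longrightarrow> x < b \<Longrightarrow> 0 \<le> f x"
    and A: "(F \<longlongrightarrow> A) (at_right a)" and B: "(F \<longlongrightarrow> B) (at_left b)"
  shows "integrable lborel (\<lambda>x. indicator {a<..<b} x * f x)"
    and "(LBINT x. indicator {a<..<b} x * f x) = B - A"
proof -
  have 1: "set_integrable lborel (einterval a b) f"
    by (rule interval_integral_FTC_nonneg(1)[where F = F and A = A and B = B])
       (use assms in \<open>auto simp: ereal_tendsto_simps\<close>)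
  have 2: "(LBINT x=a..b. f x) = B - A"
    by (rule interval_integral_FTC_nonneg(2)) (use assms in \<open>auto simp: ereal_tendsto_simps\<close>)
  show "integrable lborel (\<lambda>x. indicator {a<..<b} x * f x)"
    using 1 by (simp add: set_integrable_def)
  show "(LBINT x. indicator {a<..<b} x * f x) = B - A"
    using 2 assms(1) by (simp add: interval_lebesgue_integral_def set_lebesgue_integral_def)
qed

lemma L2_iff: "L2 f \<longleftrightarrow> f \<in> borel_measurable borel \<and> integrable lborel (\<lambda>x. (f x)^2)"
  by (simp add: L2_def)

lemma L2_meas: "L2 f \<Longrightarrow> f \<in> borel_measurable borel"
  by (simp add: L2_iff)

lemma L2_norm_nonneg: "0 \<le> L2_norm f"
  by (simp add: L2_norm_def)

lemma L2_norm_sq: "(L2_norm f)^2 = (LBINT x. (f x)^2)"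
  by (simp add: L2_norm_def)

lemma L2_norm_cong_AE: "L2 f \<Longrightarrow> L2 g \<Longrightarrow> AE x in lborel. f x = g x \<Longrightarrow> L2_norm f = L2_norm g"
  unfolding L2_norm_def
  by (intro arg_cong[where f = sqrt] integral_cong_AE) (auto simp: L2_iff elim!: eventually_mono)

lemma L2_bound:
  assumes "L2 f" "g \<in> borel_measurable borel" "\<And>x. \<bar>g x\<bar> \<le> \<bar>f x\<bar>"
  shows "L2 g"
  unfolding L2_iff
proof
  show "integrable lborel (\<lambda>x. (g x)^2)"
    by (rule Bochner_Integration.integrable_bound[of _ "\<lambda>x. (f x)^2"])
       (use assms in \<open>auto simp: L2_iff abs_le_square_iff\<close>)
qed (rule assms)

lemma L2_cmult: "L2 f \<Longrightarrow> L2 (\<lambda>x. c * f x)"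
  by (auto simp: L2_iff power_mult_distrib)

lemma L2_mult_integrable:
  assumes "L2 f" "L2 g" shows "integrable lborel (\<lambda>x. f x * g x)"
proof (rule Bochner_Integration.integrable_bound[of _ "\<lambda>x. (f x)^2 + (g x)^2"])
  show "integrable lborel (\<lambda>x. (f x)^2 + (g x)^2)" using assms by (auto simp: L2_iff)
  have [measurable]: "f \<in> borel_measurable borel" "g \<in> borel_measurable borel"
    using assms by (auto simp: L2_iff)
  show "(\<lambda>x. f x * g x) \<in> borel_measurable lborel" by measurable
  have "norm (f x * g x) \<le> norm ((f x)^2 + (g x)^2)" for x
  proof -
    have "2 * (\<bar>f x\<bar> * \<bar>g x\<bar>) \<le> (f x)^2 + (g x)^2"
      using sum_squares_bound[of "\<bar>f x\<bar>" "\<bar>g x\<bar>"] by simp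
    moreover have "0 \<le> \<bar>f x\<bar> * \<bar>g x\<bar>" by simp
    ultimately have "\<bar>f x\<bar> * \<bar>g x\<bar> \<le> (f x)^2 + (g x)^2" by linarith
    then show ?thesis by (simp add: abs_mult)
  qed
  then show "AE x in lborel. norm (f x * g x) \<le> norm ((f x)^2 + (g x)^2)" by simp
qed

lemma L2_add: assumes "L2 f" "L2 g" shows "L2 (\<lambda>x. f x + g x)"
proof -
  have "integrable lborel (\<lambda>x. (f x)^2 + 2 * (f x * g x) + (g x)^2)"
    using assms L2_mult_integrable[OF assms] by (auto simp: L2_iff)
  then have "integrable lborel (\<lambda>x. (f x + g x)^2)" by (simp add: power2_sum algebra_simps)
  then show ?thesis using assms by (auto simp: L2_iff)
qed

lemma L2_diff: "L2 f \<Longrightarrow> L2 g \<Longrightarrow> L2 (\<lambda>x. f x - g x)"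
  using L2_add[OF _ L2_cmult[of g "-1"], of f] by simp

lemma L2_mult_bounded:
  assumes "L2 f" "g \<in> borel_measurable borel" "\<And>x. \<bar>g x\<bar> \<le> B"
  shows "L2 (\<lambda>x. g x * f x)"
proof (rule L2_bound[OF L2_cmult[OF assms(1), of B]])
  show "(\<lambda>x. g x * f x) \<in> borel_measurable borel" using assms by (auto simp: L2_iff)
  fix x
  show "\<bar>g x * f x\<bar> \<le> \<bar>B * f x\<bar>"
    unfolding abs_mult by (intro mult_right_mono order_trans[OF assms(3) abs_ge_self]) simp
qed

lemma L2_norm_mult_bounded:
  assumes "L2 f" "g \<in> borel_measurable borel" "\<And>x. \<bar>g x\<bar> \<le> B" "0 \<le> B"
  shows "L2_norm (\<lambda>x. g x * f x) \<le> B * L2_norm f"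
proof -
  have "(LBINT x. (g x * f x)^2) \<le> (LBINT x. B^2 * (f x)^2)"
  proof (rule integral_mono)
    show "integrable lborel (\<lambda>x. (g x * f x)^2)"
      using L2_mult_bounded[OF assms(1-3)] by (auto simp: L2_iff)
    show "integrable lborel (\<lambda>x. B^2 * (f x)^2)" using assms by (auto simp: L2_iff)
    fix x
    have "(g x)^2 \<le> B^2" using assms(3)[of x] assms(4) abs_le_square_iff[of "g x" B] by simp
    then show "(g x * f x)^2 \<le> B^2 * (f x)^2"
      by (simp add: power_mult_distrib mult_right_mono)
  qed
  also have "\<dots> = (B * L2_norm f)^2" by (simp add: power_mult_distrib L2_norm_sq)
  finally have "(L2_norm (\<lambda>x. g x * f x))^2 \<le> (B * L2_norm f)^2" by (simp add: L2_norm_sq)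
  then show ?thesis by (rule power2_le_imp_le) (simp add: assms(4) L2_norm_nonneg)
qed

lemma L2_Cauchy_Schwarz:
  assumes f: "L2 f" and g: "L2 g"
  shows "\<bar>LBINT x. f x * g x\<bar> \<le> L2_norm f * L2_norm g"
proof -
  define a where "a = (L2_norm f)^2"
  define b where "b = (L2_norm g)^2"
  define c where "c = (LBINT x. f x * g x)"
  have i: "integrable lborel (\<lambda>x. (f x)^2)" "integrable lborel (\<lambda>x. (g x)^2)" "integrable lborel (\<lambda>x. f x * g x)"
    using f g L2_mult_integrable[OF f g] by (auto simp: L2_iff)
  have q: "0 \<le> s^2 * a + 2 * s * c + b" for s
  proof -
    have "0 \<le> (LBINT x. (s * f x + g x)^2)" by simp
    also have "\<dots> = (LBINT x. s^2 * (f x)^2 + 2 * s * (f x * g x) + (g x)^2)"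
      by (intro Bochner_Integration.integral_cong) (auto simp: power2_sum power_mult_distrib algebra_simps)
    also have "\<dots> = s^2 * a + 2 * s * c + b"
      using i by (simp add: a_def b_def c_def L2_norm_sq)
    finally show ?thesis .
  qed
  have "c^2 \<le> a * b"
  proof (cases "a = 0")
    case True
    have "c = 0"
    proof (rule ccontr)
      assume "c \<noteq> 0"
      \<comment> \<open>With \<open>a = 0\<close> the quadratic form is affine in \<open>s\<close>;
        this \<open>s\<close> gives it the value \<open>-1\<close>.\<close>
      then have "2 * (- (b + 1) / (2 * c)) * c = - (b + 1)" by (simp add: field_simps)
      then show False using q[of "- (b + 1) / (2 * c)"] True by simp
    qed
    then show ?thesis using True by simp
  next
    case False
    then have "a > 0" by (simp add: a_def)
    have "0 \<le> a * ((- c / a)^2 * a + 2 * (- c / a) * c + b)"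
      using q[of "- c / a"] \<open>a > 0\<close> by simp
    also have "\<dots> = a * b - c^2" using \<open>a > 0\<close> by (simp add: field_simps power2_eq_square)
    finally show ?thesis by simp
  qed
  then have "\<bar>c\<bar>^2 \<le> (L2_norm f * L2_norm g)^2" by (simp add: a_def b_def power_mult_distrib)
  then show ?thesis unfolding c_def[symmetric]
    by (rule power2_le_imp_le) (simp add: L2_norm_nonneg)
qed

lemma L2_affine:
  assumes "L2 f" "c = 1 \<or> c = -1"
  shows "L2 (\<lambda>s. f (t + c * s))" "L2_norm (\<lambda>s. f (t + c * s)) = L2_norm f"
proof -
  show "L2 (\<lambda>s. f (t + c * s))"
    using assms lborel_integrable_real_affine[of "\<lambda>x. (f x)^2" c t] by (auto simp: L2_iff)
  show "L2_norm (\<lambda>s. f (t + c * s)) = L2_norm f"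
    unfolding L2_norm_def using assms(2) lborel_integral_real_affine[of c "\<lambda>x. (f x)^2" t] by auto
qed

lemma L2_indicator_Icc:
  assumes "a \<le> b" shows "L2 (indicator {a..b})" "L2_norm (indicator {a..b}) = sqrt (b - a)"
proof -
  have *: "(\<lambda>x::real. (indicator {a..b} x :: real)^2) = indicator {a..b}" by (auto simp: indicator_def)
  show "L2 (indicator {a..b})" unfolding L2_iff * using integrable_indicator_Icc by auto
  show "L2_norm (indicator {a..b}) = sqrt (b - a)"
    unfolding L2_norm_def * using assms by simp
qed

lemma L2_loc_int: assumes "L2 f" shows "loc_int f"
proof -
  have "integrable lborel (\<lambda>x. indicator {a..b} x * f x)" for a b
    using L2_mult_integrable[OF L2_indicator_Icc(1) assms, of a b] by (cases "a \<le> b") auto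
  then show ?thesis using assms by (simp add: loc_int_def L2_iff)
qed

text \<open>The absolutely continuous representative \<open>f\<close> of an \<open>H1\<close> class
  together with its derivative \<open>g\<close>. Since the identity holds for all endpoints,
  estimates on \<open>f\<close> hold at every point and not only almost everywhere.\<close>

definition sob :: "(real \<Rightarrow> real) \<Rightarrow> (real \<Rightarrow> real) \<Rightarrow> bool" where
  "sob f g \<longleftrightarrow> L2 f \<and> L2 g \<and> (\<forall>a b. a \<le> b \<longrightarrow> f b - f a = (LINT y:{a..b}|lborel. g y))"

lemma sob_diff:
  assumes "sob f g" "sob f' g'" shows "sob (\<lambda>x. f x - f' x) (\<lambda>x. g x - g' x)"
proof -
  have "(f b - f' b) - (f a - f' a) = (LINT y:{a..b}|lborel. g y - g' y)" if "a \<le> b" for a b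
  proof -
    have "set_integrable lborel {a..b} g" "set_integrable lborel {a..b} g'"
      using L2_loc_int[of g] L2_loc_int[of g'] assms by (auto simp: sob_def loc_int_def set_integrable_def)
    then have "(LINT y:{a..b}|lborel. g y - g' y) = (LINT y:{a..b}|lborel. g y) - (LINT y:{a..b}|lborel. g' y)"
      by (rule set_integral_diff)
    moreover have "f b - f a = (LINT y:{a..b}|lborel. g y)" "f' b - f' a = (LINT y:{a..b}|lborel. g' y)"
      using assms that by (auto simp: sob_def)
    ultimately show ?thesis by linarith
  qed
  then show ?thesis using assms by (auto simp: sob_def intro: L2_diff)
qed

lemma sob_Hoelder:
  assumes "sob f g" shows "\<bar>f x - f y\<bar> \<le> sqrt \<bar>x - y\<bar> * L2_norm g"
proof -
  have *: "\<bar>f b - f a\<bar> \<le> sqrt (b - a) * L2_norm g" if "a \<le> b" for a b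
  proof -
    have "f b - f a = (LBINT x. indicator {a..b} x * g x)"
      using assms that by (simp add: sob_def set_lebesgue_integral_def)
    then show ?thesis
      using L2_Cauchy_Schwarz[OF L2_indicator_Icc(1)[OF that], of g] assms L2_indicator_Icc(2)[OF that]
      by (simp add: sob_def)
  qed
  show ?thesis using *[of x y] *[of y x] by (cases "x \<le> y") (auto simp: abs_minus_commute)
qed

text \<open>For \<open>y\<close> within distance one of \<open>x\<close>, the Hoelder bound gives
  \<open>(f x)^2 \<le> 2 (f y)^2 + 2 (L2_norm g)^2\<close>; this is averaged over a unit
  interval.\<close>

lemma sob_sup:
  assumes "sob f g" shows "(f x)^2 \<le> 2 * (L2_norm f)^2 + 2 * (L2_norm g)^2"
proof -
  have i: "integrable lborel (\<lambda>y. (f y)^2)" using assms by (simp add: sob_def L2_iff)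
  have ii: "integrable lborel (\<lambda>y. indicator {x..x+1} y * (f y)^2)"
    by (rule Bochner_Integration.integrable_bound[OF i])
       (use assms in \<open>auto simp: sob_def L2_iff indicator_def\<close>)
  have "(LBINT y. indicator {x..x+1} y * (f x)^2)
      \<le> (LBINT y. 2 * (indicator {x..x+1} y * (f y)^2) + 2 * (L2_norm g)^2 * indicator {x..x+1} y)"
  proof (rule integral_mono)
    show "integrable lborel (\<lambda>y. indicator {x..x+1} y * (f x)^2)"
      using integrable_indicator_Icc by simp
    show "integrable lborel (\<lambda>y. 2 * (indicator {x..x+1} y * (f y)^2) + 2 * (L2_norm g)^2 * indicator {x..x+1} y)"
      using ii integrable_indicator_Icc by (intro Bochner_Integration.integrable_add integrable_mult_right)
    fix y
    have "(f x)^2 \<le> 2 * (f y)^2 + 2 * (L2_norm g)^2" if "y \<in> {x..x+1}"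
    proof -
      have "\<bar>f x - f y\<bar> \<le> sqrt \<bar>x - y\<bar> * L2_norm g" by (rule sob_Hoelder[OF assms])
      also have "\<dots> \<le> 1 * L2_norm g" using that by (intro mult_right_mono L2_norm_nonneg) auto
      finally have "(f x - f y)^2 \<le> (L2_norm g)^2"
        using abs_le_square_iff[of "f x - f y" "L2_norm g"] L2_norm_nonneg[of g] by simp
      moreover have "(f x)^2 \<le> 2 * (f y)^2 + 2 * (f x - f y)^2"
        using zero_le_power2[of "f x - 2 * f y"] by (simp add: power2_eq_square algebra_simps)
      ultimately show ?thesis by linarith
    qed
    then show "indicator {x..x+1} y * (f x)^2 \<le> 2 * (indicator {x..x+1} y * (f y)^2) + 2 * (L2_norm g)^2 * indicator {x..x+1} y"
      by (cases "y \<in> {x..x+1}") auto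
  qed
  also have "\<dots> = 2 * (LBINT y. indicator {x..x+1} y * (f y)^2) + 2 * (L2_norm g)^2"
    using ii integrable_indicator_Icc by simp
  also have "(LBINT y. indicator {x..x+1} y * (f y)^2) \<le> (LBINT y. (f y)^2)"
    using i ii by (intro integral_mono) (auto simp: indicator_def)
  finally show ?thesis by (simp add: L2_norm_sq)
qed

lemma sob_sup':
  assumes "sob f g" shows "\<bar>f x\<bar> \<le> 2 * (L2_norm f + L2_norm g)"
proof (rule power2_le_imp_le)
  have "0 \<le> L2_norm f * L2_norm g" by (simp add: L2_norm_nonneg)
  moreover have "(2 * (L2_norm f + L2_norm g))^2 = 4 * (L2_norm f)^2 + 4 * (L2_norm g)^2 + 8 * (L2_norm f * L2_norm g)"
    by (simp add: power2_sum power_mult_distrib)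
  ultimately show "\<bar>f x\<bar>^2 \<le> (2 * (L2_norm f + L2_norm g))^2"
    using sob_sup[OF assms, of x] zero_le_power2[of "L2_norm f"] zero_le_power2[of "L2_norm g"]
    unfolding power2_abs by linarith
  show "0 \<le> 2 * (L2_norm f + L2_norm g)" by (simp add: L2_norm_nonneg)
qed

lemma sob_representative:
  assumes "L2 f" "L2 g" "weak_deriv f g"
  shows "\<exists>F. sob F g \<and> (AE x in lborel. f x = F x)"
proof -
  obtain c where c: "AE x in lborel. f x = c + prim g x"
    using weak_deriv_imp_prim[OF assms(3) L2_loc_int L2_loc_int] assms by blast
  have [measurable]: "g \<in> borel_measurable borel" "f \<in> borel_measurable borel" using assms L2_meas by auto
  have "integrable lborel (\<lambda>x. (c + prim g x)^2)"
    by (rule integrable_cong_AE_imp[of _ "\<lambda>x. (f x)^2"]) (use assms c in \<open>auto simp: L2_iff elim!: eventually_mono\<close>)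
  then have "sob (\<lambda>x. c + prim g x) g"
    using assms prim_diff[OF L2_loc_int[OF assms(2)]] by (auto simp: sob_def L2_iff)
  then show ?thesis using c by blast
qed

lemma weak_deriv_diff:
  assumes "L2 f" "L2 g" "weak_deriv f g" "L2 f'" "L2 g'" "weak_deriv f' g'"
  shows "weak_deriv (\<lambda>x. f x - f' x) (\<lambda>x. g x - g' x)"
  unfolding weak_deriv_def
proof (intro allI impI)
  fix \<phi> assume p: "test_fun1 \<phi>"
  note i = loc_int_test_integrable[OF L2_loc_int]
  show "(LBINT x. (f x - f' x) * deriv \<phi> x) = - (LBINT x. (g x - g' x) * \<phi> x)"
    using assms p i[OF assms(1) test_fun1_deriv[OF p]] i[OF assms(4) test_fun1_deriv[OF p]]
      i[OF assms(2) p] i[OF assms(5) p]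
    by (simp add: left_diff_distrib weak_deriv_def)
qed

lemma H1_diff: "H1 f \<Longrightarrow> H1 f' \<Longrightarrow> H1 (\<lambda>x. f x - f' x)"
  unfolding H1_def using weak_deriv_diff L2_diff by metis

text \<open>\<open>H1_norm\<close> is defined through a choice of weak derivative. The
  representative is built from that very choice, so both bounds follow without any uniqueness
  statement for weak derivatives.\<close>

lemma H1_norm_representative:
  assumes "H1 f"
  obtains F g where "sob F g" "AE x in lborel. f x = F x" "L2_norm F \<le> H1_norm f" "L2_norm g \<le> H1_norm f"
proof -
  define g where "g = (SOME g. L2 g \<and> weak_deriv f g)"
  have g: "L2 g" "weak_deriv f g"
    using assms someI_ex[of "\<lambda>g. L2 g \<and> weak_deriv f g"] unfolding H1_def g_def by auto
  have f: "L2 f" using assms by (simp add: H1_def)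
  obtain F where F: "sob F g" "AE x in lborel. f x = F x" using sob_representative[OF f g] by blast
  have "H1_norm f = sqrt ((L2_norm f)^2 + (L2_norm g)^2)" by (simp add: H1_norm_def g_def)
  then have "L2_norm f \<le> H1_norm f" "L2_norm g \<le> H1_norm f"
    using real_sqrt_sum_squares_ge1 real_sqrt_sum_squares_ge2 by metis+
  moreover have "L2_norm F = L2_norm f"
    using L2_norm_cong_AE[OF f _ F(2)] F(1) by (simp add: sob_def)
  ultimately show ?thesis using that F by simp
qed

section \<open>The Hilbert transform\<close>

text \<open>Folding the principal value about its singularity gives an absolutely convergent integral for functions
that are Hoelder continuous of exponent 1/2.\<close>
definition hilbert_diff :: "(real \<Rightarrow> real) \<Rightarrow> real \<Rightarrow> real \<Rightarrow> real" where
  "hilbert_diff f x s = (f (x - s) - f (x + s)) / s"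

lemma inverse_Ioi_L2:
  assumes "0 < e"
  shows "L2 (\<lambda>s. indicator {e<..} s / s)" "L2_norm (\<lambda>s. indicator {e<..} s / s) = sqrt (1 / e)"
proof -
  have lim: "((\<lambda>s. - (1 / s)) \<longlongrightarrow> - (1 / e)) (at_right e)"
    using assms by (intro tendsto_intros) auto
  have lim': "((\<lambda>s::real. - (1 / s)) \<longlongrightarrow> 0) at_top"
    using tendsto_minus[OF tendsto_divide_0[OF tendsto_const[of 1] filterlim_at_top_imp_at_infinity[OF filterlim_ident]]]
    by simp
  have *: "(\<lambda>s. (indicator {e<..} s / s)^2) = (\<lambda>s. indicator {e<..} s * (1 / s^2))"
    by (auto simp: indicator_def power_divide)
  have d: "((\<lambda>s. - (1 / s)) has_real_derivative 1 / s^2) (at s)" "isCont (\<lambda>s. 1 / s^2) s" if "e < s" for s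
    using that assms by (auto intro!: derivative_eq_intros continuous_intros simp: power2_eq_square)
  have i1: "integrable lborel (\<lambda>s. indicator {e<..} s * (1 / s^2))"
    by (rule FTC_nonneg_Ioi(1)[OF d _ lim lim']) (simp_all add: zero_le_divide_iff)
  have i2: "(LBINT s. indicator {e<..} s * (1 / s^2)) = 0 - (- (1 / e))"
    by (rule FTC_nonneg_Ioi(2)[OF d _ lim lim']) (simp_all add: zero_le_divide_iff)
  show "L2 (\<lambda>s. indicator {e<..} s / s)" unfolding L2_iff * using i1 by auto
  show "L2_norm (\<lambda>s. indicator {e<..} s / s) = sqrt (1 / e)"
    unfolding L2_norm_def * i2 by simp
qed

lemma integral_inverse_sqrt:
  "integrable lborel (\<lambda>s. indicator {0<..<1} s * (1 / sqrt s))"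
  "(LBINT s. indicator {0<..<1} s * (1 / sqrt s)) = 2"
proof -
  have l: "((\<lambda>s. 2 * sqrt s) \<longlongrightarrow> 0) (at_right 0)" "((\<lambda>s. 2 * sqrt s) \<longlongrightarrow> 2) (at_left 1)"
    by (auto intro!: tendsto_eq_intros)
  show "integrable lborel (\<lambda>s. indicator {0<..<1} s * (1 / sqrt s))"
    by (rule FTC_nonneg_Ioo(1)[OF _ _ _ _ l])
       (auto intro!: derivative_eq_intros continuous_intros simp: field_simps)
  show "(LBINT s. indicator {0<..<1} s * (1 / sqrt s)) = 2"
    by (subst FTC_nonneg_Ioo(2)[OF _ _ _ _ l])
       (auto intro!: derivative_eq_intros continuous_intros simp: field_simps)
qed

lemma L2_translates:
  assumes "L2 f"
  shows "L2 (\<lambda>s. f (x - s))" "L2 (\<lambda>s. f (x + s))" "L2_norm (\<lambda>s. f (x - s)) = L2_norm f"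
    "L2_norm (\<lambda>s. f (x + s)) = L2_norm f" "L2 (\<lambda>s. f (s - x))"
    using L2_affine[OF assms, of "-1" x] L2_affine[OF assms, of 1 x] L2_affine[OF assms, of 1 "-x"] by simp_all

lemma L2_abs: "L2 f \<Longrightarrow> L2 (\<lambda>x. \<bar>f x\<bar>)" "L2_norm (\<lambda>x. \<bar>f x\<bar>) = L2_norm f"
  by (auto simp: L2_iff L2_norm_def)

text \<open>On \<open>(0,1)\<close> the Hoelder bound leaves \<open>s^(-1/2)\<close>, whose integral
  \<open>2\<close> yields \<open>4 * L2_norm g\<close>. Beyond \<open>1\<close> the two translates
  are paired with \<open>1/s\<close>, of \<open>L2\<close> norm one, by Cauchy-Schwarz, which yields
  \<open>2 * L2_norm f\<close>.\<close>

lemma hilbert_diff_integrable: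
  assumes "sob f g"
  shows "integrable lborel (\<lambda>s. indicator {0<..} s * hilbert_diff f x s)"
    and "(LBINT s. \<bar>indicator {0<..} s * hilbert_diff f x s\<bar>) \<le> 4 * (L2_norm f + L2_norm g)"
proof -
  have f: "L2 f" using assms by (simp add: sob_def)
  have [measurable]: "f \<in> borel_measurable borel" using f by (rule L2_meas)
  define D where "D = (\<lambda>s. 2 * L2_norm g * (indicator {0<..<1} s * (1 / sqrt s))
     + (\<bar>f (x - s)\<bar> * (indicator {1<..} s / s) + \<bar>f (x + s)\<bar> * (indicator {1<..} s / s)))"
  have t1: "integrable lborel (\<lambda>s. \<bar>f (x - s)\<bar> * (indicator {1<..} s / s))"
    and t2: "integrable lborel (\<lambda>s. \<bar>f (x + s)\<bar> * (indicator {1<..} s / s))"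
    by (rule L2_mult_integrable[OF L2_abs(1)[OF L2_translates(1)[OF f]] inverse_Ioi_L2(1)[OF zero_less_one]]
        L2_mult_integrable[OF L2_abs(1)[OF L2_translates(2)[OF f]] inverse_Ioi_L2(1)[OF zero_less_one]])+
  have b1: "(LBINT s. \<bar>f (x - s)\<bar> * (indicator {1<..} s / s)) \<le> L2_norm f"
    using L2_Cauchy_Schwarz[OF L2_abs(1)[OF L2_translates(1)[OF f, of x]] inverse_Ioi_L2(1)[of 1]]
    by (simp add: inverse_Ioi_L2(2) L2_abs(2) L2_translates(3)[OF f])
  have b2: "(LBINT s. \<bar>f (x + s)\<bar> * (indicator {1<..} s / s)) \<le> L2_norm f"
    using L2_Cauchy_Schwarz[OF L2_abs(1)[OF L2_translates(2)[OF f, of x]] inverse_Ioi_L2(1)[of 1]]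
    by (simp add: inverse_Ioi_L2(2) L2_abs(2) L2_translates(4)[OF f])
  have iD: "integrable lborel D"
    unfolding D_def
    by (intro Bochner_Integration.integrable_add integrable_mult_right t1 t2 integral_inverse_sqrt)
  have bound: "AE s in lborel. \<bar>indicator {0<..} s * hilbert_diff f x s\<bar> \<le> D s"
    using AE_lborel_singleton[of "1::real"]
  proof eventually_elim
    case (elim s)
    consider "s \<le> 0" | "0 < s" "s < 1" | "1 < s" using elim by linarith
    then show ?case
    proof cases
      case 1
      then show ?thesis by (simp add: D_def)
    next
      case 2
      have "\<bar>f (x - s) - f (x + s)\<bar> \<le> sqrt \<bar>(x - s) - (x + s)\<bar> * L2_norm g" by (rule sob_Hoelder[OF assms])
      also have "\<bar>(x - s) - (x + s)\<bar> = 2 * s" using 2 by simp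
      also have "sqrt (2 * s) * L2_norm g \<le> (2 * sqrt s) * L2_norm g"
      proof (intro mult_right_mono L2_norm_nonneg)
        have "sqrt 2 \<le> sqrt (2^2)" by (rule real_sqrt_le_mono) simp
        then show "sqrt (2 * s) \<le> 2 * sqrt s" using 2 by (simp add: real_sqrt_mult)
      qed
      finally have "\<bar>f (x - s) - f (x + s)\<bar> / s \<le> 2 * sqrt s * L2_norm g / s"
        using 2 by (intro divide_right_mono) auto
      also have "\<dots> = 2 * L2_norm g * (1 / sqrt s)"
        using 2 real_sqrt_mult_self[of s] by (simp add: field_simps)
      finally show ?thesis using 2 by (simp add: D_def hilbert_diff_def)
    next
      case 3
      have "\<bar>f (x - s) - f (x + s)\<bar> / s \<le> (\<bar>f (x - s)\<bar> + \<bar>f (x + s)\<bar>) / s"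
        using 3 by (intro divide_right_mono abs_triangle_ineq4) auto
      then show ?thesis using 3 by (simp add: D_def hilbert_diff_def add_divide_distrib)
    qed
  qed
  have m: "(\<lambda>s. indicator {0<..} s * hilbert_diff f x s) \<in> borel_measurable lborel"
    unfolding hilbert_diff_def by measurable
  show int: "integrable lborel (\<lambda>s. indicator {0<..} s * hilbert_diff f x s)"
    by (rule Bochner_Integration.integrable_bound[OF iD m])
       (use bound in \<open>eventually_elim, auto intro: order_trans[OF _ abs_ge_self]\<close>)
  have "(LBINT s. \<bar>indicator {0<..} s * hilbert_diff f x s\<bar>) \<le> (LBINT s. D s)"
    by (rule integral_mono_AE[OF integrable_abs[OF int] iD bound])
  also have "\<dots> = 4 * L2_norm g + ((LBINT s. \<bar>f (x - s)\<bar> * (indicator {1<..} s / s))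
      + (LBINT s. \<bar>f (x + s)\<bar> * (indicator {1<..} s / s)))"
    unfolding D_def
    by (simp only: Bochner_Integration.integral_add Bochner_Integration.integrable_add integrable_mult_right
        t1 t2 integral_inverse_sqrt integral_mult_right_zero)
  also have "\<dots> \<le> 4 * L2_norm g + (L2_norm f + L2_norm f)" by (intro add_mono order_refl b1 b2)
  also have "\<dots> \<le> 4 * (L2_norm f + L2_norm g)" using L2_norm_nonneg[of f] by simp
  finally show "(LBINT s. \<bar>indicator {0<..} s * hilbert_diff f x s\<bar>) \<le> 4 * (L2_norm f + L2_norm g)" .
qed

text \<open>Substitution \<open>y = x - s\<close>, then reflection of the negative half onto the
  positive one. The halves may be separated because \<open>1/s\<close> is square integrable away
  from zero.\<close>

lemma truncated_hilbert:
  assumes f: "L2 f" and e: "0 < e"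
  shows "(LINT y:{y. e < \<bar>x - y\<bar>}|lborel. f y / (x - y)) = (LBINT s. indicator {e<..} s * hilbert_diff f x s)"
proof -
  have i1: "integrable lborel (\<lambda>s. f (x - s) * (indicator {e<..} s / s))"
    and i2: "integrable lborel (\<lambda>s. f (x + s) * (indicator {e<..} s / s))"
    by (rule L2_mult_integrable[OF L2_translates(1)[OF f] inverse_Ioi_L2(1)[OF e]]
        L2_mult_integrable[OF L2_translates(2)[OF f] inverse_Ioi_L2(1)[OF e]])+
  have i2': "integrable lborel (\<lambda>s. f (x + (0 + (-1) * s)) * (indicator {e<..} (0 + (-1) * s) / (0 + (-1) * s)))"
    using lborel_integrable_real_affine[OF i2, of "-1" 0] by simp
  have "(LINT y:{y. e < \<bar>x - y\<bar>}|lborel. f y / (x - y)) = (LBINT s. indicator {y. e < \<bar>x - y\<bar>} (x + (-1) * s) *\<^sub>R (f (x + (-1) * s) / (x - (x + (-1) * s))))"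
    unfolding set_lebesgue_integral_def by (subst lborel_integral_real_affine[where c = "-1" and t = x]) simp_all
  also have "\<dots> = (LBINT s. f (x - s) * (indicator {e<..} s / s) + f (x + (0 + (-1) * s)) * (indicator {e<..} (0 + (-1) * s) / s))"
    using e by (intro Bochner_Integration.integral_cong refl) (auto simp: indicator_def)
  also have "\<dots> = (LBINT s. f (x - s) * (indicator {e<..} s / s) - f (x + (0 + (-1) * s)) * (indicator {e<..} (0 + (-1) * s) / (0 + (-1) * s)))"
    by (intro Bochner_Integration.integral_cong refl) simp
  also have "\<dots> = (LBINT s. f (x - s) * (indicator {e<..} s / s)) - (LBINT s. f (x + (0 + (-1) * s)) * (indicator {e<..} (0 + (-1) * s) / (0 + (-1) * s)))"
    by (rule Bochner_Integration.integral_diff[OF i1 i2'])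
  also have "(LBINT s. f (x + (0 + (-1) * s)) * (indicator {e<..} (0 + (-1) * s) / (0 + (-1) * s)))
     = (LBINT s. f (x + s) * (indicator {e<..} s / s))"
    using lborel_integral_real_affine[of "-1" "\<lambda>s. f (x + s) * (indicator {e<..} s / s)" 0] by simp
  also have "(LBINT s. f (x - s) * (indicator {e<..} s / s)) - (LBINT s. f (x + s) * (indicator {e<..} s / s))
     = (LBINT s. f (x - s) * (indicator {e<..} s / s) - f (x + s) * (indicator {e<..} s / s))"
    by (rule Bochner_Integration.integral_diff[OF i1 i2, symmetric])
  also have "\<dots> = (LBINT s. indicator {e<..} s * hilbert_diff f x s)"
    by (intro Bochner_Integration.integral_cong refl) (simp add: hilbert_diff_def diff_divide_distrib algebra_simps)
  finally show ?thesis .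
qed

text \<open>Changing \<open>h\<close> on a null set does not affect the truncated integrals at any
  \<open>x\<close>, so the formula holds at every point although \<open>h\<close> agrees with
  \<open>f\<close> only almost everywhere. It also shows that the limit in the definition of
  \<open>hilbert\<close> exists.\<close>

lemma hilbert_eq:
  assumes s: "sob f g" and [measurable]: "h \<in> borel_measurable borel" and h: "AE x in lborel. h x = f x"
  shows "hilbert h x = (1/pi) * (LBINT s. indicator {0<..} s * hilbert_diff f x s)"
proof -
  have f: "L2 f" using s by (simp add: sob_def)
  have [measurable]: "f \<in> borel_measurable borel" using f by (rule L2_meas)
  have trunc: "(LINT y:{y. e < \<bar>x - y\<bar>}|lborel. h y / (x - y)) = (LBINT s. indicator {e<..} s * hilbert_diff f x s)"
    if "0 < e" for e
  proof -
    have "(LINT y:{y. e < \<bar>x - y\<bar>}|lborel. h y / (x - y)) = (LINT y:{y. e < \<bar>x - y\<bar>}|lborel. f y / (x - y))"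
      unfolding set_lebesgue_integral_def
    proof (rule integral_cong_AE)
      show "AE y in lborel. indicator {y. e < \<bar>x - y\<bar>} y *\<^sub>R (h y / (x - y)) = indicator {y. e < \<bar>x - y\<bar>} y *\<^sub>R (f y / (x - y))"
        using h by eventually_elim simp
    qed measurable
    then show ?thesis using truncated_hilbert[OF f that] by simp
  qed
  \<comment> \<open>The cutoff is written as \<open>inverse t\<close>, so that dominated convergence
    can be applied at infinity.\<close>
  have lim: "((\<lambda>t. LBINT s. indicator {inverse t<..} s * hilbert_diff f x s) \<longlongrightarrow> (LBINT s. indicator {0<..} s * hilbert_diff f x s)) at_top"
  proof (rule integral_dominated_convergence_at_top[where w = "\<lambda>s. \<bar>indicator {0<..} s * hilbert_diff f x s\<bar>"])
    show "(\<lambda>s. indicator {0<..} s * hilbert_diff f x s) \<in> borel_measurable lborel"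
      "\<And>t. (\<lambda>s. indicator {inverse t<..} s * hilbert_diff f x s) \<in> borel_measurable lborel"
      unfolding hilbert_diff_def by measurable
    show "integrable lborel (\<lambda>s. \<bar>indicator {0<..} s * hilbert_diff f x s\<bar>)"
      by (rule integrable_abs[OF hilbert_diff_integrable(1)[OF s]])
    show "AE s in lborel. ((\<lambda>t. indicator {inverse t<..} s * hilbert_diff f x s) \<longlongrightarrow> indicator {0<..} s * hilbert_diff f x s) at_top"
    proof (rule AE_I2, rule tendsto_eventually)
      fix s :: real
      show "\<forall>\<^sub>F t in at_top. indicator {inverse t<..} s * hilbert_diff f x s = indicator {0<..} s * hilbert_diff f x s"
        using eventually_gt_at_top[of "max 0 (inverse s)"]
      proof eventually_elim
        case (elim t)
        have "inverse t < s \<longleftrightarrow> 0 < s"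
        proof
          assume "0 < s" then show "inverse t < s" using elim less_imp_inverse_less[of "inverse s" t] by simp
        next
          assume "inverse t < s" moreover have "0 < inverse t" using elim by simp
          ultimately show "0 < s" by linarith
        qed
        then show ?case by (simp add: indicator_def)
      qed
    qed
    show "\<forall>\<^sub>F t in at_top. AE s in lborel. norm (indicator {inverse t<..} s * hilbert_diff f x s) \<le> \<bar>indicator {0<..} s * hilbert_diff f x s\<bar>"
      using eventually_gt_at_top[of 0]
    proof eventually_elim
      case (elim t)
      then have "0 < inverse t" by simp
      then show ?case by (intro AE_I2) (auto simp: indicator_def simp del: inverse_positive_iff_positive)
    qed
  qed
  have "((\<lambda>e. LBINT s. indicator {e<..} s * hilbert_diff f x s) \<longlongrightarrow> (LBINT s. indicator {0<..} s * hilbert_diff f x s)) (at_right 0)"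
    unfolding filterlim_at_right_to_top by (rule lim)
  then have "((\<lambda>e. LINT y:{y. e < \<bar>x - y\<bar>}|lborel. h y / (x - y)) \<longlongrightarrow> (LBINT s. indicator {0<..} s * hilbert_diff f x s)) (at_right 0)"
    by (rule Lim_transform_eventually) (use eventually_at_right_less[of "0::real"] trunc in \<open>auto elim!: eventually_mono\<close>)
  then have "((\<lambda>e. (1/pi) * (LINT y:{y. e < \<bar>x - y\<bar>}|lborel. h y / (x - y))) \<longlongrightarrow> (1/pi) * (LBINT s. indicator {0<..} s * hilbert_diff f x s)) (at_right 0)"
    by (intro tendsto_mult tendsto_const)
  then show ?thesis unfolding hilbert_def by (intro tendsto_Lim) auto
qed

text \<open>A crude supremum bound by the Sobolev norms. It suffices for pairing
  \<open>hilbert h\<close> with kernels that decay quadratically, and, applied to differences, for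
  continuity in time.\<close>

lemma hilbert_bound:
  assumes "sob f g" and "h \<in> borel_measurable borel" and "AE x in lborel. h x = f x"
  shows "\<bar>hilbert h x\<bar> \<le> 4 * (L2_norm f + L2_norm g)"
proof -
  have "\<bar>hilbert h x\<bar> = (1/pi) * \<bar>LBINT s. indicator {0<..} s * hilbert_diff f x s\<bar>"
    unfolding hilbert_eq[OF assms] by (simp add: abs_mult)
  also have "\<dots> \<le> 1 * \<bar>LBINT s. indicator {0<..} s * hilbert_diff f x s\<bar>"
    using pi_gt3 by (intro mult_right_mono) auto
  also have "\<dots> \<le> (LBINT s. \<bar>indicator {0<..} s * hilbert_diff f x s\<bar>)"
    by (simp only: mult_1 integral_abs_bound)
  also have "\<dots> \<le> 4 * (L2_norm f + L2_norm g)" by (rule hilbert_diff_integrable(2)[OF assms(1)])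
  finally show ?thesis .
qed

lemma hilbert_measurable:
  assumes "sob f g" and "h \<in> borel_measurable borel" and "AE x in lborel. h x = f x"
  shows "hilbert h \<in> borel_measurable borel"
proof -
  have [measurable]: "f \<in> borel_measurable borel" using assms(1) by (simp add: sob_def L2_iff)
  have "(\<lambda>x. (1/pi) * (LBINT s. indicator {0<..} s * hilbert_diff f x s)) \<in> borel_measurable borel"
    unfolding hilbert_diff_def by measurable
  then show ?thesis using hilbert_eq[OF assms] by (subst measurable_cong) auto
qed

text \<open>\<open>hilbert\<close> is a \<open>Lim\<close>, hence not linear by definition;
  linearity is read off from the absolutely convergent formula.\<close>

lemma hilbert_sob_diff:
  assumes "sob f g" "h \<in> borel_measurable borel" "AE x in lborel. h x = f x"
    and "sob f' g'" "h' \<in> borel_measurable borel" "AE x in lborel. h' x = f' x"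
  shows "hilbert (\<lambda>y. h y - h' y) x = hilbert h x - hilbert h' x"
proof -
  have ae: "AE x in lborel. h x - h' x = f x - f' x" using assms(3,6) by eventually_elim simp
  have "hilbert (\<lambda>y. h y - h' y) x = (1/pi) * (LBINT s. indicator {0<..} s * hilbert_diff (\<lambda>y. f y - f' y) x s)"
    by (rule hilbert_eq[OF sob_diff[OF assms(1,4)] _ ae]) (use assms in measurable)
  also have "(\<lambda>s. indicator {0<..} s * hilbert_diff (\<lambda>y. f y - f' y) x s)
     = (\<lambda>s. indicator {0<..} s * hilbert_diff f x s - indicator {0<..} s * hilbert_diff f' x s)"
    unfolding hilbert_diff_def right_diff_distrib[symmetric] diff_divide_distrib[symmetric]
    by (rule ext) (simp add: algebra_simps)
  finally show ?thesis
    using hilbert_diff_integrable(1)[OF assms(1), of x] hilbert_diff_integrable(1)[OF assms(4), of x]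
    by (simp add: hilbert_eq[OF assms(1-3)] hilbert_eq[OF assms(4-6)] right_diff_distrib)
qed

lemma integral_poisson_density:
  assumes "0 < m"
  shows "integrable lborel (\<lambda>x. 1 / (x^2 + m^2))" "(LBINT x. 1 / (x^2 + m^2)) = pi / m"
proof -
  let ?F = "\<lambda>x. arctan (x / m) / m"
  have pos: "0 < x^2 + m^2" for x using assms by (simp add: add_nonneg_pos)
  have d: "(?F has_real_derivative 1 / (x^2 + m^2)) (at x)" for x
  proof -
    have "((\<lambda>x. arctan (x / m) / m) has_real_derivative inverse (1 + (x / m)^2) * (1 / m) / m) (at x)"
      using assms by (auto intro!: derivative_eq_intros)
    also have "inverse (1 + (x / m)^2) * (1 / m) / m = 1 / (x^2 + m^2)"
    proof -
      have "1 + (x / m)^2 = (x^2 + m^2) / m^2" using assms by (simp add: field_simps)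
      then show ?thesis using assms pos[of x] by (simp add: power2_eq_square)
    qed
    finally show ?thesis .
  qed
  have c: "isCont (\<lambda>x. 1 / (x^2 + m^2)) x" for x
    using pos[of x] by (intro continuous_intros) auto
  have scale: "(\<lambda>x. x / m) = (\<lambda>x. (1 / m) * x)" by auto
  have "filterlim (\<lambda>x. x / m) at_top at_top"
    unfolding scale using assms by (intro filterlim_tendsto_pos_mult_at_top[OF tendsto_const _ filterlim_ident]) auto
  then have B: "(?F \<longlongrightarrow> (pi / 2) / m) at_top"
    by (intro tendsto_intros filterlim_compose[OF tendsto_arctan_at_top]) (use assms in auto)
  have "filterlim (\<lambda>x. x / m) at_bot at_bot"
    unfolding scale using assms by (intro filterlim_tendsto_pos_mult_at_bot[OF tendsto_const _ filterlim_ident]) auto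
  then have A: "(?F \<longlongrightarrow> - (pi / 2) / m) at_bot"
    by (intro tendsto_intros filterlim_compose[OF tendsto_arctan_at_bot]) (use assms in auto)
  have nn: "AE x in lborel. -\<infinity> < ereal x \<longrightarrow> ereal x < \<infinity> \<longrightarrow> 0 \<le> 1 / (x^2 + m^2)"
    using pos less_imp_le by auto
  have A': "((?F \<circ> real_of_ereal) \<longlongrightarrow> - (pi / 2) / m) (at_right (-\<infinity>))"
    and B': "((?F \<circ> real_of_ereal) \<longlongrightarrow> (pi / 2) / m) (at_left \<infinity>)"
    unfolding ereal_tendsto_simps using A B by auto
  note ftc = interval_integral_FTC_nonneg[of "-\<infinity>" "\<infinity>" ?F, OF _ d c nn A' B']
  show "integrable lborel (\<lambda>x. 1 / (x^2 + m^2))"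
    using ftc(1) by (simp add: set_integrable_def)
  show "(LBINT x. 1 / (x^2 + m^2)) = pi / m"
    using ftc(2) by (simp add: interval_lebesgue_integral_def set_lebesgue_integral_def)
qed

section \<open>Convolutions\<close>

text \<open>The mean value inequality on the ball bounds the difference quotients by
  \<open>D\<close>. The field is left general: the real case serves convolutions, the complex case
  serves the Cauchy transform.\<close>

lemma has_field_derivative_integral:
  fixes \<phi> :: "'a::{real_normed_field,banach,second_countable_topology} \<Rightarrow> 'b \<Rightarrow> 'a"
  assumes e: "0 < e"
    and int: "\<And>z. z \<in> ball x e \<Longrightarrow> integrable M (\<phi> z)"
    and der: "\<And>z y. z \<in> ball x e \<Longrightarrow> ((\<lambda>z. \<phi> z y) has_field_derivative \<phi>' z y) (at z)"
    and bd: "\<And>z y. z \<in> ball x e \<Longrightarrow> norm (\<phi>' z y) \<le> D y"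
    and D: "integrable M D" and m: "\<phi>' x \<in> borel_measurable M"
  shows "((\<lambda>z. \<integral>y. \<phi> z y \<partial>M) has_field_derivative (\<integral>y. \<phi>' x y \<partial>M)) (at x)"
  unfolding has_field_derivative_iff tendsto_at_iff_sequentially
proof (intro allI impI)
  fix X assume X: "\<forall>i::nat. X i \<in> UNIV - {x}" "X \<longlonglongrightarrow> x"
  have "eventually (\<lambda>i. X i \<in> ball x e) sequentially"
    using topological_tendstoD[OF X(2), of "ball x e"] e by simp
  then obtain N where N: "\<And>i. i \<ge> N \<Longrightarrow> X i \<in> ball x e" by (auto simp: eventually_sequentially)
  have xb: "x \<in> ball x e" using e by simp
  have L: "(\<lambda>i. \<integral>y. (\<phi> (X (i + N)) y - \<phi> x y) / (X (i + N) - x) \<partial>M) \<longlonglongrightarrow> (\<integral>y. \<phi>' x y \<partial>M)"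
  proof (rule integral_dominated_convergence[OF m _ D])
    show "(\<lambda>y. (\<phi> (X (i + N)) y - \<phi> x y) / (X (i + N) - x)) \<in> borel_measurable M" for i
    proof -
      have "integrable M (\<lambda>y. \<phi> (X (i + N)) y - \<phi> x y)"
        using int[OF N] int[OF xb] by (intro Bochner_Integration.integrable_diff) auto
      then show ?thesis using borel_measurable_integrable by (auto intro: integrable_divide)
    qed
    show "AE y in M. (\<lambda>i. (\<phi> (X (i + N)) y - \<phi> x y) / (X (i + N) - x)) \<longlonglongrightarrow> \<phi>' x y"
    proof (rule AE_I2)
      fix y
      have "((\<lambda>z. (\<phi> z y - \<phi> x y) / (z - x)) \<longlongrightarrow> \<phi>' x y) (at x)"
        using der[OF xb, of y] unfolding has_field_derivative_iff .
      then have "((\<lambda>z. (\<phi> z y - \<phi> x y) / (z - x)) \<circ> X) \<longlonglongrightarrow> \<phi>' x y"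
        unfolding tendsto_at_iff_sequentially using X by simp
      then show "(\<lambda>i. (\<phi> (X (i + N)) y - \<phi> x y) / (X (i + N) - x)) \<longlonglongrightarrow> \<phi>' x y"
        using LIMSEQ_ignore_initial_segment[of "(\<lambda>z. (\<phi> z y - \<phi> x y) / (z - x)) \<circ> X" _ N] by (simp add: o_def)
    qed
    show "AE y in M. norm ((\<phi> (X (i + N)) y - \<phi> x y) / (X (i + N) - x)) \<le> D y" for i
    proof (rule AE_I2)
      fix y
      have "norm (\<phi> (X (i + N)) y - \<phi> x y) \<le> D y * norm (X (i + N) - x)"
        by (rule field_differentiable_bound[OF convex_ball, of x e _ "\<lambda>z. \<phi>' z y"])
           (use N xb der bd in \<open>auto intro: has_field_derivative_at_within\<close>)
      moreover have "norm (X (i + N) - x) > 0" using X(1) by auto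
      ultimately show "norm ((\<phi> (X (i + N)) y - \<phi> x y) / (X (i + N) - x)) \<le> D y"
        by (simp add: norm_divide pos_divide_le_eq)
    qed
  qed
  have E: "(\<integral>y. (\<phi> (X (i + N)) y - \<phi> x y) / (X (i + N) - x) \<partial>M)
    = ((\<lambda>z. ((\<integral>y. \<phi> z y \<partial>M) - (\<integral>y. \<phi> x y \<partial>M)) / (z - x)) \<circ> X) (i + N)" for i
    using int[OF N, of "i + N"] int[OF xb] by simp
  from L show "((\<lambda>z. ((\<integral>y. \<phi> z y \<partial>M) - (\<integral>y. \<phi> x y \<partial>M)) / (z - x)) \<circ> X) \<longlonglongrightarrow> (\<integral>y. \<phi>' x y \<partial>M)"
    unfolding E by (rule LIMSEQ_offset)
qed

definition conv :: "(real \<Rightarrow> real) \<Rightarrow> (real \<Rightarrow> real) \<Rightarrow> real \<Rightarrow> real" where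
  "conv k f x = (LBINT y. k (x - y) * f y)"

text \<open>Quadratic decay is enough for pairing with integrable, square-integrable and bounded
  functions alike. The conjugate kernel \<open>qk\<close> decays only like \<open>1/z\<close> and
  stays outside this class.\<close>

definition kern :: "(real \<Rightarrow> real) \<Rightarrow> bool" where
  "kern k \<longleftrightarrow> k \<in> borel_measurable borel \<and> (\<exists>C. \<forall>z. \<bar>k z\<bar> \<le> C / (z^2 + 1))"

text \<open>The class dual to \<open>kern\<close>. It covers \<open>U\<close>, its square, and
  \<open>hilbert u\<close>, of which only boundedness is known.\<close>

definition wint :: "(real \<Rightarrow> real) \<Rightarrow> bool" where
  "wint f \<longleftrightarrow> f \<in> borel_measurable borel \<and> integrable lborel (\<lambda>y. f y / (y^2 + 1))"

lemma one_plus_square_pos [simp]: "0 < x^2 + (1::real)"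
  by (simp add: add_nonneg_pos)

lemma one_plus_square_abs [simp]: "\<bar>x^2 + (1::real)\<bar> = x^2 + 1"
  by (rule abs_of_pos) simp

lemma kern_bound:
  assumes "kern k" obtains C where "\<And>z. \<bar>k z\<bar> \<le> C / (z^2 + 1)" "C \<ge> 0"
proof -
  from assms obtain C where C: "\<And>z. \<bar>k z\<bar> \<le> C / (z^2 + 1)" unfolding kern_def by blast
  then have "C \<ge> 0" using C[of 0] abs_ge_zero[of "k 0"] by simp
  then show ?thesis using that C by blast
qed

lemma kern_measurable: "kern k \<Longrightarrow> k \<in> borel_measurable borel"
  by (simp add: kern_def)

lemma kern_integrable: assumes "kern k" shows "integrable lborel k"
proof -
  obtain C where C: "\<And>z. \<bar>k z\<bar> \<le> C / (z^2 + 1)" "C \<ge> 0" by (rule kern_bound[OF assms]) blast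
  show ?thesis
  proof (rule Bochner_Integration.integrable_bound[of _ "\<lambda>z. C * (1 / (z^2 + 1^2))"])
    show "integrable lborel (\<lambda>z::real. C * (1 / (z^2 + 1^2)))"
      by (intro integrable_mult_right integral_poisson_density) simp
    show "AE z in lborel. norm (k z) \<le> norm (C * (1 / (z^2 + 1^2)))"
      using C by (auto intro: order_trans[OF _ abs_ge_self])
  qed (use assms in \<open>simp add: kern_def\<close>)
qed

lemma kern_abs: "kern k \<Longrightarrow> kern (\<lambda>z. \<bar>k z\<bar>)"
  unfolding kern_def by auto

lemma kern_bounded: assumes "kern k" obtains B where "\<And>z. \<bar>k z\<bar> \<le> B"
proof -
  obtain C where C: "\<And>z. \<bar>k z\<bar> \<le> C / (z^2 + 1)" "C \<ge> 0" by (rule kern_bound[OF assms]) blast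
  have "\<bar>k z\<bar> \<le> C" for z
  proof -
    have "C / (z^2 + 1) \<le> C / 1" using C(2) by (intro divide_left_mono) auto
    then show ?thesis using C(1)[of z] by simp
  qed
  then show ?thesis using that by blast
qed

lemma shift_weight: "y^2 + 1 \<le> (2 + 2 * x^2) * ((x - y)^2 + (1::real))"
proof -
  have "y^2 \<le> 2 * (x - y)^2 + 2 * x^2"
    using zero_le_power2[of "y - 2 * x"] by (simp add: power2_eq_square algebra_simps)
  moreover have "0 \<le> x^2 * (x - y)^2" by simp
  moreover have "(2 + 2 * x^2) * ((x - y)^2 + 1) = 2 * (x - y)^2 + 2 + 2 * x^2 + 2 * (x^2 * (x - y)^2)"
    by (simp add: distrib_left distrib_right)
  ultimately show ?thesis using zero_le_power2[of "x - y"] by linarith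
qed

lemma kern_shift: assumes "kern k" shows "kern (\<lambda>y. k (x - y))"
proof -
  obtain C where C: "\<And>z. \<bar>k z\<bar> \<le> C / (z^2 + 1)" "C \<ge> 0" by (rule kern_bound[OF assms]) blast
  have "\<bar>k (x - y)\<bar> \<le> (C * (2 + 2 * x^2)) / (y^2 + 1)" for y
  proof -
    have "C / ((x - y)^2 + 1) \<le> (C * (2 + 2 * x^2)) / (y^2 + 1)"
      using mult_left_mono[OF shift_weight[of y x] C(2)] one_plus_square_pos[of y] one_plus_square_pos[of "x - y"]
      by (simp add: divide_simps ac_simps)
    then show ?thesis using C(1)[of "x - y"] by linarith
  qed
  moreover have "(\<lambda>y. k (x - y)) \<in> borel_measurable borel" using kern_measurable[OF assms] by measurable
  ultimately show ?thesis unfolding kern_def by blast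
qed

lemma kern_mult_integrable:
  assumes "kern k" "wint f" shows "integrable lborel (\<lambda>y. k y * f y)"
proof -
  obtain C where C: "\<And>z. \<bar>k z\<bar> \<le> C / (z^2 + 1)" "C \<ge> 0" by (rule kern_bound[OF assms(1)]) blast
  show ?thesis
  proof (rule Bochner_Integration.integrable_bound[of _ "\<lambda>y. C * (f y / (y^2 + 1))"])
    show "integrable lborel (\<lambda>y. C * (f y / (y^2 + 1)))"
      by (rule integrable_mult_right) (use assms in \<open>simp add: wint_def\<close>)
    have [measurable]: "k \<in> borel_measurable borel" "f \<in> borel_measurable borel"
      using kern_measurable[OF assms(1)] assms(2) by (auto simp: wint_def)
    show "(\<lambda>y. k y * f y) \<in> borel_measurable lborel" by measurable
    have "norm (k y * f y) \<le> norm (C * (f y / (y^2 + 1)))" for y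
      using mult_right_mono[OF C(1)[of y] abs_ge_zero[of "f y"]] C(2) one_plus_square_pos[of y]
      by (simp add: abs_mult)
    then show "AE y in lborel. norm (k y * f y) \<le> norm (C * (f y / (y^2 + 1)))" by simp
  qed
qed

lemma conv_integrable:
  assumes "kern k" "wint f" shows "integrable lborel (\<lambda>y. k (x - y) * f y)"
  by (rule kern_mult_integrable[OF kern_shift[OF assms(1)] assms(2)])

lemma wint_abs: "wint f \<Longrightarrow> wint (\<lambda>y. \<bar>f y\<bar>)"
  unfolding wint_def using integrable_abs[of lborel "\<lambda>y. f y / (y^2 + 1)"] one_plus_square_pos
  by (auto simp: abs_of_pos)

lemma wint_integrable: assumes "integrable lborel f" shows "wint f"
  unfolding wint_def
proof
  show m: "f \<in> borel_measurable borel" using borel_measurable_integrable[OF assms] by simp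
  show "integrable lborel (\<lambda>y. f y / (y^2 + 1))"
  proof (rule Bochner_Integration.integrable_bound[OF assms])
    have "\<bar>f y\<bar> / (y^2 + 1) \<le> \<bar>f y\<bar> / 1" for y by (intro divide_left_mono) auto
    then show "AE y in lborel. norm (f y / (y^2 + 1)) \<le> norm (f y)"
      using one_plus_square_pos by (auto simp: abs_of_pos)
  qed (use m in measurable)
qed

lemma wint_bounded:
  assumes "f \<in> borel_measurable borel" "\<And>y. \<bar>f y\<bar> \<le> B" shows "wint f"
  unfolding wint_def
proof
  show "integrable lborel (\<lambda>y. f y / (y^2 + 1))"
  proof (rule Bochner_Integration.integrable_bound[of _ "\<lambda>y. B * (1 / (y^2 + 1^2))"])
    show "integrable lborel (\<lambda>y::real. B * (1 / (y^2 + 1^2)))"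
      by (intro integrable_mult_right integral_poisson_density) simp
    have "\<bar>f y\<bar> / (y^2 + 1) \<le> \<bar>B\<bar> / (y^2 + 1)" for y
      using assms(2)[of y] one_plus_square_pos[of y] by (intro divide_right_mono) auto
    then show "AE y in lborel. norm (f y / (y^2 + 1)) \<le> norm (B * (1 / (y^2 + 1^2)))"
      using one_plus_square_pos by (auto simp: abs_of_pos abs_mult)
  qed (use assms(1) in measurable)
qed (rule assms)

lemma L2_inverse_weight: "L2 (\<lambda>y. 1 / (y^2 + 1))"
  unfolding L2_iff
proof
  show "integrable lborel (\<lambda>y::real. (1 / (y^2 + 1))^2)"
  proof (rule Bochner_Integration.integrable_bound[of _ "\<lambda>y::real. 1 / (y^2 + 1^2)"])
    have "(1 / (y^2 + 1))^2 \<le> 1 / (y^2 + 1)" for y :: real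
    proof -
      have "1 / (y^2 + 1) \<le> 1" "0 \<le> 1 / (y^2 + 1)" using one_plus_square_pos[of y] by auto
      then have "(1 / (y^2 + 1)) * (1 / (y^2 + 1)) \<le> 1 * (1 / (y^2 + 1))" by (intro mult_right_mono)
      then show ?thesis by (simp add: power2_eq_square)
    qed
    then show "AE y in lborel. norm ((1 / (y^2 + 1))^2) \<le> norm (1 / (y^2 + 1^2) :: real)"
      using one_plus_square_pos by (auto simp: abs_of_pos)
  qed (use integral_poisson_density(1)[of 1] in auto)
qed measurable

lemma wint_L2: assumes "L2 f" shows "wint f"
  using L2_mult_integrable[OF assms L2_inverse_weight] L2_meas[OF assms] by (simp add: wint_def)

lemma conv_measurable:
  assumes [measurable]: "k \<in> borel_measurable borel" "f \<in> borel_measurable borel"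
  shows "conv k f \<in> borel_measurable borel"
  unfolding conv_def[abs_def] by measurable

text \<open>Only the derivative of the kernel has to lie in \<open>kern\<close>; integrability
  against \<open>k\<close> itself is a separate hypothesis, so that \<open>k\<close> may be
  \<open>qk\<close>.\<close>

lemma conv_deriv:
  assumes der: "\<And>z. (k has_real_derivative k' z) (at z)" and k': "kern k'" and f: "wint f"
    and int: "\<And>x. integrable lborel (\<lambda>y. k (x - y) * f y)"
  shows "(conv k f has_real_derivative conv k' f x) (at x)"
proof -
  obtain C where C: "\<And>z. \<bar>k' z\<bar> \<le> C / (z^2 + 1)" "C \<ge> 0" by (rule kern_bound[OF k']) blast
  have [measurable]: "k' \<in> borel_measurable borel" "f \<in> borel_measurable borel"
    using kern_measurable[OF k'] f by (auto simp: wint_def)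
  \<comment> \<open>For \<open>z\<close> in the unit ball about \<open>x\<close> the two weights
    differ by a factor of at most \<open>2 + 2 (x - z)^2 \<le> 4\<close>.\<close>
  have kD: "kern (\<lambda>z. 4 * C / (z^2 + 1))" unfolding kern_def by (auto intro!: exI[of _ "4 * C"] simp: C(2) one_plus_square_pos abs_of_pos)
  show ?thesis
    unfolding conv_def[abs_def]
  proof (rule has_field_derivative_integral[where e = 1 and \<phi> = "\<lambda>x y. k (x - y) * f y" and \<phi>' = "\<lambda>x y. k' (x - y) * f y"
        and D = "\<lambda>y. 4 * C / ((x - y)^2 + 1) * \<bar>f y\<bar>"])
    show "((\<lambda>z. k (z - y) * f y) has_real_derivative k' (z - y) * f y) (at z)" for z y
    proof -
      have "((\<lambda>z. k (z - y)) has_real_derivative k' (z - y) * (1 - 0)) (at z)"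
        by (rule DERIV_chain2[OF der]) (intro DERIV_diff DERIV_ident DERIV_const)
      then show ?thesis using DERIV_cmult_right[of "\<lambda>z. k (z - y)" "k' (z - y)"] by simp
    qed
    fix z y assume z: "z \<in> ball x 1"
    have "(x - y)^2 + 1 \<le> (2 + 2 * (x - z)^2) * ((z - y)^2 + 1)"
      using shift_weight[of "x - y" "x - z"] by (simp add: algebra_simps power2_commute)
    also have "\<dots> \<le> 4 * ((z - y)^2 + 1)"
    proof (rule mult_right_mono)
      have "\<bar>x - z\<bar> \<le> 1" using z by (simp add: dist_real_def)
      then show "2 + 2 * (x - z)^2 \<le> 4" using abs_le_square_iff[of "x - z" 1] by simp
    qed simp
    finally have "1 / ((z - y)^2 + 1) \<le> 4 / ((x - y)^2 + 1)"
      using one_plus_square_pos[of "z - y"] one_plus_square_pos[of "x - y"] by (simp add: field_simps)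
    then have "C * (1 / ((z - y)^2 + 1)) \<le> C * (4 / ((x - y)^2 + 1))" using C(2) by (rule mult_left_mono)
    then have "\<bar>k' (z - y)\<bar> \<le> 4 * C / ((x - y)^2 + 1)" using C(1)[of "z - y"] by (simp add: mult.commute)
    then show "norm (k' (z - y) * f y) \<le> 4 * C / ((x - y)^2 + 1) * \<bar>f y\<bar>"
      by (simp only: real_norm_def abs_mult) (intro mult_right_mono, auto)
  next
    show "integrable lborel (\<lambda>y. 4 * C / ((x - y)^2 + 1) * \<bar>f y\<bar>)"
      using conv_integrable[OF kD wint_abs[OF f], of x] .
    show "(\<lambda>y. k' (x - y) * f y) \<in> borel_measurable lborel" by measurable
  qed (use int in auto)
qed

lemma convolution_integrable_prod:
  assumes k: "integrable lborel k" and h: "integrable lborel (h :: real \<Rightarrow> real)"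
  shows "integrable (lborel \<Otimes>\<^sub>M lborel) (\<lambda>(x,y). k (x - y) * h y)"
proof -
  have [measurable]: "k \<in> borel_measurable borel" "h \<in> borel_measurable borel"
    using borel_measurable_integrable[OF k] borel_measurable_integrable[OF h] by simp_all
  have shift: "integrable lborel (\<lambda>x. k (x - y))" "(LBINT x. k' (x - y)) = (LBINT x. k' x)" for y and k' :: "real \<Rightarrow> real"
    using lborel_integrable_real_affine[OF k, of 1 "-y"] lborel_integral_real_affine[of 1 k' "-y"] by simp_all
  have "integrable (lborel \<Otimes>\<^sub>M lborel) (\<lambda>(y,x). k (x - y) * h y)"
  proof (rule lborel_pair.Fubini_integrable)
    show "(\<lambda>(y,x). k (x - y) * h y) \<in> borel_measurable (lborel \<Otimes>\<^sub>M lborel)" by measurable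
    show "integrable lborel (\<lambda>y. LBINT x. norm (case (y,x) of (y,x) \<Rightarrow> k (x - y) * h y))"
      using h shift(2)[of "\<lambda>x. \<bar>k x\<bar>"] by (simp add: abs_mult)
    show "AE y in lborel. integrable lborel (\<lambda>x. case (y,x) of (y,x) \<Rightarrow> k (x - y) * h y)"
      using shift(1) by simp
  qed
  from lborel_pair.integrable_product_swap[OF this] show ?thesis by (simp add: case_prod_beta)
qed

lemma conv_integral:
  assumes k: "integrable lborel k" and h: "integrable lborel h"
  shows "integrable lborel (conv k h)" "(LBINT x. conv k h x) = (LBINT x. k x) * (LBINT x. h x)"
proof -
  note i = convolution_integrable_prod[OF k h]
  show "integrable lborel (conv k h)"
    using lborel_pair.integrable_fst'[OF i] by (simp add: conv_def[abs_def])
  have shift: "(LBINT x. k (x - y)) = (LBINT x. k x)" for y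
    using lborel_integral_real_affine[of 1 k "-y"] by simp
  have "(LBINT x. conv k h x) = (LBINT y. (LBINT x. k (x - y) * h y))"
    unfolding conv_def by (rule lborel_pair.Fubini_integral[OF i, symmetric])
  then show "(LBINT x. conv k h x) = (LBINT x. k x) * (LBINT x. h x)"
    by (simp add: shift)
qed

lemma conv_adjoint:
  assumes k: "integrable lborel k" and h: "integrable lborel h"
    and [measurable]: "a \<in> borel_measurable borel" and B: "\<And>x. \<bar>a x\<bar> \<le> B"
  shows "(LBINT x. a x * conv k h x) = (LBINT y. h y * (LBINT x. a x * k (x - y)))"
proof -
  note i0 = convolution_integrable_prod[OF k h]
  have [measurable]: "k \<in> borel_measurable borel" "h \<in> borel_measurable borel"
    using borel_measurable_integrable[OF k] borel_measurable_integrable[OF h] by simp_all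
  have i: "integrable (lborel \<Otimes>\<^sub>M lborel) (\<lambda>(x,y). a x * (k (x - y) * h y))"
  proof (rule Bochner_Integration.integrable_bound[OF integrable_mult_right[OF i0, of B]])
    show "(\<lambda>(x,y). a x * (k (x - y) * h y)) \<in> borel_measurable (lborel \<Otimes>\<^sub>M lborel)" by measurable
    have "norm (a x * (k (x - y) * h y)) \<le> norm (B * (k (x - y) * h y))" for x y
      unfolding real_norm_def abs_mult by (intro mult_right_mono order_trans[OF B abs_ge_self]) auto
    then show "AE p in lborel \<Otimes>\<^sub>M lborel. norm (case p of (x,y) \<Rightarrow> a x * (k (x - y) * h y))
        \<le> norm (B * (case p of (x,y) \<Rightarrow> k (x - y) * h y))" by (auto simp: case_prod_beta)
  qed
  have "(LBINT x. a x * conv k h x) = (LBINT x. (LBINT y. a x * (k (x - y) * h y)))"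
    unfolding conv_def by simp
  also have "\<dots> = (LBINT y. (LBINT x. a x * (k (x - y) * h y)))"
    by (rule lborel_pair.Fubini_integral[OF i, symmetric])
  also have "\<dots> = (LBINT y. h y * (LBINT x. a x * k (x - y)))"
    by (intro Bochner_Integration.integral_cong refl)
       (simp flip: integral_mult_right_zero add: ac_simps)
  finally show ?thesis .
qed

text \<open>Cauchy-Schwarz after splitting the kernel into two factors
  \<open>sqrt \<bar>k\<bar>\<close>. The pointwise form, rather than the norm bound derived from it,
  gives the sign of the defect in the nonlinear term.\<close>

lemma conv_square_le:
  assumes k: "kern k" and f: "L2 f"
  shows "(conv k f x)^2 \<le> (LBINT z. \<bar>k z\<bar>) * conv (\<lambda>z. \<bar>k z\<bar>) (\<lambda>y. (f y)^2) x"
proof -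
  note kx = kern_shift[OF k, of x]
  have [measurable]: "k \<in> borel_measurable borel" "f \<in> borel_measurable borel"
    using kern_measurable[OF k] L2_meas[OF f] by auto
  have i1: "integrable lborel (\<lambda>y. \<bar>k (x - y)\<bar>)" by (rule kern_integrable[OF kern_abs[OF kx]])
  have i2: "integrable lborel (\<lambda>y. \<bar>k (x - y)\<bar> * (f y)^2)"
    using conv_integrable[OF kern_abs[OF k] wint_integrable, of "\<lambda>y. (f y)^2" x] f by (simp add: L2_iff)
  define p where "p = (\<lambda>y. sqrt \<bar>k (x - y)\<bar>)"
  define q where "q = (\<lambda>y. sqrt \<bar>k (x - y)\<bar> * \<bar>f y\<bar>)"
  have p2: "(p y)^2 = \<bar>k (x - y)\<bar>" and q2: "(q y)^2 = \<bar>k (x - y)\<bar> * (f y)^2" and pq: "p y * q y = \<bar>k (x - y) * f y\<bar>" for y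
    by (simp_all add: p_def q_def power_mult_distrib abs_mult mult.assoc[symmetric])
  have L: "L2 p" "L2 q" unfolding L2_iff p2 q2 using i1 i2 by (auto simp: p_def q_def)
  have "\<bar>conv k f x\<bar> \<le> (LBINT y. \<bar>k (x - y) * f y\<bar>)" unfolding conv_def by (rule integral_abs_bound)
  also have "\<dots> = (LBINT y. p y * q y)" unfolding pq ..
  also have "\<dots> \<le> L2_norm p * L2_norm q"
    using L2_Cauchy_Schwarz[OF L] by (rule order_trans[OF abs_ge_self])
  finally have "(conv k f x)^2 \<le> (L2_norm p * L2_norm q)^2"
    using abs_le_square_iff[of "conv k f x" "L2_norm p * L2_norm q"] L2_norm_nonneg[of p] L2_norm_nonneg[of q] by simp
  also have "\<dots> = (LBINT y. \<bar>k (x - y)\<bar>) * (LBINT y. \<bar>k (x - y)\<bar> * (f y)^2)"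
    by (simp add: power_mult_distrib L2_norm_sq p2 q2)
  also have "(LBINT y. \<bar>k (x - y)\<bar>) = (LBINT z. \<bar>k z\<bar>)"
    using lborel_integral_real_affine[of "-1" "\<lambda>z. \<bar>k z\<bar>" x] by simp
  finally show ?thesis by (simp add: conv_def)
qed

lemma conv_L2:
  assumes k: "kern k" and f: "L2 f"
  shows "L2 (conv k f)" "L2_norm (conv k f) \<le> (LBINT z. \<bar>k z\<bar>) * L2_norm f"
proof -
  define I where "I = (LBINT z. \<bar>k z\<bar>)"
  have I0: "0 \<le> I" by (simp add: I_def)
  have [measurable]: "conv k f \<in> borel_measurable borel"
    by (intro conv_measurable kern_measurable[OF k] L2_meas[OF f])
  have f2: "integrable lborel (\<lambda>y. (f y)^2)" using f by (simp add: L2_iff)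
  note ci = conv_integral[OF kern_integrable[OF kern_abs[OF k]] f2]
  have i: "integrable lborel (\<lambda>x. I * conv (\<lambda>z. \<bar>k z\<bar>) (\<lambda>y. (f y)^2) x)"
    using ci(1) by simp
  have le: "(conv k f x)^2 \<le> I * conv (\<lambda>z. \<bar>k z\<bar>) (\<lambda>y. (f y)^2) x" for x
    using conv_square_le[OF k f] by (simp add: I_def)
  have i': "integrable lborel (\<lambda>x. (conv k f x)^2)"
    by (rule Bochner_Integration.integrable_bound[OF i]) (use le in \<open>auto intro: order_trans[OF _ abs_ge_self]\<close>)
  then show "L2 (conv k f)" by (simp add: L2_iff)
  have "(L2_norm (conv k f))^2 \<le> (LBINT x. I * conv (\<lambda>z. \<bar>k z\<bar>) (\<lambda>y. (f y)^2) x)"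
    unfolding L2_norm_sq by (rule integral_mono[OF i' i le])
  also have "\<dots> = (I * L2_norm f)^2"
    using ci(2) by (simp add: I_def L2_norm_sq power_mult_distrib power2_eq_square[of "integral\<^sup>L lborel _"])
  finally show "L2_norm (conv k f) \<le> (LBINT z. \<bar>k z\<bar>) * L2_norm f"
    unfolding I_def[symmetric] by (rule power2_le_imp_le) (simp add: I0 L2_norm_nonneg)
qed

section \<open>The Poisson formula in the half-plane\<close>

text \<open>Cauchy's theorem on the closed upper half-disc: the integral along the diameter is minus
  the one along the arc. Holomorphy slightly below the axis keeps the diameter inside an open convex
  domain.\<close>

lemma arc_integral_bound:
  fixes H :: "complex \<Rightarrow> complex"
  assumes hol: "H holomorphic_on {z. Im z > - d}" and d: "0 < d"
    and B: "\<And>z. Im z \<ge> 0 \<Longrightarrow> norm z = R \<Longrightarrow> norm (H z) \<le> B" "0 \<le> B" and R: "0 < R"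
  shows "norm (integral {-R..R} (\<lambda>x. H (of_real x))) \<le> B * R * pi"
proof -
  let ?S = "{z. Im z > - d}"
  let ?l = "linepath (- of_real R) (of_real R) :: real \<Rightarrow> complex"
  let ?a = "part_circlepath 0 R 0 pi"
  have conv: "convex ?S" by (simp add: convex_halfspace_Im_gt)
  have il: "path_image ?l \<subseteq> ?S"
    using d R by (auto simp: closed_segment_same_Im)
  have ia: "path_image ?a \<subseteq> {z. Im z \<ge> 0 \<and> norm z = R}"
    using R by (auto simp: path_image_part_circlepath' closed_segment_eq_real_ivl norm_mult sin_ge_zero)
  then have ia': "path_image ?a \<subseteq> ?S" using d by force
  have cont: "continuous_on (path_image ?l) H" "continuous_on (path_image ?a) H"
    using il ia' holomorphic_on_imp_continuous_on[OF hol] continuous_on_subset by blast+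
  have cl: "H contour_integrable_on ?l" by (rule contour_integrable_continuous_linepath) (use cont in simp)
  have ca: "H contour_integrable_on ?a" by (rule contour_integrable_continuous_part_circlepath) (use cont in simp)
  have ends: "pathfinish ?l = pathstart ?a" "pathfinish ?a = pathstart ?l"
    by (simp_all add: exp_pi_i' exp_pi_i)
  have "(H has_contour_integral 0) (?l +++ ?a)"
  proof (rule Cauchy_theorem_convex_simple[OF hol conv])
    show "valid_path (?l +++ ?a)" using ends by (intro valid_path_join) auto
    show "path_image (?l +++ ?a) \<subseteq> ?S" using il ia' by (intro subset_path_image_join) auto
  qed (use ends in auto)
  moreover have "(H has_contour_integral (contour_integral ?l H + contour_integral ?a H)) (?l +++ ?a)"
    by (intro has_contour_integral_join has_contour_integral_integral cl ca) auto
  ultimately have "contour_integral ?l H + contour_integral ?a H = 0"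
    using has_contour_integral_unique by blast
  moreover have "contour_integral ?l H = integral {-R..R} (\<lambda>x. H (of_real x))"
    using R by (subst contour_integral_linepath_Reals_eq) auto
  ultimately have "integral {-R..R} (\<lambda>x. H (of_real x)) = - contour_integral ?a H"
    by (simp add: add_eq_0_iff2)
  moreover have "norm (contour_integral ?a H) \<le> B * R * \<bar>pi - 0\<bar>"
    using ia R B by (intro contour_integral_bound_part_circlepath ca) auto
  ultimately show ?thesis by simp
qed

text \<open>The quotient \<open>(g(z) - g(i m)) / (z^2 + m^2)\<close> has a removable singularity at \<open>i m\<close>, so that Cauchy's theorem
on half-discs suffices and no winding number has to be computed.\<close>
lemma poisson_formula:
  assumes hol: "g holomorphic_on {z. Im z > - d}" and d: "0 < d" and m: "0 < m"
    and B: "\<And>z. Im z \<ge> 0 \<Longrightarrow> norm (g z) \<le> B"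
  shows "integrable lborel (\<lambda>x. g (of_real x) / of_real (x^2 + m^2))"
    and "(LBINT x. g (of_real x) / of_real (x^2 + m^2)) = of_real (pi / m) * g (\<i> * of_real m)"
proof -
  \<comment> \<open>With \<open>e \<le> m\<close> the second zero \<open>- i m\<close> of
    \<open>z^2 + m^2\<close> stays outside the strip, so only the singularity at \<open>i m\<close>
    has to be removed.\<close>
  define e where "e = min d m"
  have e: "0 < e" "e \<le> d" "e \<le> m" using d m by (auto simp: e_def)
  let ?S = "{z. Im z > - e}"
  have hol': "g holomorphic_on ?S" using e by (intro holomorphic_on_subset[OF hol]) auto
  have op: "open ?S" by (simp add: open_halfspace_Im_gt)
  define w where "w = \<i> * of_real m"
  have wS: "w \<in> ?S" using m e by (simp add: w_def)
  define H0 where "H0 = (\<lambda>z. if z = w then deriv g w else (g z - g w) / (z - w))"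
  have H0: "H0 holomorphic_on ?S"
    unfolding H0_def using wS interior_open[OF op] by (intro pole_lemma[OF hol']) simp
  define H where "H = (\<lambda>z. H0 z / (z + w))"
  have H: "H holomorphic_on ?S"
    unfolding H_def
  proof (intro holomorphic_intros H0)
    fix z assume "z \<in> ?S"
    then have "Im (z + w) > 0" using e by (simp add: w_def)
    then show "z + w \<noteq> 0" by (metis less_irrefl zero_complex.sel(2))
  qed
  have Heq: "H z = (g z - g w) / (z^2 + of_real (m^2))" if "z \<noteq> w" for z
  proof -
    have "z^2 + of_real (m^2) = (z - w) * (z + w)"
      by (simp add: w_def algebra_simps power2_eq_square)
    then show ?thesis using that by (simp add: H_def H0_def)
  qed
  have pos: "0 < x^2 + m^2" for x using m by (simp add: add_nonneg_pos)
  have Hreal: "H (of_real x) = (g (of_real x) - g w) / of_real (x^2 + m^2)" for x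
    by (subst Heq) (use m in \<open>auto simp: w_def complex_eq_iff\<close>)
  have contg: "continuous_on UNIV (\<lambda>x. g (of_real x))"
    by (rule continuous_on_compose2[OF holomorphic_on_imp_continuous_on[OF hol]])
       (use d in \<open>auto intro!: continuous_intros\<close>)
  have [measurable]: "(\<lambda>x. g (of_real x)) \<in> borel_measurable borel"
    by (rule borel_measurable_continuous_onI[OF contg])
  have B0: "0 \<le> B" using order_trans[OF norm_ge_zero B[of 0]] by simp
  have gB: "norm (g (of_real x)) \<le> B" for x by (rule B) simp
  have dens: "integrable lborel (\<lambda>x. 1 / (x^2 + m^2))" "(LBINT x. 1 / (x^2 + m^2)) = pi / m"
    using integral_poisson_density[OF m] by auto
  show int: "integrable lborel (\<lambda>x. g (of_real x) / of_real (x^2 + m^2))"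
  proof (rule Bochner_Integration.integrable_bound[OF integrable_mult_right[OF dens(1), of B]])
    have "norm (g (of_real x) / of_real (x^2 + m^2)) \<le> norm (B * (1 / (x^2 + m^2)))" for x
    proof -
      have "norm (g (of_real x) / of_real (x^2 + m^2)) = norm (g (of_real x)) / (x^2 + m^2)"
        unfolding norm_divide norm_of_real using pos[of x] by simp
      also have "\<dots> \<le> B * (1 / (x^2 + m^2))"
        using gB[of x] pos[of x] by (simp add: divide_right_mono)
      finally show ?thesis using B0 by simp
    qed
    then show "AE x in lborel. norm (g (of_real x) / of_real (x^2 + m^2)) \<le> norm (B * (1 / (x^2 + m^2)))" by simp
  qed measurable
  have dc: "integrable lborel (\<lambda>x. g w * of_real (1 / (x^2 + m^2)))"
    by (intro integrable_mult_right integrable_of_real dens)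
  have HrealE: "(\<lambda>x. H (of_real x)) = (\<lambda>x. g (of_real x) / of_real (x^2 + m^2) - g w * of_real (1 / (x^2 + m^2)))"
    by (rule ext) (simp add: Hreal diff_divide_distrib)
  have intH: "integrable lborel (\<lambda>x. H (of_real x))"
    unfolding HrealE by (rule Bochner_Integration.integrable_diff[OF int dc])
  have lim1: "(\<lambda>n. integral {- real n..real n} (\<lambda>x. H (of_real x))) \<longlonglongrightarrow> (LBINT x. H (of_real x))"
  proof -
    have eq: "integral {- real n..real n} (\<lambda>x. H (of_real x)) = (LBINT x. indicator {- real n..real n} x *\<^sub>R H (of_real x))" for n
    proof -
      have "set_integrable lborel {- real n..real n} (\<lambda>x. H (of_real x))"
        using integrable_mult_indicator[OF _ intH, of "{- real n..real n}"] by (simp add: set_integrable_def)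
      from set_borel_integral_eq_integral(2)[OF this] show ?thesis
        unfolding set_lebesgue_integral_def by (rule sym)
    qed
    show ?thesis unfolding eq
    proof (rule integral_dominated_convergence[where w = "\<lambda>x. norm (H (of_real x))"])
      show "AE x in lborel. (\<lambda>n. indicator {- real n..real n} x *\<^sub>R H (of_real x)) \<longlonglongrightarrow> H (of_real x)"
      proof (rule AE_I2, rule tendsto_eventually)
        fix x
        obtain N :: nat where "\<bar>x\<bar> \<le> real N" using real_arch_simple by blast
        then show "\<forall>\<^sub>F n in sequentially. indicator {- real n..real n} x *\<^sub>R H (of_real x) = H (of_real x)"
          by (intro eventually_sequentiallyI[of N]) (auto simp: indicator_def)
      qed
      show "(\<lambda>x. H (of_real x)) \<in> borel_measurable lborel" using intH by (rule borel_measurable_integrable)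
      then show "(\<lambda>x. indicator {- real n..real n} x *\<^sub>R H (of_real x)) \<in> borel_measurable lborel" for n
        by measurable
      show "integrable lborel (\<lambda>x. norm (H (of_real x)))" using intH by (rule integrable_norm)
    qed (auto simp: indicator_def)
  qed
  \<comment> \<open>On the arc of radius \<open>n\<close> the quotient is \<open>O(n^(-2))\<close>,
    which beats the length \<open>n pi\<close>.\<close>
  have lim2: "(\<lambda>n. integral {- real n..real n} (\<lambda>x. H (of_real x))) \<longlonglongrightarrow> 0"
  proof (rule Lim_null_comparison)
    show "\<forall>\<^sub>F n in sequentially. norm (integral {- real n..real n} (\<lambda>x. H (of_real x))) \<le> (2 * B) / ((real n)^2 - m^2) * real n * pi"
      using eventually_gt_at_top[of "nat \<lceil>m\<rceil>"]
    proof eventually_elim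
      case (elim n)
      then have n: "m < real n" by linarith
      then have n2: "m^2 < (real n)^2" using m by (intro power_strict_mono) auto
      show ?case
      proof (rule arc_integral_bound[OF H e(1)])
        show "0 \<le> 2 * B / ((real n)^2 - m^2)" using B0 n2 by simp
        show "0 < real n" using n m by linarith
        fix z :: complex assume z: "Im z \<ge> 0" "norm z = real n"
        have "norm w = m" using m by (simp add: w_def norm_mult)
        then have zw: "z \<noteq> w" using z n by auto
        have "norm (g z - g w) \<le> 2 * B"
          using norm_triangle_ineq4[of "g z" "g w"] B[of z] B[of w] z m by (simp add: w_def)
        moreover have "(real n)^2 - m^2 \<le> norm (z^2 + of_real (m^2))"
          using norm_diff_ineq[of "z^2" "of_real (m^2)"] z by (simp add: norm_power norm_mult)
        ultimately show "norm (H z) \<le> 2 * B / ((real n)^2 - m^2)"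
          unfolding Heq[OF zw] norm_divide using n2 B0 by (intro frac_le) auto
      qed
    qed
    show "(\<lambda>n. (2 * B) / ((real n)^2 - m^2) * real n * pi) \<longlonglongrightarrow> 0" by real_asymp
  qed
  have "(LBINT x. H (of_real x)) = 0" by (rule LIMSEQ_unique[OF lim1 lim2])
  then have "(LBINT x. g (of_real x) / of_real (x^2 + m^2)) = (LBINT x. g w * of_real (1 / (x^2 + m^2)))"
    unfolding HrealE Bochner_Integration.integral_diff[OF int dc] by simp
  also have "\<dots> = g w * of_real (LBINT x. 1 / (x^2 + m^2))"
    by (simp only: integral_mult_right_zero integral_complex_of_real)
  finally show "(LBINT x. g (of_real x) / of_real (x^2 + m^2)) = of_real (pi / m) * g (\<i> * of_real m)"
    unfolding dens(2) by (simp add: w_def mult.commute)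
qed

section \<open>Poisson kernels\<close>

text \<open>\<open>pk\<close> and \<open>qk\<close> are the Poisson and conjugate Poisson kernels at
  height \<open>e\<close>, the real and imaginary parts of \<open>i / (pi (z + i e))\<close>. The
  suffixes \<open>1\<close> and \<open>2\<close> count derivatives in \<open>z\<close>.\<close>

definition pk :: "real \<Rightarrow> real \<Rightarrow> real" where "pk e z = e / (pi * (z^2 + e^2))"
definition pk1 :: "real \<Rightarrow> real \<Rightarrow> real" where "pk1 e z = - 2 * e * z / (pi * (z^2 + e^2)^2)"
definition pk2 :: "real \<Rightarrow> real \<Rightarrow> real" where
  "pk2 e z = e * (8 * z^2 - 2 * (z^2 + e^2)) / (pi * (z^2 + e^2)^3)"
definition qk :: "real \<Rightarrow> real \<Rightarrow> real" where "qk e z = z / (pi * (z^2 + e^2))"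
definition qk1 :: "real \<Rightarrow> real \<Rightarrow> real" where "qk1 e z = ((z^2 + e^2) - 2 * z^2) / (pi * (z^2 + e^2)^2)"
definition qk2 :: "real \<Rightarrow> real \<Rightarrow> real" where
  "qk2 e z = z * (8 * z^2 - 6 * (z^2 + e^2)) / (pi * (z^2 + e^2)^3)"

lemma kernel_denom:
  fixes e z :: real
  assumes "0 < e" shows "0 < z^2 + e^2" "2 * e * \<bar>z\<bar> \<le> z^2 + e^2" "z^2 \<le> z^2 + e^2" "e^2 \<le> z^2 + e^2"
proof -
  show "0 < z^2 + e^2" using assms by (simp add: add_nonneg_pos)
  show "2 * e * \<bar>z\<bar> \<le> z^2 + e^2"
    using zero_le_power2[of "\<bar>z\<bar> - e"] by (simp add: power2_diff algebra_simps)
qed auto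

lemma DERIV_denom: "((\<lambda>z::real. z^2 + e^2) has_real_derivative 2 * z) (at z)"
  by (auto intro!: derivative_eq_intros)

lemma kernel_derivs:
  assumes "0 < e"
  shows "(pk e has_real_derivative pk1 e z) (at z)" "(qk e has_real_derivative qk1 e z) (at z)"
    "(pk1 e has_real_derivative pk2 e z) (at z)" "(qk1 e has_real_derivative qk2 e z) (at z)"
proof -
  define D where "D = (\<lambda>z. z^2 + e^2)"
  have D: "(D has_real_derivative 2 * z) (at z)" unfolding D_def by (rule DERIV_denom)
  have pos: "D z > 0" using kernel_denom(1)[OF assms] by (simp add: D_def)
  have d1: "((\<lambda>z. e / (pi * D z)) has_real_derivative - 2 * e * z / (pi * (D z)^2)) (at z)"
    by (rule derivative_eq_intros D refl | use pos in \<open>simp add: field_simps power2_eq_square\<close>)+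
  have d2: "((\<lambda>z. z / (pi * D z)) has_real_derivative (D z - 2 * z^2) / (pi * (D z)^2)) (at z)"
    by (rule derivative_eq_intros D refl | use pos in \<open>simp add: field_simps power2_eq_square\<close>)+
  have d3: "((\<lambda>z. - 2 * e * z / (pi * (D z)^2)) has_real_derivative e * (8 * z^2 - 2 * D z) / (pi * (D z)^3)) (at z)"
    by (rule derivative_eq_intros D refl | use pos in \<open>simp add: field_simps power2_eq_square power3_eq_cube\<close>)+
  have d4: "((\<lambda>z. (D z - 2 * z^2) / (pi * (D z)^2)) has_real_derivative z * (8 * z^2 - 6 * D z) / (pi * (D z)^3)) (at z)"
    by (rule derivative_eq_intros D refl | use pos in \<open>simp add: field_simps power2_eq_square power3_eq_cube\<close>)+
  show "(pk e has_real_derivative pk1 e z) (at z)" using d1 by (simp add: pk_def[abs_def] pk1_def D_def)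
  show "(qk e has_real_derivative qk1 e z) (at z)" using d2 by (simp add: qk_def[abs_def] qk1_def D_def)
  show "(pk1 e has_real_derivative pk2 e z) (at z)" using d3 by (simp add: pk1_def[abs_def] pk2_def D_def)
  show "(qk1 e has_real_derivative qk2 e z) (at z)" using d4 by (simp add: qk1_def[abs_def] qk2_def D_def)
qed

lemma kernI:
  assumes "0 < e" "k \<in> borel_measurable borel" "\<And>z. \<bar>k z\<bar> \<le> B / (z^2 + e^2)"
  shows "kern k"
proof -
  have "\<bar>k z\<bar> \<le> (B * (1 + 1 / e^2)) / (z^2 + 1)" for z
  proof -
    have D: "0 < z^2 + e^2" by (rule kernel_denom(1)[OF assms(1)])
    have "0 \<le> B / (0^2 + e^2)" by (rule order_trans[OF abs_ge_zero assms(3)])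
    then have B: "0 \<le> B" using assms(1) by (simp add: zero_le_divide_iff)
    have "z^2 + 1 \<le> (1 + 1 / e^2) * (z^2 + e^2)"
      using assms(1) by (simp add: distrib_left distrib_right)
    then have "1 / (z^2 + e^2) \<le> (1 + 1 / e^2) / (z^2 + 1)"
      using D one_plus_square_pos[of z] by (simp add: divide_simps mult.commute)
    then have "B * (1 / (z^2 + e^2)) \<le> B * ((1 + 1 / e^2) / (z^2 + 1))" using B by (rule mult_left_mono)
    then show ?thesis using assms(3)[of z] by simp
  qed
  then show ?thesis using assms(2) unfolding kern_def by blast
qed

lemma kernel_measurable [measurable]:
  "pk e \<in> borel_measurable borel" "pk1 e \<in> borel_measurable borel" "pk2 e \<in> borel_measurable borel"
  "qk e \<in> borel_measurable borel" "qk1 e \<in> borel_measurable borel" "qk2 e \<in> borel_measurable borel"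
  unfolding pk_def[abs_def] pk1_def[abs_def] pk2_def[abs_def] qk_def[abs_def] qk1_def[abs_def] qk2_def[abs_def]
  by measurable

lemma kernel_kern:
  assumes e: "0 < e"
  shows "kern (pk e)" "kern (pk1 e)" "kern (pk2 e)" "kern (qk1 e)" "kern (qk2 e)"
proof -
  have b: "\<bar>N / (pi * (z^2 + e^2)^2)\<bar> \<le> (B / pi) / (z^2 + e^2)" if "\<bar>N\<bar> \<le> B * (z^2 + e^2)" for N B z
  proof -
    define D where "D = z^2 + e^2"
    have D: "0 < D" unfolding D_def by (rule kernel_denom(1)[OF e])
    have "\<bar>N / (pi * D^2)\<bar> = \<bar>N\<bar> / (pi * D^2)" by (simp add: abs_mult)
    also have "\<dots> \<le> (B * D) / (pi * D^2)" using that by (intro divide_right_mono) (auto simp: D_def)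
    also have "\<dots> = (B / pi) / D" using D by (simp add: power2_eq_square)
    finally show ?thesis unfolding D_def .
  qed
  show "kern (pk e)"
    by (rule kernI[OF e, where B = "e / pi"]) (use e kernel_denom(1)[OF e] in \<open>auto simp: pk_def abs_mult abs_of_pos\<close>)
  show "kern (pk1 e)"
    unfolding pk1_def[abs_def]
  proof (rule kernI[OF e _ b])
    show "\<bar>- 2 * e * z\<bar> \<le> 1 * (z^2 + e^2)" for z using kernel_denom(2)[OF e, of z] e by (simp add: abs_mult)
  qed measurable
  show "kern (qk1 e)"
    unfolding qk1_def[abs_def]
  proof (rule kernI[OF e _ b])
    show "\<bar>z^2 + e^2 - 2 * z^2\<bar> \<le> 1 * (z^2 + e^2)" for z by (auto simp: abs_le_iff)
  qed measurable
  have three: "N / (pi * (z^2 + e^2)^3) = (N / (z^2 + e^2)) / (pi * (z^2 + e^2)^2)" for N z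
    by (simp add: power3_eq_cube power2_eq_square)
  show "kern (pk2 e)"
    unfolding pk2_def[abs_def] three
  proof (rule kernI[OF e _ b])
    fix z
    have D: "0 < z^2 + e^2" by (rule kernel_denom(1)[OF e])
    have "\<bar>8 * z^2 - 2 * (z^2 + e^2)\<bar> \<le> 6 * (z^2 + e^2)" by (auto simp: abs_le_iff)
    then have "\<bar>e * (8 * z^2 - 2 * (z^2 + e^2)) / (z^2 + e^2)\<bar> \<le> 6 * e"
      using D e by (simp add: abs_mult abs_of_pos pos_divide_le_eq)
    also have "6 * e \<le> (6 / e) * (z^2 + e^2)"
    proof -
      have "(6 / e) * e^2 \<le> (6 / e) * (z^2 + e^2)" using e by (intro mult_left_mono) auto
      then show ?thesis using e by (simp add: power2_eq_square)
    qed
    finally show "\<bar>e * (8 * z^2 - 2 * (z^2 + e^2)) / (z^2 + e^2)\<bar> \<le> (6 / e) * (z^2 + e^2)" .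
  qed measurable
  show "kern (qk2 e)"
    unfolding qk2_def[abs_def] three
  proof (rule kernI[OF e _ b])
    fix z
    have D: "0 < z^2 + e^2" by (rule kernel_denom(1)[OF e])
    have "\<bar>8 * z^2 - 6 * (z^2 + e^2)\<bar> \<le> 6 * (z^2 + e^2)" by (auto simp: abs_le_iff)
    then have "\<bar>z * (8 * z^2 - 6 * (z^2 + e^2)) / (z^2 + e^2)\<bar> \<le> \<bar>z\<bar> * 6"
      using D mult_left_mono[of "\<bar>8 * z^2 - 6 * (z^2 + e^2)\<bar>" "6 * (z^2 + e^2)" "\<bar>z\<bar>"]
      by (simp add: abs_mult abs_of_pos pos_divide_le_eq mult.assoc)
    also have "\<bar>z\<bar> * 6 \<le> (3 / e) * (z^2 + e^2)"
    proof -
      have "(3 / e) * (2 * e * \<bar>z\<bar>) \<le> (3 / e) * (z^2 + e^2)"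
        using e by (intro mult_left_mono kernel_denom(2)) auto
      then show ?thesis using e by simp
    qed
    finally show "\<bar>z * (8 * z^2 - 6 * (z^2 + e^2)) / (z^2 + e^2)\<bar> \<le> (3 / e) * (z^2 + e^2)" .
  qed measurable
qed

lemma pk_nonneg: "0 < e \<Longrightarrow> 0 \<le> pk e z"
  by (simp add: pk_def)

lemma pk_even: "pk e (- z) = pk e z"
  by (simp add: pk_def)

lemma pk_integral: assumes "0 < e" shows "(LBINT z. pk e z) = 1"
proof -
  have "pk e = (\<lambda>z. (e / pi) * (1 / (z^2 + e^2)))" by (auto simp: pk_def)
  then show ?thesis
    by (simp only: integral_mult_right_zero integral_poisson_density(2)[OF assms]) (use assms in simp)
qed

lemma L2_qk: assumes e: "0 < e" shows "L2 (qk e)"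
  unfolding L2_iff
proof
  show "integrable lborel (\<lambda>z. (qk e z)^2)"
  proof (rule Bochner_Integration.integrable_bound[OF integral_poisson_density(1)[OF e]])
    have "(qk e z)^2 \<le> 1 / (z^2 + e^2)" for z
    proof -
      define D where "D = z^2 + e^2"
      have D: "0 < D" "z^2 \<le> D" using kernel_denom[OF e] by (auto simp: D_def)
      have "(qk e z)^2 = z^2 / (pi^2 * D^2)" by (simp add: qk_def D_def power_divide power_mult_distrib)
      also have "\<dots> \<le> D / (1 * D^2)"
      proof (rule frac_le)
        have "1 \<le> pi^2" using pi_gt3 one_le_power[of pi 2] by simp
        then show "1 * D^2 \<le> pi^2 * D^2" by (intro mult_right_mono) auto
      qed (use D in auto)
      also have "\<dots> = 1 / D" using D by (simp add: power2_eq_square)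
      finally show ?thesis by (simp add: D_def)
    qed
    then show "AE z in lborel. norm ((qk e z)^2) \<le> norm (1 / (z^2 + e^2))"
      using kernel_denom(1)[OF e] by (auto simp: abs_of_pos)
  qed measurable
qed measurable

text \<open>The semigroup law of the Poisson kernels is the Poisson formula for the Cauchy kernel.\<close>
lemma pk_semigroup:
  assumes e: "0 < e" and m: "0 < m"
  shows "integrable lborel (\<lambda>x. pk m x * pk e (x - y))" "(LBINT x. pk m x * pk e (x - y)) = pk (m + e) y"
proof -
  define g where "g = (\<lambda>z. 1 / (z + \<i> * of_real e - of_real y))"
  have nz: "z + \<i> * of_real e - of_real y \<noteq> 0" if "Im z > - e" for z
    using that by (auto simp: complex_eq_iff)
  have hol: "g holomorphic_on {z. Im z > - e}"
    unfolding g_def by (intro holomorphic_intros) (use nz in auto)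
  have bd: "norm (g z) \<le> 1 / e" if "Im z \<ge> 0" for z
  proof -
    have "e \<le> \<bar>Im (z + \<i> * of_real e - of_real y)\<bar>" using that e by simp
    also have "\<dots> \<le> norm (z + \<i> * of_real e - of_real y)" by (rule abs_Im_le_cmod)
    finally show ?thesis unfolding g_def norm_divide using e by (simp add: frac_le)
  qed
  note pf = poisson_formula[OF hol e m bd]
  \<comment> \<open>\<open>pk e (x - y)\<close> is the real part of \<open>i / pi\<close> times the
    Cauchy kernel \<open>g\<close>; the factor \<open>m / pi\<close> comes from
    \<open>pk m\<close>.\<close>
  have ptw: "pk m x * pk e (x - y) = Re ((\<i> * of_real (m / pi^2)) * (g (of_real x) / of_real (x^2 + m^2)))" for x
  proof -
    have "g (of_real x) = (of_real (x - y) - \<i> * of_real e) / of_real ((x - y)^2 + e^2)"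
    proof -
      have "of_real ((x - y)^2 + e^2) = (of_real x + \<i> * of_real e - of_real y) * (of_real (x - y) - \<i> * of_real e)"
        by (simp add: complex_eq_iff power2_eq_square algebra_simps)
      moreover have "of_real ((x - y)^2 + e^2) \<noteq> (0::complex)"
        using kernel_denom(1)[OF e, of "x - y"] by (metis of_real_eq_0_iff less_irrefl)
      ultimately show ?thesis unfolding g_def by (simp add: divide_simps del: of_real_add of_real_diff of_real_power)
    qed
    then show ?thesis by (simp add: pk_def power2_eq_square del: of_real_add of_real_diff of_real_power of_real_mult)
  qed
  have i: "integrable lborel (\<lambda>x. (\<i> * of_real (m / pi^2)) * (g (of_real x) / of_real (x^2 + m^2)))"
    using pf(1) by (rule integrable_mult_right)
  show "integrable lborel (\<lambda>x. pk m x * pk e (x - y))"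
    unfolding ptw by (rule integrable_Re[OF i])
  have "(LBINT x. pk m x * pk e (x - y)) = Re (LBINT x. (\<i> * of_real (m / pi^2)) * (g (of_real x) / of_real (x^2 + m^2)))"
    unfolding ptw by (rule integral_Re[OF i])
  also have "(LBINT x. (\<i> * of_real (m / pi^2)) * (g (of_real x) / of_real (x^2 + m^2)))
     = (\<i> * of_real (m / pi^2)) * (of_real (pi / m) * g (\<i> * of_real m))"
    by (simp only: integral_mult_right_zero pf(2))
  also have "\<dots> = \<i> * of_real (1 / pi) * g (\<i> * of_real m)"
    using m by (simp add: power2_eq_square)
  also have "g (\<i> * of_real m) = (- of_real y - \<i> * of_real (m + e)) / of_real (y^2 + (m + e)^2)"
  proof -
    have p: "0 < m + e" using e m by simp
    have "of_real (y^2 + (m + e)^2) = (\<i> * of_real m + \<i> * of_real e - of_real y) * (- of_real y - \<i> * of_real (m + e))"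
      by (simp add: complex_eq_iff power2_eq_square algebra_simps)
    moreover have "of_real (y^2 + (m + e)^2) \<noteq> (0::complex)"
      using kernel_denom(1)[OF p, of y] by (metis of_real_eq_0_iff less_irrefl)
    ultimately show ?thesis unfolding g_def by (simp add: divide_simps del: of_real_add of_real_diff of_real_power)
  qed
  also have "Re (\<i> * of_real (1 / pi) * ((- of_real y - \<i> * of_real (m + e)) / of_real (y^2 + (m + e)^2))) = pk (m + e) y"
    by (simp add: pk_def del: of_real_add of_real_diff of_real_power of_real_mult)
  finally show "(LBINT x. pk m x * pk e (x - y)) = pk (m + e) y" .
qed

section \<open>The Hilbert transform of the Poisson kernel\<close>

lemma integral_even_half:
  fixes h :: "real \<Rightarrow> real"
  assumes i: "integrable lborel h" and ev: "\<And>s. h (- s) = h s"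
  shows "(LBINT s. indicator {0<..} s * h s) = (LBINT s. h s) / 2"
proof -
  have i1: "integrable lborel (\<lambda>s. indicator {0<..} s * h s)"
    using integrable_mult_indicator[OF _ i, of "{0<..}"] by simp
  have i2: "integrable lborel (\<lambda>s. indicator {0<..} (0 + (-1) * s) * h (0 + (-1) * s))"
    by (rule lborel_integrable_real_affine[OF i1]) simp
  have [measurable]: "h \<in> borel_measurable borel" using borel_measurable_integrable[OF i] by simp
  have "(LBINT s. h s) = (LBINT s. indicator {0<..} s * h s + indicator {0<..} (0 + (-1) * s) * h (0 + (-1) * s))"
  proof (rule integral_cong_AE)
    show "AE s in lborel. h s = indicator {0<..} s * h s + indicator {0<..} (0 + (-1) * s) * h (0 + (-1) * s)"
      using AE_lborel_singleton[of "0::real"] by eventually_elim (auto simp: indicator_def ev)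
  qed measurable
  also have "\<dots> = (LBINT s. indicator {0<..} s * h s) + (LBINT s. indicator {0<..} (0 + (-1) * s) * h (0 + (-1) * s))"
    by (rule Bochner_Integration.integral_add[OF i1 i2])
  also have "(LBINT s. indicator {0<..} (0 + (-1) * s) * h (0 + (-1) * s)) = (LBINT s. indicator {0<..} s * h s)"
    using lborel_integral_real_affine[of "-1" "\<lambda>s. indicator {0<..} s * h s" 0] by simp
  finally show ?thesis by simp
qed

text \<open>\<open>1/A - 1/B = (B - A) / (A B)\<close> with \<open>B - A = 4 z s\<close>: the
  singular factor \<open>1/s\<close> cancels and a product of two Poisson kernels is left, which the
  semigroup law can integrate.\<close>

lemma pk_difference:
  assumes e: "0 < e" and s: "0 < s"
  shows "(pk e (z - s) - pk e (z + s)) / s = 4 * z * (pi / e) * (pk e (z - s) * pk e (z + s))"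
proof -
  define A where "A = (z - s)^2 + e^2"
  define B where "B = (z + s)^2 + e^2"
  have pos: "A > 0" "B > 0" using kernel_denom(1)[OF e] by (auto simp: A_def B_def)
  have BA: "B - A = 4 * z * s" by (simp add: A_def B_def power2_eq_square algebra_simps)
  have "e / (pi * A) - e / (pi * B) = e * (B - A) / (pi * (A * B))"
    using pos by (simp add: field_simps)
  then have "(e / (pi * A) - e / (pi * B)) / s = e * (4 * z) / (pi * (A * B))"
    using s unfolding BA by simp
  also have "\<dots> = 4 * z * (pi / e) * ((e / (pi * A)) * (e / (pi * B)))"
    using pos e by (simp add: field_simps)
  finally show ?thesis by (simp add: pk_def A_def B_def)
qed

text \<open>Shifted by \<open>z\<close> and using evenness, the product becomes a convolution of two
  Poisson kernels evaluated at \<open>2 z\<close>, hence a Poisson kernel at height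
  \<open>2 e\<close>; evenness in \<open>s\<close> halves it. Together with
  \<open>pk_difference\<close> this says that the Hilbert transform of \<open>pk e\<close> is
  \<open>qk e\<close>.\<close>

lemma pk_product_half_integral:
  assumes e: "0 < e"
  shows "integrable lborel (\<lambda>s. pk e (z - s) * pk e (z + s))"
    and "4 * z * (pi / e) * (LBINT s. indicator {0<..} s * (pk e (z - s) * pk e (z + s))) = pi * qk e z"
proof -
  have eq: "(\<lambda>s. pk e (z - s) * pk e (z + s)) = (\<lambda>s. pk e (z + 1 * s) * pk e ((z + 1 * s) - 2 * z))"
    using pk_even[of e] by (auto simp: fun_eq_iff) (metis minus_diff_eq)
  show i: "integrable lborel (\<lambda>s. pk e (z - s) * pk e (z + s))"
    unfolding eq by (rule lborel_integrable_real_affine[OF pk_semigroup(1)[OF e e]]) simp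
  have "(LBINT s. pk e (z - s) * pk e (z + s)) = pk (e + e) (2 * z)"
    unfolding eq using lborel_integral_real_affine[of 1 "\<lambda>x. pk e x * pk e (x - 2 * z)" z] pk_semigroup(2)[OF e e, of "2 * z"]
    by simp
  then have "(LBINT s. indicator {0<..} s * (pk e (z - s) * pk e (z + s))) = pk (e + e) (2 * z) / 2"
    by (subst integral_even_half[OF i]) (auto simp: mult.commute)
  also have "pk (e + e) (2 * z) = e / (2 * (pi * (z^2 + e^2)))"
  proof -
    have "(2 * z)^2 + (e + e)^2 = 4 * (z^2 + e^2)" by (simp add: power2_eq_square algebra_simps)
    moreover have "(e + e) / (pi * (4 * D)) = e / (2 * (pi * D))" for D by simp
    ultimately show ?thesis unfolding pk_def by metis
  qed
  finally have half: "(LBINT s. indicator {0<..} s * (pk e (z - s) * pk e (z + s))) = e / (2 * (pi * (z^2 + e^2))) / 2" .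
  define D where "D = z^2 + e^2"
  have "0 < D" unfolding D_def by (rule kernel_denom(1)[OF e])
  then show "4 * z * (pi / e) * (LBINT s. indicator {0<..} s * (pk e (z - s) * pk e (z + s))) = pi * qk e z"
    unfolding half qk_def D_def[symmetric] using e by (simp add: field_simps)
qed

text \<open>In the second application of Fubini, \<open>pk e (z - s) - pk e (z + s)\<close> has the sign of \<open>z\<close> for all
\<open>s > 0\<close>, so absolute integrability is read off from the value of the integral.\<close>
lemma poisson_hilbert:
  assumes e: "0 < e" and s: "sob f g" and hm: "h \<in> borel_measurable borel" and h: "AE x in lborel. h x = f x"
  shows "conv (pk e) (hilbert h) x = conv (qk e) f x"
proof -
  have f: "L2 f" using s by (simp add: sob_def)
  have [measurable]: "f \<in> borel_measurable borel" using f by (rule L2_meas)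
  define N where "N = 4 * (L2_norm f + L2_norm g)"
  define K where "K = (\<lambda>y s. pk e (x - y) * (indicator {0<..} s * hilbert_diff f y s))"
  have Km: "case_prod K \<in> borel_measurable (lborel \<Otimes>\<^sub>M lborel)"
    unfolding K_def hilbert_diff_def by measurable
  have iK: "integrable (lborel \<Otimes>\<^sub>M lborel) (case_prod K)"
  proof (rule lborel_pair.Fubini_integrable[OF Km])
    have ipk: "integrable lborel (\<lambda>y. pk e (x - y))" by (rule kern_integrable[OF kern_shift[OF kernel_kern(1)[OF e]]])
    show "integrable lborel (\<lambda>y. LBINT s. norm (case_prod K (y, s)))"
    proof (rule Bochner_Integration.integrable_bound[OF integrable_mult_right[OF ipk, of N]])
      show "(\<lambda>y. LBINT s. norm (case_prod K (y, s))) \<in> borel_measurable lborel"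
        using Km by measurable
      have "(LBINT s. norm (case_prod K (y, s))) \<le> N * pk e (x - y)" for y
      proof -
        have "(LBINT s. norm (case_prod K (y, s))) = pk e (x - y) * (LBINT s. \<bar>indicator {0<..} s * hilbert_diff f y s\<bar>)"
          using pk_nonneg[OF e] by (simp add: K_def abs_mult)
        also have "\<dots> \<le> pk e (x - y) * N"
          unfolding N_def by (intro mult_left_mono hilbert_diff_integrable(2)[OF s] pk_nonneg[OF e])
        finally show ?thesis by (simp add: mult.commute)
      qed
      then show "AE y in lborel. norm (LBINT s. norm (case_prod K (y, s))) \<le> norm (N * pk e (x - y))"
        by (intro AE_I2) (auto intro: order_trans[OF _ abs_ge_self])
    qed
    show "AE y in lborel. integrable lborel (\<lambda>s. case_prod K (y, s))"
      using hilbert_diff_integrable(1)[OF s] by (simp add: K_def)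
  qed
  define L where "L = (\<lambda>y s. (4 * (x - y) * (pi / e) * (indicator {0<..} s * (pk e ((x - y) - s) * pk e ((x - y) + s)))) * f y)"
  have Lm: "case_prod L \<in> borel_measurable (lborel \<Otimes>\<^sub>M lborel)"
    unfolding L_def by measurable
  have iq: "integrable lborel (\<lambda>y. qk e (x - y) * f y)"
    by (rule L2_mult_integrable[OF L2_translates(1)[OF L2_qk[OF e]] f])
  have iP: "integrable lborel (\<lambda>s. indicator {0<..} s * (pk e (z - s) * pk e (z + s)))" for z
    using integrable_mult_indicator[OF _ pk_product_half_integral(1)[OF e, of z], of "{0<..}"] by simp
  have iL: "integrable (lborel \<Otimes>\<^sub>M lborel) (case_prod L)"
  proof (rule lborel_pair.Fubini_integrable[OF Lm])
    have "(LBINT s. norm (case_prod L (y, s))) = pi * \<bar>qk e (x - y) * f y\<bar>" for y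
    proof -
      define J where "J = (LBINT s. indicator {0<..} s * (pk e ((x - y) - s) * pk e ((x - y) + s)))"
      have J0: "0 \<le> J" unfolding J_def by (intro integral_nonneg_AE) (auto simp: pk_nonneg[OF e])
      have "(LBINT s. norm (case_prod L (y, s)))
         = (LBINT s. (\<bar>4 * (x - y) * (pi / e)\<bar> * \<bar>f y\<bar>) * (indicator {0<..} s * (pk e ((x - y) - s) * pk e ((x - y) + s))))"
        by (intro Bochner_Integration.integral_cong refl)
           (simp add: L_def abs_mult abs_of_nonneg[OF pk_nonneg[OF e]] ac_simps)
      also have "\<dots> = \<bar>4 * (x - y) * (pi / e)\<bar> * \<bar>f y\<bar> * J"
        unfolding J_def by simp
      also have "\<dots> = \<bar>4 * (x - y) * (pi / e) * J\<bar> * \<bar>f y\<bar>"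
        using J0 by (simp add: abs_mult)
      also have "4 * (x - y) * (pi / e) * J = pi * qk e (x - y)"
        unfolding J_def by (rule pk_product_half_integral(2)[OF e])
      finally show ?thesis by (simp add: abs_mult)
    qed
    then show "integrable lborel (\<lambda>y. LBINT s. norm (case_prod L (y, s)))"
      using iq by simp
    show "AE y in lborel. integrable lborel (\<lambda>s. case_prod L (y, s))"
      using iP by (simp add: L_def)
  qed
  have "(LBINT s. K y s) = pk e (x - y) * (LBINT s. indicator {0<..} s * hilbert_diff f y s)" for y
    unfolding K_def by (rule integral_mult_right_zero)
  then have "conv (pk e) (hilbert h) x = (LBINT y. (1/pi) * (LBINT s. K y s))"
    unfolding conv_def hilbert_eq[OF s hm h] by (intro Bochner_Integration.integral_cong refl) simp
  also have "\<dots> = (1/pi) * (LBINT y. (LBINT s. K y s))"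
    by (rule integral_mult_right_zero)
  also have "(LBINT y. (LBINT s. K y s)) = (LBINT s. (LBINT y. K y s))"
    by (rule lborel_pair.Fubini_integral[OF iK, symmetric])
  \<comment> \<open>For fixed \<open>s\<close> both shifts are moved from \<open>f\<close> to the
    kernel by translation in \<open>y\<close>, and the kernel difference is replaced by the product
    of \<open>pk_difference\<close>.\<close>
  also have "\<dots> = (LBINT s. (LBINT y. L y s))"
  proof (rule Bochner_Integration.integral_cong[OF refl])
    fix s :: real
    show "(LBINT y. K y s) = (LBINT y. L y s)"
    proof (cases "0 < s")
      case True
      note wf = wint_L2[OF f] and kp = kernel_kern(1)[OF e]
      have i1: "integrable lborel (\<lambda>y. pk e (x - y) * f (y - s))" "integrable lborel (\<lambda>y. pk e (x - y) * f (y + s))"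
        using conv_integrable[OF kp wint_L2, of "\<lambda>y. f (y - s)" x] conv_integrable[OF kp wint_L2, of "\<lambda>y. f (y + s)" x]
          L2_affine(1)[OF f, of 1 s] L2_affine(1)[OF f, of 1 "-s"] by (simp_all add: add.commute)
      have i2: "integrable lborel (\<lambda>y. pk e (x - s - y) * f y)" "integrable lborel (\<lambda>y. pk e (x + s - y) * f y)"
        by (rule conv_integrable[OF kp wf])+
      have sh1: "(LBINT y. pk e (x - y) * f (y - s)) = (LBINT y. pk e (x - s - y) * f y)"
        using lborel_integral_real_affine[of 1 "\<lambda>y. pk e (x - y) * f (y - s)" s] by (simp add: algebra_simps)
      have sh2: "(LBINT y. pk e (x - y) * f (y + s)) = (LBINT y. pk e (x + s - y) * f y)"
        using lborel_integral_real_affine[of 1 "\<lambda>y. pk e (x - y) * f (y + s)" "-s"] by (simp add: algebra_simps)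
      have "(LBINT y. K y s) = (LBINT y. (pk e (x - y) * f (y - s) - pk e (x - y) * f (y + s)) / s)"
        using True by (simp add: K_def hilbert_diff_def right_diff_distrib)
      also have "\<dots> = ((LBINT y. pk e (x - s - y) * f y) - (LBINT y. pk e (x + s - y) * f y)) / s"
        using i1 by (simp add: sh1 sh2)
      also have "\<dots> = (LBINT y. (pk e (x - s - y) * f y - pk e (x + s - y) * f y) / s)"
        using i2 by simp
      also have "\<dots> = (LBINT y. L y s)"
      proof (intro Bochner_Integration.integral_cong refl)
        fix y
        have "(pk e (x - s - y) * f y - pk e (x + s - y) * f y) / s = ((pk e ((x - y) - s) - pk e ((x - y) + s)) / s) * f y"
          by (simp add: algebra_simps)
        then show "(pk e (x - s - y) * f y - pk e (x + s - y) * f y) / s = L y s"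
          unfolding pk_difference[OF e True] L_def using True by simp
      qed
      finally show ?thesis .
    qed (simp add: K_def L_def)
  qed
  also have "\<dots> = (LBINT y. (LBINT s. L y s))"
    by (rule lborel_pair.Fubini_integral[OF iL])
  also have "\<dots> = (LBINT y. pi * (qk e (x - y) * f y))"
  proof (intro Bochner_Integration.integral_cong refl)
    fix y
    have "(LBINT s. L y s) = (4 * (x - y) * (pi / e) * (LBINT s. indicator {0<..} s * (pk e ((x - y) - s) * pk e ((x - y) + s)))) * f y"
      unfolding L_def by simp
    then show "(LBINT s. L y s) = pi * (qk e (x - y) * f y)"
      unfolding pk_product_half_integral(2)[OF e] by simp
  qed
  finally show ?thesis by (simp add: conv_def)
qed

lemma conv_kernel_derivs:
  assumes e: "0 < e" and f: "wint f"
  shows "(conv (pk e) f has_real_derivative conv (pk1 e) f x) (at x)"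
    "(conv (pk1 e) f has_real_derivative conv (pk2 e) f x) (at x)"
    "(conv (qk1 e) f has_real_derivative conv (qk2 e) f x) (at x)"
  by (rule conv_deriv[OF kernel_derivs(1)[OF e]] conv_deriv[OF kernel_derivs(3)[OF e]] conv_deriv[OF kernel_derivs(4)[OF e]];
      intro kernel_kern e f conv_integrable)+

text \<open>The identity \<open>poisson_hilbert\<close> holds for all \<open>x\<close>, so both
  sides may be differentiated twice. The result is the dispersive term of the smoothed equation,
  with both derivatives on the kernel.\<close>

lemma poisson_hilbert2:
  assumes e: "0 < e" and s: "sob f g" and hm: "h \<in> borel_measurable borel" and h: "AE x in lborel. h x = f x"
  shows "conv (pk2 e) (hilbert h) x = conv (qk2 e) f x"
proof -
  have f: "L2 f" using s by (simp add: sob_def)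
  have wh: "wint (hilbert h)"
    by (rule wint_bounded[OF hilbert_measurable[OF s hm h] hilbert_bound[OF s hm h]])
  have eq0: "conv (pk e) (hilbert h) = conv (qk e) f" using poisson_hilbert[OF assms] by auto
  have dq: "(conv (qk e) f has_real_derivative conv (qk1 e) f x) (at x)" for x
    by (rule conv_deriv[OF kernel_derivs(2)[OF e] kernel_kern(4)[OF e] wint_L2[OF f]])
       (rule L2_mult_integrable[OF L2_translates(1)[OF L2_qk[OF e]] f])
  have eq1: "conv (pk1 e) (hilbert h) = conv (qk1 e) f"
    using DERIV_unique[OF conv_kernel_derivs(1)[OF e wh, unfolded eq0] dq] by auto
  show ?thesis
    by (rule DERIV_unique[OF conv_kernel_derivs(2)[OF e wh, unfolded eq1] conv_kernel_derivs(3)[OF e wint_L2[OF f]]])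
qed

section \<open>The square of the Cauchy transform\<close>

text \<open>Minus the derivative of the Cauchy integral of \<open>f\<close>. Multiplied by
  \<open>- i / pi\<close> it has real part \<open>conv (pk1 e) f\<close> and imaginary part
  \<open>conv (qk1 e) f\<close> on the line at height \<open>e\<close>.\<close>

definition cauchy2 :: "(real \<Rightarrow> real) \<Rightarrow> complex \<Rightarrow> complex" where
  "cauchy2 f z = (LBINT y. of_real (f y) / (z - of_real y)^2)"

text \<open>The squared distance in the denominator is that of the Poisson kernel at height
  \<open>Im z\<close>, so positive Poisson averages dominate the Cauchy transform.\<close>

lemma norm_cauchy_kernel:
  assumes "0 < Im z"
  shows "norm (of_real a / (z - of_real y)^2) = (pi / Im z) * (pk (Im z) (Re z - y) * \<bar>a\<bar>)"
proof -
  have "norm (z - of_real y)^2 = (Re z - y)^2 + (Im z)^2" by (simp add: cmod_power2)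
  then show ?thesis using assms by (simp add: norm_divide norm_power pk_def)
qed

lemma cauchy2_integrable:
  assumes f: "L2 f" and z: "0 < Im z"
  shows "integrable lborel (\<lambda>y. of_real (f y) / (z - of_real y)^2)"
proof (rule Bochner_Integration.integrable_bound)
  have [measurable]: "f \<in> borel_measurable borel" using f by (rule L2_meas)
  show "integrable lborel (\<lambda>y. (pi / Im z) * (pk (Im z) (Re z - y) * \<bar>f y\<bar>))"
    by (intro integrable_mult_right conv_integrable kernel_kern z wint_abs wint_L2 f)
  show "(\<lambda>y. of_real (f y) / (z - of_real y)^2) \<in> borel_measurable lborel" by measurable
  show "AE y in lborel. norm (of_real (f y) / (z - of_real y)^2) \<le> norm ((pi / Im z) * (pk (Im z) (Re z - y) * \<bar>f y\<bar>))"
    unfolding norm_cauchy_kernel[OF z] real_norm_def by (intro AE_I2 abs_ge_self)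
qed

lemma cauchy2_holomorphic:
  assumes f: "L2 f" shows "cauchy2 f holomorphic_on {z. Im z > 0}"
proof (rule holomorphic_onI)
  fix z0 assume "z0 \<in> {z. Im z > 0}"
  then have s: "0 < Im z0" by simp
  have [measurable]: "f \<in> borel_measurable borel" using f by (rule L2_meas)
  have "(cauchy2 f has_field_derivative (LBINT y. - 2 * of_real (f y) / (z0 - of_real y)^3)) (at z0)"
    unfolding cauchy2_def[abs_def]
  proof (rule has_field_derivative_integral[where e = "Im z0 / 2"
        and D = "\<lambda>y. (16 / Im z0) * norm (of_real (f y) / (z0 - of_real y)^2)"])
    show "0 < Im z0 / 2" using s by simp
    show "integrable lborel (\<lambda>y. (16 / Im z0) * norm (of_real (f y) / (z0 - of_real y)^2))"
      by (intro integrable_mult_right integrable_norm cauchy2_integrable f s)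
    show "(\<lambda>y. - 2 * of_real (f y) / (z0 - of_real y)^3) \<in> borel_measurable lborel" by measurable
    fix z assume z: "z \<in> ball z0 (Im z0 / 2)"
    have d: "norm (z0 - z) < Im z0 / 2" using z by (simp add: dist_norm)
    have "Im z0 - Im z < Im z0 / 2" using abs_Im_le_cmod[of "z0 - z"] d by simp
    then have Iz: "Im z0 / 2 < Im z" by simp
    show "integrable lborel (\<lambda>y. of_real (f y) / (z - of_real y)^2)"
      by (rule cauchy2_integrable[OF f]) (use Iz s in linarith)
    fix y
    have zy: "Im z0 / 2 < norm (z - of_real y)"
      using abs_Im_le_cmod[of "z - of_real y"] Iz by simp
    then have nz: "z - of_real y \<noteq> 0" using s by auto
    show "((\<lambda>z. of_real (f y) / (z - of_real y)^2) has_field_derivative - 2 * of_real (f y) / (z - of_real y)^3) (at z)"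
    proof -
      have q: "((\<lambda>z. (z - of_real y)^2) has_field_derivative 2 * (z - of_real y)) (at z)"
        by (auto intro!: derivative_eq_intros)
      have "((\<lambda>z. of_real (f y) / (z - of_real y)^2) has_field_derivative
          (0 * (z - of_real y)^2 - of_real (f y) * (2 * (z - of_real y))) / ((z - of_real y)^2 * (z - of_real y)^2)) (at z)"
        by (rule DERIV_divide[OF DERIV_const q]) (use nz in simp)
      also have "(0 * (z - of_real y)^2 - of_real (f y) * (2 * (z - of_real y))) / ((z - of_real y)^2 * (z - of_real y)^2)
          = - 2 * of_real (f y) / (z - of_real y)^3"
      proof -
        have "(0 * u^2 - c * (2 * u)) / (u^2 * u^2) = - 2 * c / u^3" if "u \<noteq> 0" for c u :: complex
          using that by (simp add: power2_eq_square power3_eq_cube ac_simps)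
        then show ?thesis using nz .
      qed
      finally show ?thesis .
    qed
    define a where "a = norm (z - of_real y)"
    define b where "b = norm (z0 - of_real y)"
    have "b \<le> norm (z - of_real y) + norm (z0 - z)"
      unfolding b_def using norm_triangle_ineq[of "z - of_real y" "z0 - z"] by simp
    then have ab: "b \<le> 2 * a" using d zy by (simp add: a_def)
    have "Im z0 \<le> b" using abs_Im_le_cmod[of "z0 - of_real y"] by (simp add: b_def)
    then have b0: "0 < b" using s by linarith
    have za: "Im z0 \<le> 2 * a" using zy unfolding a_def by linarith
    then have a0: "0 < a" using s by linarith
    \<comment> \<open>Two of the three factors \<open>1/a\<close> are traded for \<open>1/b\<close>,
      the third for \<open>1 / Im z0\<close>; with the factor \<open>2\<close> from the derivative
      this gives the constant \<open>16\<close>.\<close>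
    have "b^2 * Im z0 \<le> (2 * a)^2 * (2 * a)"
      by (intro mult_mono power_mono ab za) (use b0 a0 s in auto)
    then have "1 / a^3 \<le> 8 / (b^2 * Im z0)"
      using a0 b0 s by (simp add: field_simps power2_eq_square power3_eq_cube)
    then have "2 * \<bar>f y\<bar> * (1 / a^3) \<le> 2 * \<bar>f y\<bar> * (8 / (b^2 * Im z0))" by (intro mult_left_mono) auto
    then show "norm (- 2 * of_real (f y) / (z - of_real y)^3) \<le> (16 / Im z0) * norm (of_real (f y) / (z0 - of_real y)^2)"
      unfolding norm_divide norm_mult norm_power norm_minus_cancel a_def[symmetric] b_def[symmetric]
      by (simp add: ac_simps)
  qed
  then show "cauchy2 f field_differentiable at z0 within {z. Im z > 0}"
    using field_differentiable_at_within field_differentiable_def by blast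
qed

lemma conv_pk_square_le:
  assumes e: "0 < e" and f: "L2 f"
  shows "(conv (pk e) f x)^2 \<le> conv (pk e) (\<lambda>y. (f y)^2) x"
proof -
  have "(\<lambda>z. \<bar>pk e z\<bar>) = pk e" using pk_nonneg[OF e] by auto
  then show ?thesis using conv_square_le[OF kernel_kern(1)[OF e] f, of x] pk_integral[OF e] by simp
qed

text \<open>Jensen's inequality for the Poisson average and the maximum \<open>1 / (pi s)\<close> of
  the kernel at height \<open>s\<close>. The inverse cube is what later survives, after the
  prefactors in \<open>m\<close>, as \<open>m^(-2)\<close>.\<close>

lemma cauchy2_bound:
  assumes f: "L2 f" and z: "0 < Im z"
  shows "norm (cauchy2 f z)^2 \<le> pi / (Im z)^3 * (L2_norm f)^2"
proof -
  define s where "s = Im z"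
  have s: "0 < s" using z by (simp add: s_def)
  have f2: "integrable lborel (\<lambda>y. (f y)^2)" using f by (simp add: L2_iff)
  have "norm (cauchy2 f z) \<le> (LBINT y. norm (of_real (f y) / (z - of_real y)^2))"
    unfolding cauchy2_def by (rule integral_norm_bound)
  also have "\<dots> = (pi / s) * conv (pk s) (\<lambda>y. \<bar>f y\<bar>) (Re z)"
    unfolding norm_cauchy_kernel[OF z] conv_def s_def by (rule integral_mult_right_zero)
  finally have "norm (cauchy2 f z)^2 \<le> ((pi / s) * conv (pk s) (\<lambda>y. \<bar>f y\<bar>) (Re z))^2"
    by (rule power_mono) simp
  also have "\<dots> = (pi / s)^2 * (conv (pk s) (\<lambda>y. \<bar>f y\<bar>) (Re z))^2" by (rule power_mult_distrib)
  also have "\<dots> \<le> (pi / s)^2 * ((1 / (pi * s)) * (L2_norm f)^2)"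
  proof (rule mult_left_mono)
    have "(conv (pk s) (\<lambda>y. \<bar>f y\<bar>) (Re z))^2 \<le> conv (pk s) (\<lambda>y. (f y)^2) (Re z)"
      using conv_pk_square_le[OF s L2_abs(1)[OF f], of "Re z"] by simp
    also have "\<dots> \<le> (LBINT y. (1 / (pi * s)) * (f y)^2)"
      unfolding conv_def
    proof (rule integral_mono)
      show "integrable lborel (\<lambda>y. pk s (Re z - y) * (f y)^2)"
        by (intro conv_integrable kernel_kern s wint_integrable f2)
      show "integrable lborel (\<lambda>y. (1 / (pi * s)) * (f y)^2)" by (intro integrable_mult_right f2)
      fix y
      have "pk s t \<le> 1 / (pi * s)" for t
      proof -
        have "pk s t \<le> s / (pi * s^2)"
          unfolding pk_def using s kernel_denom[OF s, of t] by (intro divide_left_mono mult_left_mono mult_pos_pos) auto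
        then show ?thesis using s by (simp add: power2_eq_square)
      qed
      then show "pk s (Re z - y) * (f y)^2 \<le> (1 / (pi * s)) * (f y)^2" by (intro mult_right_mono) auto
    qed
    also have "\<dots> = (1 / (pi * s)) * (L2_norm f)^2" unfolding L2_norm_sq by (rule integral_mult_right_zero)
    finally show "(conv (pk s) (\<lambda>y. \<bar>f y\<bar>) (Re z))^2 \<le> (1 / (pi * s)) * (L2_norm f)^2" .
  qed simp
  also have "\<dots> = pi / s^3 * (L2_norm f)^2"
    using s by (simp add: power2_eq_square power3_eq_cube)
  finally show ?thesis by (simp add: s_def)
qed

lemma cauchy_kernel_parts:
  assumes e: "0 < e"
  shows "(- \<i> / of_real pi) * (of_real a / (of_real x + \<i> * of_real e - of_real y)^2)
    = Complex (pk1 e (x - y) * a) (qk1 e (x - y) * a)"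
proof -
  define t where "t = x - y"
  define D where "D = t^2 + e^2"
  have D: "0 < D" unfolding D_def by (rule kernel_denom(1)[OF e])
  have n: "(Complex t e)^2 * (Complex t (- e))^2 = of_real (D^2)"
  proof -
    have "Complex t e * Complex t (- e) = of_real D"
      by (simp add: complex_eq_iff D_def power2_eq_square)
    then show ?thesis by (simp add: power_mult_distrib[symmetric])
  qed
  then have nz: "(Complex t e)^2 \<noteq> 0" using D by (metis mult_zero_left of_real_eq_0_iff power_eq_0_iff less_irrefl)
  have "(- \<i> / of_real pi) * (of_real a / (Complex t e)^2) = (- \<i> / of_real pi) * (of_real a * (Complex t (- e))^2 / of_real (D^2))"
    unfolding n[symmetric] using nz D n by (simp add: field_simps) 
  also have "\<dots> = Complex (pk1 e t * a) (qk1 e t * a)"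
  proof -
    have "(Complex t (- e))^2 = Complex (D - 2 * e^2) (- (2 * t * e))"
      by (simp add: complex_eq_iff D_def power2_eq_square)
    moreover have "D - 2 * e^2 = - ((t^2 + e^2) - 2 * t^2)" by (simp add: D_def)
    ultimately show ?thesis
      by (simp add: complex_eq_iff pk1_def qk1_def D_def[symmetric] Re_divide_of_real Im_divide_of_real
          del: of_real_power) (simp add: minus_divide_left algebra_simps)
  qed
  finally show ?thesis by (simp add: t_def complex_eq_iff Complex_eq algebra_simps)
qed

lemma cauchy2_conv:
  assumes e: "0 < e" and f: "L2 f"
  shows "(- \<i> / of_real pi) * cauchy2 f (of_real x + \<i> * of_real e) = Complex (conv (pk1 e) f x) (conv (qk1 e) f x)"
proof -
  have i: "integrable lborel (\<lambda>y. (- \<i> / of_real pi) * (of_real (f y) / (of_real x + \<i> * of_real e - of_real y)^2))"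
    using cauchy2_integrable[OF f, of "of_real x + \<i> * of_real e"] e by (intro integrable_mult_right) simp
  have "(- \<i> / of_real pi) * cauchy2 f (of_real x + \<i> * of_real e)
     = (LBINT y. (- \<i> / of_real pi) * (of_real (f y) / (of_real x + \<i> * of_real e - of_real y)^2))"
    unfolding cauchy2_def by (rule integral_mult_right_zero[symmetric])
  then show ?thesis
    using integral_Re[OF i] integral_Im[OF i]
    unfolding cauchy_kernel_parts[OF e] by (simp add: complex_eq_iff conv_def)
qed

text \<open>\<open>v + i w\<close> is the boundary value of a holomorphic function; the Poisson formula is applied to its square.\<close>
lemma cauchy_square_poisson:
  assumes e: "0 < e" and m: "0 < m" and f: "L2 f"
  defines "v \<equiv> conv (pk1 e) f" and "w \<equiv> conv (qk1 e) f"
  shows "\<bar>LBINT x. ((v x)^2 - (w x)^2) * (m^2 / (x^2 + m^2))\<bar> \<le> (L2_norm f)^2 / m^2"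
    and "\<bar>LBINT x. (2 * (v x * w x)) * (m^2 / (x^2 + m^2))\<bar> \<le> (L2_norm f)^2 / m^2"
proof -
  define g where "g = (\<lambda>z. ((- \<i> / of_real pi) * cauchy2 f (z + \<i> * of_real e))^2)"
  have hol: "g holomorphic_on {z. Im z > - e}"
  proof -
    have "cauchy2 f \<circ> (\<lambda>z. z + \<i> * of_real e) holomorphic_on {z. Im z > - e}"
      by (rule holomorphic_on_compose_gen[OF _ cauchy2_holomorphic[OF f]]) (auto intro!: holomorphic_intros)
    then show ?thesis unfolding g_def o_def by (intro holomorphic_intros)
  qed
  have gn: "norm (g z) \<le> (L2_norm f)^2 / (pi * (Im z + e)^3)" if "Im z \<ge> 0" for z
  proof -
    have p: "0 < Im (z + \<i> * of_real e)" using that e by simp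
    have "norm (g z) = norm (cauchy2 f (z + \<i> * of_real e))^2 / pi^2"
      unfolding g_def by (simp add: norm_power norm_mult norm_divide power_mult_distrib power_divide)
    also have "\<dots> \<le> (pi / (Im (z + \<i> * of_real e))^3 * (L2_norm f)^2) / pi^2"
      by (intro divide_right_mono cauchy2_bound[OF f p]) simp
    also have "\<dots> = (L2_norm f)^2 / (pi * (Im z + e)^3)" by (simp add: power2_eq_square)
    finally show ?thesis .
  qed
  have bd: "norm (g z) \<le> (L2_norm f)^2 / (pi * e^3)" if "Im z \<ge> 0" for z
  proof -
    have "e^3 \<le> (Im z + e)^3" using that e by (intro power_mono) auto
    then have "(L2_norm f)^2 / (pi * (Im z + e)^3) \<le> (L2_norm f)^2 / (pi * e^3)"
      using e that by (intro divide_left_mono mult_left_mono mult_pos_pos) auto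
    then show ?thesis using gn[OF that] by linarith
  qed
  note pf = poisson_formula[OF hol e m bd]
  define I where "I = (LBINT x. g (of_real x) / of_real (x^2 + m^2))"
  have "I = of_real (pi / m) * g (\<i> * of_real m)" unfolding I_def by (rule pf(2))
  then have "norm I = (pi / m) * norm (g (\<i> * of_real m))"
    using m by (simp add: norm_mult norm_divide)
  \<comment> \<open>Cubic decay at height \<open>m + e \<ge> m\<close>. With the prefactor this is
    of order \<open>m^(-4)\<close>, and the numerator \<open>m^2\<close> of the weight leaves
    \<open>m^(-2)\<close>, uniformly in \<open>e\<close>.\<close>
  also have "\<dots> \<le> (pi / m) * ((L2_norm f)^2 / (pi * m^3))"
  proof (rule mult_left_mono)
    have "m^3 \<le> (m + e)^3" using m e by (intro power_mono) auto
    then have "(L2_norm f)^2 / (pi * (m + e)^3) \<le> (L2_norm f)^2 / (pi * m^3)"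
      using m e by (intro divide_left_mono mult_left_mono mult_pos_pos) auto
    then show "norm (g (\<i> * of_real m)) \<le> (L2_norm f)^2 / (pi * m^3)"
      using gn[of "\<i> * of_real m"] m by simp
  qed (use m in simp)
  also have "\<dots> = (L2_norm f)^2 / (m^2 * m^2)" using m by (simp add: power2_eq_square power3_eq_cube)
  finally have nI: "m^2 * norm I \<le> (L2_norm f)^2 / m^2"
    using m by (simp add: field_simps)
  have parts: "g (of_real x) / of_real (x^2 + m^2) = Complex (((v x)^2 - (w x)^2) / (x^2 + m^2)) ((2 * (v x * w x)) / (x^2 + m^2))" for x
    unfolding g_def cauchy2_conv[OF e f] v_def w_def
    by (simp only: complex_eq_iff Re_divide_of_real Im_divide_of_real) (simp add: power2_eq_square)
  have pull: "(LBINT x. q x * (m^2 / (x^2 + m^2))) = m^2 * (LBINT x. q x / (x^2 + m^2))" for q :: "real \<Rightarrow> real"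
  proof -
    have "(\<lambda>x. q x * (m^2 / (x^2 + m^2))) = (\<lambda>x. m^2 * (q x / (x^2 + m^2)))" by auto
    then show ?thesis by (simp only: integral_mult_right_zero)
  qed
  have "(LBINT x. ((v x)^2 - (w x)^2) / (x^2 + m^2)) = Re I"
    using integral_Re[OF pf(1)] unfolding I_def parts by simp
  then have "(LBINT x. ((v x)^2 - (w x)^2) * (m^2 / (x^2 + m^2))) = m^2 * Re I"
    by (simp only: pull)
  moreover have "(LBINT x. (2 * (v x * w x)) / (x^2 + m^2)) = Im I"
    using integral_Im[OF pf(1)] unfolding I_def parts by simp
  then have "(LBINT x. (2 * (v x * w x)) * (m^2 / (x^2 + m^2))) = m^2 * Im I"
    by (simp only: pull)
  moreover have "m^2 * \<bar>Re I\<bar> \<le> m^2 * norm I" "m^2 * \<bar>Im I\<bar> \<le> m^2 * norm I"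
    by (intro mult_left_mono abs_Re_le_cmod abs_Im_le_cmod; simp)+
  ultimately show "\<bar>LBINT x. ((v x)^2 - (w x)^2) * (m^2 / (x^2 + m^2))\<bar> \<le> (L2_norm f)^2 / m^2"
    and "\<bar>LBINT x. (2 * (v x * w x)) * (m^2 / (x^2 + m^2))\<bar> \<le> (L2_norm f)^2 / m^2"
    using nI by (auto simp: abs_mult)
qed

lemma weight_complement_bounds:
  assumes "0 < (m::real)" shows "0 \<le> m^2 / (x^2 + m^2)" "m^2 / (x^2 + m^2) \<le> 1"
  using kernel_denom[OF assms, of x] by auto

text \<open>As \<open>m\<close> grows, the factors increase to one and stay bounded by one, so the
  weighted integrals converge to the full integral while their bound tends to zero.\<close>

lemma integral_zero_of_weighted:
  assumes h: "integrable lborel h"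
    and le: "\<And>m. 0 < m \<Longrightarrow> \<bar>LBINT x. h x * (m^2 / (x^2 + m^2))\<bar> \<le> A / m^2"
  shows "(LBINT x. h x) = (0::real)"
proof -
  have [measurable]: "h \<in> borel_measurable borel" using borel_measurable_integrable[OF h] by simp
  have lim1: "(\<lambda>n. LBINT x. h x * ((real (Suc n))^2 / (x^2 + (real (Suc n))^2))) \<longlonglongrightarrow> (LBINT x. h x)"
  proof (rule integral_dominated_convergence[where w = "\<lambda>x. \<bar>h x\<bar>"])
    show "AE x in lborel. (\<lambda>n. h x * ((real (Suc n))^2 / (x^2 + (real (Suc n))^2))) \<longlonglongrightarrow> h x"
    proof (rule AE_I2)
      fix x :: real
      have "(\<lambda>n. (real (Suc n))^2 / (x^2 + (real (Suc n))^2)) \<longlonglongrightarrow> 1" by real_asymp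
      from tendsto_mult[OF tendsto_const[of "h x"] this]
      show "(\<lambda>n. h x * ((real (Suc n))^2 / (x^2 + (real (Suc n))^2))) \<longlonglongrightarrow> h x" by simp
    qed
    show "AE x in lborel. norm (h x * ((real (Suc n))^2 / (x^2 + (real (Suc n))^2))) \<le> \<bar>h x\<bar>" for n
    proof (rule AE_I2)
      fix x :: real
      show "norm (h x * ((real (Suc n))^2 / (x^2 + (real (Suc n))^2))) \<le> \<bar>h x\<bar>"
        unfolding real_norm_def abs_mult
        using weight_complement_bounds[of "real (Suc n)" x] by (intro mult_right_le_one_le) (auto simp del: of_nat_Suc)
    qed
  qed (use h in auto)
  have lim2: "(\<lambda>n. LBINT x. h x * ((real (Suc n))^2 / (x^2 + (real (Suc n))^2))) \<longlonglongrightarrow> 0"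
  proof (rule Lim_null_comparison)
    show "\<forall>\<^sub>F n in sequentially. norm (LBINT x. h x * ((real (Suc n))^2 / (x^2 + (real (Suc n))^2))) \<le> A / (real (Suc n))^2"
      using le[of "real (Suc _)"] by (intro always_eventually allI) (simp del: of_nat_Suc)
    show "(\<lambda>n. A / (real (Suc n))^2) \<longlonglongrightarrow> 0" by real_asymp
  qed
  show ?thesis by (rule LIMSEQ_unique[OF lim1 lim2])
qed

text \<open>Real and imaginary parts of the squared boundary function, with the weight removed. The
  norm identity controls \<open>w_x\<close>; the orthogonality allows the weight \<open>wt\<close>
  to be exchanged for minus its complement in the flux.\<close>

lemma hilbert_isometry:
  assumes e: "0 < e" and f: "L2 f"
  shows "L2_norm (conv (qk1 e) f) = L2_norm (conv (pk1 e) f)"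
    and "(LBINT x. conv (pk1 e) f x * conv (qk1 e) f x) = 0"
proof -
  define v where "v = conv (pk1 e) f"
  define w where "w = conv (qk1 e) f"
  have L: "L2 v" "L2 w" unfolding v_def w_def by (intro conv_L2 kernel_kern e f)+
  have i: "integrable lborel (\<lambda>x. (v x)^2 - (w x)^2)" "integrable lborel (\<lambda>x. 2 * (v x * w x))"
    using L L2_mult_integrable[OF L] by (auto simp: L2_iff)
  have "(LBINT x. (v x)^2 - (w x)^2) = 0"
    by (rule integral_zero_of_weighted[OF i(1)], unfold v_def w_def, rule cauchy_square_poisson(1)[OF e _ f])
  then have "(L2_norm v)^2 = (L2_norm w)^2" unfolding L2_norm_sq using L by (simp add: L2_iff)
  then show "L2_norm w = L2_norm v" using L2_norm_nonneg by (simp add: power2_eq_iff_nonneg)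
  have "(LBINT x. 2 * (v x * w x)) = 0"
    by (rule integral_zero_of_weighted[OF i(2)], unfold v_def w_def, rule cauchy_square_poisson(2)[OF e _ f])
  then show "(LBINT x. v x * w x) = 0" by simp
qed

section \<open>Fluxes through the weight\<close>

lemma kern_add: assumes "kern k" "kern k'" shows "kern (\<lambda>z. k z + k' z)"
proof -
  obtain C where C: "\<And>z. \<bar>k z\<bar> \<le> C / (z^2 + 1)" by (rule kern_bound[OF assms(1)]) blast
  obtain C' where C': "\<And>z. \<bar>k' z\<bar> \<le> C' / (z^2 + 1)" by (rule kern_bound[OF assms(2)]) blast
  have "\<bar>k z + k' z\<bar> \<le> (C + C') / (z^2 + 1)" for z
    using abs_triangle_ineq[of "k z" "k' z"] C[of z] C'[of z] by (simp add: add_divide_distrib)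
  then show ?thesis using assms unfolding kern_def by auto
qed

lemma kern_cmult: assumes "kern k" shows "kern (\<lambda>z. c * k z)"
proof -
  obtain C where C: "\<And>z. \<bar>k z\<bar> \<le> C / (z^2 + 1)" by (rule kern_bound[OF assms(1)]) blast
  have "\<bar>c * k z\<bar> \<le> (\<bar>c\<bar> * C) / (z^2 + 1)" for z
    using mult_left_mono[OF C[of z] abs_ge_zero[of c]] by (simp add: abs_mult)
  then show ?thesis using assms unfolding kern_def by auto
qed

lemma smooth1_ident: "smooth1 (\<lambda>x. x)"
  by (rule smooth1.intros[where f' = "\<lambda>x. 1"]) (auto intro: smooth1_const continuous_on_id)

text \<open>The Poisson kernel is not compactly supported, hence not admissible in the weak
  formulation. Multiplication by a cutoff dilated by \<open>n + 1\<close> approximates it, and a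
  single majorant \<open>\<kappa>\<close> serves the functions and their first two derivatives,
  which permits passing to the limit.\<close>

lemma test_cutoff:
  assumes s: "smooth1 \<psi>" and k: "kern \<psi>" "kern (deriv \<psi>)" "kern (deriv (deriv \<psi>))"
  obtains \<theta> \<kappa> where "\<And>n::nat. test_fun1 (\<theta> n)" "kern \<kappa>"
    "\<And>n y. \<bar>\<theta> n y\<bar> \<le> \<kappa> y" "\<And>n y. \<bar>deriv (\<theta> n) y\<bar> \<le> \<kappa> y" "\<And>n y. \<bar>deriv (deriv (\<theta> n)) y\<bar> \<le> \<kappa> y"
    "\<And>y. (\<lambda>n. \<theta> n y) \<longlonglongrightarrow> \<psi> y" "\<And>y. (\<lambda>n. deriv (\<theta> n) y) \<longlonglongrightarrow> deriv \<psi> y"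
    "\<And>y. (\<lambda>n. deriv (deriv (\<theta> n)) y) \<longlonglongrightarrow> deriv (deriv \<psi>) y"
proof -
  \<comment> \<open>With \<open>n = 1\<close> the transitions have half-width one around
    \<open>-2\<close> and \<open>2\<close>, so the cutoff equals one for
    \<open>\<bar>x\<bar> \<le> 1\<close>.\<close>
  define cut where "cut = plateau (-2) 2 1"
  have tx: "test_fun1 cut" unfolding cut_def by (rule test_fun1_plateau) simp
  then have sx: "smooth1 cut" by (simp add: test_fun1_def)
  note sx1 = smooth1_deriv(1)[OF sx]
  obtain B0 R0 where B0: "\<And>x. \<bar>cut x\<bar> \<le> B0" "\<And>x. R0 < \<bar>x\<bar> \<Longrightarrow> cut x = 0"
    by (rule test_fun1_bounded[OF tx]) blast
  obtain B1 where B1: "\<And>x. \<bar>deriv cut x\<bar> \<le> B1"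
    by (rule test_fun1_bounded[OF test_fun1_deriv[OF tx]]) blast
  obtain B2 where B2: "\<And>x. \<bar>deriv (deriv cut) x\<bar> \<le> B2"
    by (rule test_fun1_bounded[OF test_fun1_deriv[OF test_fun1_deriv[OF tx]]]) blast
  have B: "0 \<le> B0" "0 \<le> B1" "0 \<le> B2"
    using B0(1)[of 0] B1[of 0] B2[of 0] abs_ge_zero order_trans by blast+
  have one: "cut x = 1" if "\<bar>x\<bar> \<le> 1" for x
    using that by (simp add: cut_def plateau_def step_left step_right)
  define c where "c = (\<lambda>n::nat. 1 / real (Suc n))"
  have c: "0 < c n" "c n \<le> 1" for n by (auto simp: c_def)
  have clim: "c \<longlonglongrightarrow> 0" unfolding c_def by (rule LIMSEQ_Suc[OF lim_1_over_n])
  define \<theta> where "\<theta> = (\<lambda>n y. cut (c n * y) * \<psi> y)"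
  define \<theta>1 where "\<theta>1 = (\<lambda>n y. c n * deriv cut (c n * y) * \<psi> y + cut (c n * y) * deriv \<psi> y)"
  define \<theta>2 where "\<theta>2 = (\<lambda>n y. (c n)^2 * deriv (deriv cut) (c n * y) * \<psi> y
     + 2 * c n * deriv cut (c n * y) * deriv \<psi> y + cut (c n * y) * deriv (deriv \<psi>) y)"
  have dil: "((\<lambda>y. F (c n * y)) has_real_derivative deriv F (c n * y) * c n) (at y)" if "smooth1 F" for F n y
    by (rule DERIV_chain2[OF smooth1_deriv(2)[OF that]]) (auto intro!: derivative_eq_intros)
  have d1: "(\<theta> n has_real_derivative \<theta>1 n y) (at y)" for n y
    unfolding \<theta>_def \<theta>1_def
    by (rule derivative_eq_intros dil[OF sx] smooth1_deriv(2)[OF s] refl)+ (simp add: algebra_simps)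
  have d2: "(\<theta>1 n has_real_derivative \<theta>2 n y) (at y)" for n y
    unfolding \<theta>1_def \<theta>2_def
    by (rule derivative_eq_intros dil[OF sx] dil[OF sx1] smooth1_deriv(2)[OF s] smooth1_deriv(2)[OF smooth1_deriv(1)[OF s]] refl)+
       (simp add: algebra_simps power2_eq_square)
  have D1: "deriv (\<theta> n) = \<theta>1 n" for n using d1 by (auto intro: DERIV_imp_deriv)
  have D2: "deriv (deriv (\<theta> n)) = \<theta>2 n" for n unfolding D1 using d2 by (auto intro: DERIV_imp_deriv)
  \<comment> \<open>The sum of the product-rule terms of orders zero to two; the powers of
    \<open>c n\<close> are dropped since \<open>c n \<le> 1\<close>.\<close>
  define \<kappa> where "\<kappa> = (\<lambda>y. (B0 + B1 + B2) * \<bar>\<psi> y\<bar> + ((B0 + 2 * B1) * \<bar>deriv \<psi> y\<bar> + B0 * \<bar>deriv (deriv \<psi>) y\<bar>))"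
  have kk: "kern \<kappa>" unfolding \<kappa>_def by (intro kern_add kern_cmult kern_abs k)
  have tf: "test_fun1 (\<theta> n)" for n
  proof -
    have "smooth1 (\<theta> n)" unfolding \<theta>_def
      using smooth1_mult[OF smooth1_affine[OF sx, of "c n" 0] s] by simp
    moreover have "\<theta> n x = 0" if "\<bar>R0\<bar> / c n < \<bar>x\<bar>" for x
    proof -
      have "\<bar>R0\<bar> < \<bar>c n * x\<bar>" using that c[of n] by (simp add: abs_mult field_simps)
      then show ?thesis using B0(2)[of "c n * x"] by (simp add: \<theta>_def)
    qed
    ultimately show ?thesis unfolding test_fun1_def by blast
  qed
  have m: "\<bar>a * b\<bar> \<le> A * \<bar>b\<bar>" if "\<bar>a\<bar> \<le> A" for a b A :: real
    using that by (simp add: abs_mult mult_right_mono)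
  have x0: "\<bar>cut (c n * y) * p\<bar> \<le> B0 * \<bar>p\<bar>" for n y p by (rule m[OF B0(1)])
  have x1: "\<bar>c n * deriv cut (c n * y) * p\<bar> \<le> B1 * \<bar>p\<bar>" for n y p
  proof (rule m)
    have "\<bar>c n * deriv cut (c n * y)\<bar> \<le> 1 * B1" unfolding abs_mult
      using c[of n] B by (intro mult_mono B1) auto
    then show "\<bar>c n * deriv cut (c n * y)\<bar> \<le> B1" by simp
  qed
  have x2: "\<bar>(c n)^2 * deriv (deriv cut) (c n * y) * p\<bar> \<le> B2 * \<bar>p\<bar>" for n y p
  proof (rule m)
    have "(c n)^2 \<le> 1" using c[of n] power_le_one[of "c n" 2] by simp
    then have "\<bar>(c n)^2 * deriv (deriv cut) (c n * y)\<bar> \<le> 1 * B2" unfolding abs_mult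
      using B by (intro mult_mono B2) auto
    then show "\<bar>(c n)^2 * deriv (deriv cut) (c n * y)\<bar> \<le> B2" by simp
  qed
  have pos: "0 \<le> B0 * \<bar>p\<bar>" "0 \<le> B1 * \<bar>p\<bar>" "0 \<le> B2 * \<bar>p\<bar>" for p using B by auto
  have b0: "\<bar>\<theta> n y\<bar> \<le> \<kappa> y" for n y
    using x0[of n y "\<psi> y"] pos[of "\<psi> y"] pos[of "deriv \<psi> y"] pos[of "deriv (deriv \<psi>) y"]
    unfolding \<theta>_def \<kappa>_def distrib_right by linarith
  have b1: "\<bar>\<theta>1 n y\<bar> \<le> \<kappa> y" for n y
    using x1[of n y "\<psi> y"] x0[of n y "deriv \<psi> y"] pos[of "\<psi> y"] pos[of "deriv \<psi> y"] pos[of "deriv (deriv \<psi>) y"]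
    unfolding \<theta>1_def \<kappa>_def distrib_right by linarith
  have b2: "\<bar>\<theta>2 n y\<bar> \<le> \<kappa> y" for n y
  proof -
    have "2 * c n * deriv cut (c n * y) * deriv \<psi> y = 2 * (c n * deriv cut (c n * y) * deriv \<psi> y)" by simp
    then show ?thesis
      using x2[of n y "\<psi> y"] x1[of n y "deriv \<psi> y"] x0[of n y "deriv (deriv \<psi>) y"]
        pos[of "\<psi> y"] pos[of "deriv \<psi> y"] pos[of "deriv (deriv \<psi>) y"]
      unfolding \<theta>2_def \<kappa>_def distrib_right by linarith
  qed
  have L0: "(\<lambda>n. cut (c n * y)) \<longlonglongrightarrow> 1" for y
  proof (rule tendsto_eventually)
    have "(\<lambda>n. \<bar>c n * y\<bar>) \<longlonglongrightarrow> 0"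
      using tendsto_rabs[OF tendsto_mult[OF clim tendsto_const[of y]]] by simp
    then have "\<forall>\<^sub>F n in sequentially. \<bar>c n * y\<bar> < 1" by (rule order_tendstoD) simp
    then show "\<forall>\<^sub>F n in sequentially. cut (c n * y) = 1" by eventually_elim (simp add: one)
  qed
  have L1: "(\<lambda>n. c n * deriv cut (c n * y)) \<longlonglongrightarrow> 0" for y
  proof (rule Lim_null_comparison)
    show "\<forall>\<^sub>F n in sequentially. norm (c n * deriv cut (c n * y)) \<le> c n * B1"
      using c B1 by (intro always_eventually allI) (simp add: abs_mult abs_of_pos)
    show "(\<lambda>n. c n * B1) \<longlonglongrightarrow> 0" using tendsto_mult[OF clim tendsto_const[of B1]] by simp
  qed
  have L2: "(\<lambda>n. (c n)^2 * deriv (deriv cut) (c n * y)) \<longlonglongrightarrow> 0" for y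
  proof (rule Lim_null_comparison)
    show "\<forall>\<^sub>F n in sequentially. norm ((c n)^2 * deriv (deriv cut) (c n * y)) \<le> (c n)^2 * B2"
      using c B2 by (intro always_eventually allI) (simp add: abs_mult mult_left_mono)
    show "(\<lambda>n. (c n)^2 * B2) \<longlonglongrightarrow> 0" using tendsto_mult[OF tendsto_power[OF clim, of 2] tendsto_const[of B2]] by simp
  qed
  have b1': "\<bar>deriv (\<theta> n) y\<bar> \<le> \<kappa> y" and b2': "\<bar>deriv (deriv (\<theta> n)) y\<bar> \<le> \<kappa> y" for n y
    unfolding D2 unfolding D1 by (rule b1 b2)+
  show ?thesis
  proof (rule that[of \<theta> \<kappa>])
    show "(\<lambda>n. \<theta> n y) \<longlonglongrightarrow> \<psi> y" for y
      unfolding \<theta>_def using tendsto_mult[OF L0 tendsto_const, of y "\<psi> y"] by simp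
    show "(\<lambda>n. deriv (\<theta> n) y) \<longlonglongrightarrow> deriv \<psi> y" for y
      unfolding D1 \<theta>1_def
      using tendsto_add[OF tendsto_mult[OF L1 tendsto_const] tendsto_mult[OF L0 tendsto_const], of y "\<psi> y" y "deriv \<psi> y"] by simp
    show "(\<lambda>n. deriv (deriv (\<theta> n)) y) \<longlonglongrightarrow> deriv (deriv \<psi>) y" for y
    proof -
      have "(\<lambda>n. (c n)^2 * deriv (deriv cut) (c n * y) * \<psi> y + 2 * (c n * deriv cut (c n * y)) * deriv \<psi> y
          + cut (c n * y) * deriv (deriv \<psi>) y) \<longlonglongrightarrow> 0 * \<psi> y + 2 * 0 * deriv \<psi> y + 1 * deriv (deriv \<psi>) y"
        by (intro tendsto_add tendsto_mult L2 L1 L0 tendsto_const)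
      then show ?thesis unfolding D2 \<theta>2_def by (simp add: mult.assoc)
    qed
  qed (rule tf kk b0 b1' b2')+
qed

lemma pk_shift_smooth:
  assumes e: "0 < e"
  shows "smooth1 (\<lambda>y. pk e (x - y))" "deriv (\<lambda>y. pk e (x - y)) = (\<lambda>y. - pk1 e (x - y))"
    "deriv (deriv (\<lambda>y. pk e (x - y))) = (\<lambda>y. pk2 e (x - y))"
    "kern (\<lambda>y. pk e (x - y))" "kern (\<lambda>y. - pk1 e (x - y))" "kern (\<lambda>y. pk2 e (x - y))"
proof -
  have "smooth1 (\<lambda>z. (e / pi) * inverse (z * z + e^2))"
  proof (intro smooth1_cmult smooth1_inverse smooth1_add smooth1_const)
    show "smooth1 (\<lambda>z::real. z * z)" by (rule smooth1_mult[OF smooth1_ident smooth1_ident])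
    show "z * z + e^2 \<noteq> 0" for z using kernel_denom(1)[OF e, of z] unfolding power2_eq_square by linarith
  qed
  moreover have "(\<lambda>z. (e / pi) * inverse (z * z + e^2)) = pk e"
    by (auto simp: pk_def power2_eq_square field_simps)
  ultimately have "smooth1 (pk e)" by simp
  from smooth1_affine[OF this, of "-1" x] show "smooth1 (\<lambda>y. pk e (x - y))" by simp
  have ch: "((\<lambda>y. F (x - y)) has_real_derivative - F' (x - y)) (at y)" if "\<And>z. (F has_real_derivative F' z) (at z)" for F F' y
  proof -
    have "((\<lambda>y. F (x - y)) has_real_derivative F' (x - y) * (0 - 1)) (at y)"
      by (rule DERIV_chain2[OF that]) (intro DERIV_diff DERIV_const DERIV_ident)
    then show ?thesis by simp
  qed
  show d: "deriv (\<lambda>y. pk e (x - y)) = (\<lambda>y. - pk1 e (x - y))"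
    using ch[OF kernel_derivs(1)[OF e]] by (auto intro: DERIV_imp_deriv)
  show "deriv (deriv (\<lambda>y. pk e (x - y))) = (\<lambda>y. pk2 e (x - y))"
    unfolding d using DERIV_minus[OF ch[OF kernel_derivs(3)[OF e]]] by (auto intro: DERIV_imp_deriv)
  show "kern (\<lambda>y. pk e (x - y))" "kern (\<lambda>y. pk2 e (x - y))" by (intro kern_shift kernel_kern e)+
  show "kern (\<lambda>y. - pk1 e (x - y))"
    using kern_cmult[OF kern_shift[OF kernel_kern(2)[OF e]], of "-1" x] by simp
qed

lemma dominated_kern_limit:
  assumes k: "kern \<kappa>" and f: "wint f" and m: "\<And>n. \<theta> n \<in> borel_measurable borel" "\<psi> \<in> borel_measurable borel"
    and b: "\<And>n y. \<bar>\<theta> n y\<bar> \<le> \<kappa> y" and l: "\<And>y. (\<lambda>n. \<theta> n y) \<longlonglongrightarrow> \<psi> y"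
  shows "(\<lambda>n. LBINT y. f y * \<theta> n y) \<longlonglongrightarrow> (LBINT y. f y * \<psi> y)"
proof (rule integral_dominated_convergence[where w = "\<lambda>y. \<kappa> y * \<bar>f y\<bar>"])
  have [measurable]: "f \<in> borel_measurable borel" using f by (simp add: wint_def)
  note [measurable] = m
  show "(\<lambda>y. f y * \<psi> y) \<in> borel_measurable lborel" "\<And>n. (\<lambda>y. f y * \<theta> n y) \<in> borel_measurable lborel"
    by measurable
  show "integrable lborel (\<lambda>y. \<kappa> y * \<bar>f y\<bar>)" by (rule kern_mult_integrable[OF k wint_abs[OF f]])
  show "AE y in lborel. (\<lambda>n. f y * \<theta> n y) \<longlonglongrightarrow> f y * \<psi> y"
    by (intro AE_I2 tendsto_mult tendsto_const l)
  show "AE y in lborel. norm (f y * \<theta> n y) \<le> \<kappa> y * \<bar>f y\<bar>" for n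
    unfolding real_norm_def abs_mult mult.commute[of "\<bar>f _\<bar>"] by (intro AE_I2 mult_right_mono b) simp
qed

lemma sob_weak_deriv:
  assumes "sob f g" shows "weak_deriv f g"
proof -
  have f: "L2 f" and g: "L2 g" using assms by (auto simp: sob_def)
  have eq: "f x = f 0 + prim g x" for x
  proof -
    have p0: "prim g 0 = 0" by (simp add: prim_def)
    show ?thesis
    proof (cases "0 \<le> x")
      case True
      then have "f x - f 0 = (LINT y:{0..x}|lborel. g y)" "prim g x - prim g 0 = (LINT y:{0..x}|lborel. g y)"
        using assms prim_diff[OF L2_loc_int[OF g]] by (auto simp: sob_def)
      then show ?thesis using p0 by simp
    next
      case False
      then have "x \<le> 0" by simp
      then have "f 0 - f x = (LINT y:{x..0}|lborel. g y)" "prim g 0 - prim g x = (LINT y:{x..0}|lborel. g y)"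
        using assms prim_diff[OF L2_loc_int[OF g]] by (auto simp: sob_def)
      then show ?thesis using p0 by simp
    qed
  qed
  show ?thesis
    unfolding weak_deriv_def
  proof (intro allI impI)
    fix \<phi> assume p: "test_fun1 \<phi>"
    note p' = test_fun1_deriv[OF p]
    have "(LBINT x. f x * deriv \<phi> x) = (LBINT x. f 0 * deriv \<phi> x + prim g x * deriv \<phi> x)"
      by (subst eq) (simp add: distrib_right)
    also have "\<dots> = f 0 * (LBINT x. deriv \<phi> x) + (LBINT x. prim g x * deriv \<phi> x)"
      using loc_int_test_integrable[OF loc_int_const p', of "f 0"]
        loc_int_test_integrable[OF loc_int_prim[OF L2_loc_int[OF g]] p'] by simp
    finally show "(LBINT x. f x * deriv \<phi> x) = - (LBINT x. g x * \<phi> x)"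
      using integral_deriv_test(2)[OF p] weak_deriv_prim[OF L2_loc_int[OF g]] p by (simp add: weak_deriv_def)
  qed
qed

text \<open>Integration by parts against the Poisson kernel, justified by cutoffs. It bounds the
  derivative of the smoothed function in \<open>L2\<close> by the norm of \<open>g\<close>,
  uniformly in \<open>e\<close>.\<close>

lemma conv_pk1_eq:
  assumes e: "0 < e" and s: "sob f g"
  shows "conv (pk1 e) f x = conv (pk e) g x"
proof -
  have f: "L2 f" and g: "L2 g" using s by (auto simp: sob_def)
  note ps = pk_shift_smooth[OF e, of x]
  obtain \<theta> \<kappa> where t: "\<And>n::nat. test_fun1 (\<theta> n)" "kern \<kappa>"
    "\<And>n y. \<bar>\<theta> n y\<bar> \<le> \<kappa> y" "\<And>n y. \<bar>deriv (\<theta> n) y\<bar> \<le> \<kappa> y"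
    "\<And>y. (\<lambda>n. \<theta> n y) \<longlonglongrightarrow> pk e (x - y)" "\<And>y. (\<lambda>n. deriv (\<theta> n) y) \<longlonglongrightarrow> - pk1 e (x - y)"
    by (rule test_cutoff[OF ps(1), unfolded ps(2,3)]) (use ps in auto)
  have A: "(\<lambda>n. LBINT y. f y * deriv (\<theta> n) y) \<longlonglongrightarrow> (LBINT y. f y * (- pk1 e (x - y)))"
    by (rule dominated_kern_limit[OF t(2) wint_L2[OF f] _ _ t(4,6)])
       (use test_fun1_measurable[OF test_fun1_deriv[OF t(1)]] in measurable)
  have E: "(LBINT y. f y * deriv (\<theta> n) y) = - (LBINT y. g y * \<theta> n y)" for n
    using sob_weak_deriv[OF s] t(1) by (simp add: weak_deriv_def)
  have "(\<lambda>n. LBINT y. g y * \<theta> n y) \<longlonglongrightarrow> (LBINT y. g y * pk e (x - y))"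
    by (rule dominated_kern_limit[OF t(2) wint_L2[OF g] _ _ t(3,5)])
       (use test_fun1_measurable[OF t(1)] in measurable)
  then have B: "(\<lambda>n. - (LBINT y. g y * \<theta> n y)) \<longlonglongrightarrow> - (LBINT y. g y * pk e (x - y))"
    by (rule tendsto_minus)
  have "(LBINT y. f y * (- pk1 e (x - y))) = - (LBINT y. g y * pk e (x - y))"
    by (rule LIMSEQ_unique[OF A[unfolded E] B])
  then show ?thesis by (simp add: conv_def mult.commute)
qed

lemma integral_total_derivative_zero:
  assumes d: "\<And>x. (T has_real_derivative T' x) (at x)" and i: "integrable lborel T" and i': "integrable lborel T'"
  shows "(LBINT x. T' x) = (0::real)"
proof -
  \<comment> \<open>The integral of \<open>T (x + 1) - T x\<close> vanishes by translation invariance; no decay of \<open>T\<close> is used.\<close>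
  define k where "k = (indicator {-1..0} :: real \<Rightarrow> real)"
  have k: "integrable lborel k" unfolding k_def by (rule integrable_indicator_Icc)
  have "conv k T' x = T (1 + 1 * x) - T x" for x
  proof -
    have "set_integrable lborel {x..x+1} T'"
      using integrable_mult_indicator[OF _ i', of "{x..x+1}"] by (simp add: set_integrable_def)
    then have "(LINT y:{x..x+1}|lborel. T' y) = integral {x..x+1} T'"
      by (rule set_borel_integral_eq_integral(2))
    also have "\<dots> = T (x + 1) - T x"
    proof (rule integral_unique, rule fundamental_theorem_of_calculus)
      show "(T has_vector_derivative T' y) (at y within {x..x+1})" for y
        by (rule has_vector_derivative_at_within[OF has_real_derivative_iff_has_vector_derivative[THEN iffD1, OF d]])
    qed simp
    also have "(LINT y:{x..x+1}|lborel. T' y) = conv k T' x"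
      unfolding conv_def set_lebesgue_integral_def k_def
      by (intro Bochner_Integration.integral_cong) (auto simp: indicator_def)
    finally show ?thesis by (simp add: add.commute)
  qed
  then have eq: "conv k T' = (\<lambda>x. T (1 + 1 * x) - T x)" by auto
  have "(LBINT x. k x) * (LBINT x. T' x) = (LBINT x. T (1 + 1 * x) - T x)"
    using conv_integral(2)[OF k i'] unfolding eq by simp
  also have "\<dots> = (LBINT x. T (1 + 1 * x)) - (LBINT x. T x)"
    by (rule Bochner_Integration.integral_diff[OF lborel_integrable_real_affine[OF i] i]) simp
  also have "\<dots> = 0" using lborel_integral_real_affine[of 1 T 1] by simp
  finally show ?thesis by (simp add: k_def)
qed

definition wt :: "real \<Rightarrow> real \<Rightarrow> real" where "wt m x = x^2 / (x^2 + m^2)"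
definition wt1 :: "real \<Rightarrow> real \<Rightarrow> real" where "wt1 m x = 2 * x * m^2 / (x^2 + m^2)^2"

text \<open>The slope bound is \<open>2 m \<bar>x\<bar> \<le> x^2 + m^2\<close>. It is the source of
  the factor \<open>1 / m\<close> in each flux term where the derivative falls on the
  weight.\<close>

lemma wt_props:
  assumes m: "0 < m"
  shows "wt m x = 1 - m^2 / (x^2 + m^2)" "0 \<le> wt m x" "wt m x \<le> 1"
    "(wt m has_real_derivative wt1 m x) (at x)" "\<bar>wt1 m x\<bar> \<le> 1 / m"
proof -
  note D = kernel_denom[OF m, of x]
  show "wt m x = 1 - m^2 / (x^2 + m^2)" 
    using D(1) m by (simp add: wt_def eq_diff_eq add_divide_distrib[symmetric])
  show "0 \<le> wt m x" "wt m x \<le> 1" using D by (auto simp: wt_def)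
  have "((\<lambda>x. x^2 / (x^2 + m^2)) has_real_derivative (2 * x * (x^2 + m^2) - x^2 * (2 * x)) / ((x^2 + m^2) * (x^2 + m^2))) (at x)"
    by (rule DERIV_divide[OF _ DERIV_denom]) (use D(1) in \<open>auto intro!: derivative_eq_intros\<close>)
  then show "(wt m has_real_derivative wt1 m x) (at x)"
    unfolding wt_def[abs_def] wt1_def by (simp add: power2_eq_square algebra_simps)
  have "\<bar>wt1 m x\<bar> = (2 * m * \<bar>x\<bar>) * m / (x^2 + m^2)^2"
    using m by (simp add: wt1_def abs_mult power2_eq_square)
  also have "\<dots> \<le> (x^2 + m^2) * m / (x^2 + m^2)^2"
    using D m by (intro divide_right_mono mult_right_mono) auto
  also have "\<dots> = m / (x^2 + m^2)" using D(1) by (simp add: power2_eq_square)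
  also have "\<dots> \<le> m / m^2" using D m by (intro divide_left_mono) auto
  also have "\<dots> = 1 / m" using m by (simp add: power2_eq_square)
  finally show "\<bar>wt1 m x\<bar> \<le> 1 / m" .
qed

lemma wt_measurable [measurable]: "wt m \<in> borel_measurable borel" "wt1 m \<in> borel_measurable borel"
  unfolding wt_def[abs_def] wt1_def[abs_def] by measurable

text \<open>The modulus of approximation of the Poisson smoothing on functions of Hoelder exponent 1/2.\<close>
definition pk_modulus :: "real \<Rightarrow> real" where
  "pk_modulus e = (LBINT t. pk 1 t * min (sqrt (e * \<bar>t\<bar>)) 1)"

lemma pk_modulus_tendsto: "(\<lambda>n. pk_modulus (1 / real (Suc n))) \<longlonglongrightarrow> 0"
proof -
  have "(\<lambda>n. LBINT t. pk 1 t * min (sqrt (1 / real (Suc n) * \<bar>t\<bar>)) 1) \<longlonglongrightarrow> (\<integral>t. 0 \<partial>(lborel :: real measure))"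
  proof (rule integral_dominated_convergence[where w = "pk 1"])
    show "integrable lborel (pk 1)" by (rule kern_integrable[OF kernel_kern(1)]) simp
    show "AE t in lborel. (\<lambda>n. pk 1 t * min (sqrt (1 / real (Suc n) * \<bar>t\<bar>)) 1) \<longlonglongrightarrow> 0"
    proof (rule AE_I2)
      fix t :: real
      have "(\<lambda>n. pk 1 t * min (sqrt (1 / real (Suc n) * \<bar>t\<bar>)) 1) \<longlonglongrightarrow> pk 1 t * min (sqrt (0 * \<bar>t\<bar>)) 1"
        by (intro tendsto_mult tendsto_min tendsto_real_sqrt tendsto_const LIMSEQ_Suc[OF lim_1_over_n])
      then show "(\<lambda>n. pk 1 t * min (sqrt (1 / real (Suc n) * \<bar>t\<bar>)) 1) \<longlonglongrightarrow> 0" by simp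
    qed
    show "AE t in lborel. norm (pk 1 t * min (sqrt (1 / real (Suc n) * \<bar>t\<bar>)) 1) \<le> pk 1 t" for n
      using pk_nonneg[of 1] by (intro AE_I2) (simp add: abs_mult mult_left_le)
  qed measurable
  then show ?thesis by (simp add: pk_modulus_def)
qed

lemma pk_modulus_scaled:
  assumes e: "0 < e"
  shows "(LBINT y. pk e (x - y) * min (sqrt \<bar>x - y\<bar>) 1) = pk_modulus e"
proof -
  have "(LBINT y. pk e (x - y) * min (sqrt \<bar>x - y\<bar>) 1) = \<bar>- e\<bar> *\<^sub>R (LBINT t. pk e (x - (x + (-e) * t)) * min (sqrt \<bar>x - (x + (-e) * t)\<bar>) 1)"
    by (rule lborel_integral_real_affine) (use e in simp)
  also have "\<dots> = (LBINT t. e * (pk e (e * t) * min (sqrt \<bar>e * t\<bar>) 1))"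
    using e by simp
  also have "\<dots> = pk_modulus e"
    unfolding pk_modulus_def
  proof (rule Bochner_Integration.integral_cong[OF refl])
    fix t
    have "e * pk e (e * t) = pk 1 t"
    proof -
      have "(e * t)^2 + e^2 = e^2 * (t^2 + 1)" by (simp add: power_mult_distrib algebra_simps)
      then show ?thesis using e by (simp add: pk_def power2_eq_square)
    qed
    then show "e * (pk e (e * t) * min (sqrt \<bar>e * t\<bar>) 1) = pk 1 t * min (sqrt (e * \<bar>t\<bar>)) 1"
      using e by (simp add: abs_mult mult.assoc[symmetric])
  qed
  finally show ?thesis .
qed

lemma pk_shift_integral: "0 < e \<Longrightarrow> (LBINT y. pk e (x - y)) = 1"
  using lborel_integral_real_affine[of "-1" "pk e" x] pk_integral[of e] by simp

text \<open>Expanding the square, the left side is the Poisson average of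
  \<open>(f y - f x)^2\<close>. It is the sum of a variance and a squared error, both nonnegative,
  so each is bounded separately.\<close>

lemma smoothing_error:
  assumes e: "0 < e" and s: "sob f g" and M: "L2_norm f \<le> M" "L2_norm g \<le> M"
  shows "conv (pk e) (\<lambda>y. (f y)^2) x - (conv (pk e) f x)^2 + (conv (pk e) f x - f x)^2 \<le> 64 * M^2 * pk_modulus e"
    and "\<bar>f x\<bar> \<le> 4 * M"
proof -
  have M0: "0 \<le> M" using M(1) L2_norm_nonneg[of f] by linarith
  have f: "L2 f" using s by (simp add: sob_def)
  have [measurable]: "f \<in> borel_measurable borel" using f by (rule L2_meas)
  have sup: "\<bar>f y\<bar> \<le> 4 * M" for y 
    by (rule order_trans[OF sob_sup'[OF s]]) (use M in simp)
  show "\<bar>f x\<bar> \<le> 4 * M" by (rule sup)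
  have f2: "integrable lborel (\<lambda>y. (f y)^2)" using f by (simp add: L2_iff)
  note kp = kernel_kern(1)[OF e]
  have i1: "integrable lborel (\<lambda>y. pk e (x - y) * (f y)^2)" by (rule conv_integrable[OF kp wint_integrable[OF f2]])
  have i2: "integrable lborel (\<lambda>y. pk e (x - y) * f y)" by (rule conv_integrable[OF kp wint_L2[OF f]])
  have i3: "integrable lborel (\<lambda>y. pk e (x - y))" by (rule kern_integrable[OF kern_shift[OF kp]])
  have expand: "pk e (x - y) * (f y - f x)^2 = pk e (x - y) * (f y)^2 - 2 * f x * (pk e (x - y) * f y) + (f x)^2 * pk e (x - y)" for y
    by (simp add: power2_diff algebra_simps)
  have i4: "integrable lborel (\<lambda>y. pk e (x - y) * (f y - f x)^2)"
    unfolding expand using i1 i2 i3 by auto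
  have "conv (pk e) (\<lambda>y. (f y)^2) x - (conv (pk e) f x)^2 + (conv (pk e) f x - f x)^2
     = conv (pk e) (\<lambda>y. (f y)^2) x - 2 * f x * conv (pk e) f x + (f x)^2"
    by (simp add: power2_diff)
  also have "\<dots> = (LBINT y. pk e (x - y) * (f y - f x)^2)"
    unfolding expand conv_def using i1 i2 i3 pk_shift_integral[OF e] by simp
  also have "\<dots> \<le> (LBINT y. 64 * M^2 * (pk e (x - y) * min (sqrt \<bar>x - y\<bar>) 1))"
  proof (rule integral_mono[OF i4])
    show "integrable lborel (\<lambda>y. 64 * M^2 * (pk e (x - y) * min (sqrt \<bar>x - y\<bar>) 1))"
    proof (rule integrable_mult_right, rule Bochner_Integration.integrable_bound[OF i3])
      show "AE y in lborel. norm (pk e (x - y) * min (sqrt \<bar>x - y\<bar>) 1) \<le> norm (pk e (x - y))"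
        by (intro AE_I2) (simp add: abs_mult mult_left_le)
    qed measurable
    fix y
    have a1: "\<bar>f y - f x\<bar> \<le> 8 * M" using sup[of x] sup[of y] by linarith
    have a2: "\<bar>f y - f x\<bar> \<le> sqrt \<bar>x - y\<bar> * M"
      using sob_Hoelder[OF s, of y x] mult_left_mono[OF M(2), of "sqrt \<bar>y - x\<bar>"] by (simp add: abs_minus_commute)
    \<comment> \<open>One factor uses the better of the Hoelder and the supremum bound, the other
      only the supremum. A single square root keeps the average finite, since the Poisson kernel
      decays only quadratically.\<close>
    have "\<bar>f y - f x\<bar> * \<bar>f y - f x\<bar> \<le> (8 * M * min (sqrt \<bar>x - y\<bar>) 1) * (8 * M)"
    proof (rule mult_mono)
      show "\<bar>f y - f x\<bar> \<le> 8 * M * min (sqrt \<bar>x - y\<bar>) 1"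
      proof (cases "sqrt \<bar>x - y\<bar> \<le> 1")
        case True
        have "0 \<le> sqrt \<bar>x - y\<bar> * M" using M0 by simp
        then have "sqrt \<bar>x - y\<bar> * M \<le> 8 * (sqrt \<bar>x - y\<bar> * M)"
          using M0 by (simp add: mult_nonneg_nonneg)
        then have "\<bar>f y - f x\<bar> \<le> 8 * (sqrt \<bar>x - y\<bar> * M)" by (rule order_trans[OF a2])
        then show ?thesis using True by (simp add: ac_simps)
      next
        case False
        then show ?thesis using a1 by simp
      qed
    qed (use a1 M0 in auto)
    then have "(f y - f x)^2 \<le> 64 * M^2 * min (sqrt \<bar>x - y\<bar>) 1"
      by (simp add: power2_eq_square ac_simps flip: abs_mult)
    then show "pk e (x - y) * (f y - f x)^2 \<le> 64 * M^2 * (pk e (x - y) * min (sqrt \<bar>x - y\<bar>) 1)"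
      using mult_left_mono[OF _ pk_nonneg[OF e], of "(f y - f x)^2" "64 * M^2 * min (sqrt \<bar>x - y\<bar>) 1" "x - y"]
      by (simp add: ac_simps)
  qed
  also have "\<dots> = 64 * M^2 * pk_modulus e" by (simp only: integral_mult_right_zero pk_modulus_scaled[OF e])
  finally show "conv (pk e) (\<lambda>y. (f y)^2) x - (conv (pk e) f x)^2 + (conv (pk e) f x - f x)^2 \<le> 64 * M^2 * pk_modulus e" .
qed

lemma pk_modulus_nonneg: "0 \<le> pk_modulus e" if "0 < e"
  unfolding pk_modulus_def using that by (intro integral_nonneg_AE AE_I2) (simp add: pk_nonneg)

lemma L2_mult3_bounds:
  assumes "L2 f" "L2 g" "a \<in> borel_measurable borel" "\<And>x. \<bar>a x\<bar> \<le> A" "0 \<le> A"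
  shows "integrable lborel (\<lambda>x. a x * f x * g x)" "\<bar>LBINT x. a x * f x * g x\<bar> \<le> A * (L2_norm f * L2_norm g)"
proof -
  note L = L2_mult_bounded[OF assms(1,3,4)]
  show "integrable lborel (\<lambda>x. a x * f x * g x)" by (rule L2_mult_integrable[OF L assms(2)])
  have "\<bar>LBINT x. a x * f x * g x\<bar> \<le> L2_norm (\<lambda>x. a x * f x) * L2_norm g"
    by (rule L2_Cauchy_Schwarz[OF L assms(2)])
  also have "\<dots> \<le> (A * L2_norm f) * L2_norm g"
    by (intro mult_right_mono L2_norm_mult_bounded assms L2_norm_nonneg)
  finally show "\<bar>LBINT x. a x * f x * g x\<bar> \<le> A * (L2_norm f * L2_norm g)" by (simp add: mult.assoc)
qed

text \<open>Moving one derivative off \<open>w_xx\<close> yields a term with the slope of the weight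
  and the term \<open>wt v_x w_x\<close>. The latter equals minus the same integral with the
  complementary weight, by orthogonality, and that is \<open>O(m^(-2))\<close>;
  \<open>m \<ge> 1\<close> turns this into \<open>O(1 / m)\<close>.\<close>

lemma dispersion_flux_bound:
  assumes e: "0 < e" and m: "1 \<le> m" and s: "sob f g" and M: "L2_norm f \<le> M" "L2_norm g \<le> M"
  shows "\<bar>LBINT x. wt m x * conv (pk e) f x * conv (qk2 e) f x\<bar> \<le> 2 * M^2 / m"
    and "integrable lborel (\<lambda>x. wt m x * conv (pk e) f x * conv (qk2 e) f x)"
    and "L2_norm (conv (pk e) f) \<le> M" "L2_norm (conv (pk1 e) f) \<le> M"
proof -
  have m0: "0 < m" using m by simp
  have M0: "0 \<le> M" using M(1) L2_norm_nonneg[of f] by linarith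
  have f: "L2 f" and g: "L2 g" using s by (auto simp: sob_def)
  define v where "v = conv (pk e) f"
  define v1 where "v1 = conv (pk1 e) f"
  define w1 where "w1 = conv (qk1 e) f"
  define w2 where "w2 = conv (qk2 e) f"
  have L: "L2 v" "L2 v1" "L2 w1" "L2 w2"
    unfolding v_def v1_def w1_def w2_def by (intro conv_L2 kernel_kern e f)+
  have pk1: "(LBINT z. \<bar>pk e z\<bar>) = 1" using pk_integral[OF e] pk_nonneg[OF e] by simp
  show nv: "L2_norm (conv (pk e) f) \<le> M"
    using conv_L2(2)[OF kernel_kern(1)[OF e] f] M pk1 by simp
  have "v1 = conv (pk e) g" unfolding v1_def using conv_pk1_eq[OF e s] by auto
  then have nv1: "L2_norm v1 \<le> M"
    using conv_L2(2)[OF kernel_kern(1)[OF e] g] M pk1 by simp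
  then show "L2_norm (conv (pk1 e) f) \<le> M" by (simp add: v1_def)
  have nw1: "L2_norm w1 \<le> M"
    using nv1 hilbert_isometry(1)[OF e f] by (simp add: v1_def w1_def)
  have wtb: "\<bar>wt m x\<bar> \<le> 1" for x using wt_props(2,3)[OF m0, of x] by simp
  have wt1b: "\<bar>wt1 m x\<bar> \<le> 1 / m" for x by (rule wt_props(5)[OF m0])
  note i2 = L2_mult3_bounds(1)[OF L(1,4) wt_measurable(1) wtb]
  show int: "integrable lborel (\<lambda>x. wt m x * conv (pk e) f x * conv (qk2 e) f x)"
    using i2 by (simp add: v_def w2_def)
  note i0 = L2_mult3_bounds(1)[OF L(1,3) wt_measurable(1) wtb]
  note i1 = L2_mult3_bounds[OF L(1,3) wt_measurable(2) wt1b]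
  note i3 = L2_mult3_bounds(1)[OF L(2,3) wt_measurable(1) wtb]
  have d: "((\<lambda>x. wt m x * v x * w1 x) has_real_derivative wt1 m x * v x * w1 x + wt m x * v1 x * w1 x + wt m x * v x * w2 x) (at x)" for x
    unfolding v_def v1_def w1_def w2_def
    by (rule derivative_eq_intros wt_props(4)[OF m0] conv_kernel_derivs[OF e wint_L2[OF f]] refl)+ (simp add: algebra_simps)
  have "0 = (LBINT x. wt1 m x * v x * w1 x + wt m x * v1 x * w1 x + wt m x * v x * w2 x)"
    by (rule integral_total_derivative_zero[OF d, symmetric])
       (intro Bochner_Integration.integrable_add i0 i1(1) i2 i3; use m0 in simp)+
  also have "\<dots> = (LBINT x. wt1 m x * v x * w1 x) + (LBINT x. wt m x * v1 x * w1 x) + (LBINT x. wt m x * v x * w2 x)"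
    using i1(1) i2 i3 m0 by simp
  finally have eq: "(LBINT x. wt m x * v x * w2 x) = - (LBINT x. wt1 m x * v x * w1 x) - (LBINT x. wt m x * v1 x * w1 x)"
    by linarith
  have "L2_norm v * L2_norm w1 \<le> M * M"
    using nv nw1 M0 L2_norm_nonneg by (intro mult_mono) (auto simp: v_def)
  then have "(1 / m) * (L2_norm v * L2_norm w1) \<le> (1 / m) * (M * M)" using m0 by (intro mult_left_mono) auto
  then have t1: "\<bar>LBINT x. wt1 m x * v x * w1 x\<bar> \<le> M^2 / m"
    using i1(2) m0 by (simp add: power2_eq_square)
  have t2: "\<bar>LBINT x. wt m x * v1 x * w1 x\<bar> \<le> M^2 / m"
  proof -
    have iv: "integrable lborel (\<lambda>x. v1 x * w1 x)" by (rule L2_mult_integrable[OF L(2,3)])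
    have cb: "\<bar>m^2 / (x^2 + m^2)\<bar> \<le> 1" for x using weight_complement_bounds[OF m0, of x] by simp
    have iw: "integrable lborel (\<lambda>x. m^2 / (x^2 + m^2) * v1 x * w1 x)"
      by (rule L2_mult3_bounds(1)[OF L(2,3) _ cb]) auto
    have "(LBINT x. wt m x * v1 x * w1 x) = (LBINT x. v1 x * w1 x - m^2 / (x^2 + m^2) * v1 x * w1 x)"
      by (simp add: wt_props(1)[OF m0] algebra_simps)
    also have "\<dots> = - (LBINT x. m^2 / (x^2 + m^2) * v1 x * w1 x)"
      using iv iw hilbert_isometry(2)[OF e f] by (simp add: v1_def w1_def)
    also have "(LBINT x. m^2 / (x^2 + m^2) * v1 x * w1 x) = (1/2) * (LBINT x. (2 * (v1 x * w1 x)) * (m^2 / (x^2 + m^2)))"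
      by (subst integral_mult_right_zero[symmetric]) (intro Bochner_Integration.integral_cong refl, simp)
    finally have "\<bar>LBINT x. wt m x * v1 x * w1 x\<bar> = (1/2) * \<bar>LBINT x. (2 * (v1 x * w1 x)) * (m^2 / (x^2 + m^2))\<bar>"
      by simp
    also have "\<dots> \<le> 1 * ((L2_norm f)^2 / m^2)"
      using cauchy_square_poisson(2)[OF e m0 f] by (intro mult_mono) (auto simp: v1_def w1_def)
    also have "\<dots> \<le> M^2 / m"
    proof -
      have "(L2_norm f)^2 \<le> M^2" using M L2_norm_nonneg by (intro power_mono)
      moreover have "m \<le> m^2" using m by (simp add: power2_eq_square)
      ultimately show ?thesis using m0 by (simp add: frac_le)
    qed
    finally show ?thesis .
  qed
  show "\<bar>LBINT x. wt m x * conv (pk e) f x * conv (qk2 e) f x\<bar> \<le> 2 * M^2 / m"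
    using t1 t2 eq unfolding v_def w2_def by (simp add: abs_le_iff)
qed

text \<open>The smoothed square \<open>F\<close> is written as \<open>v^2 + r\<close>. The part with
  \<open>v^2\<close> reduces to the integral of \<open>v^3\<close> against the slope of the weight;
  the part with the defect \<open>r\<close> is small in \<open>L2\<close> because \<open>r\<close>
  is small in supremum and dominated by \<open>F\<close>, whose integral is bounded.\<close>

lemma nonlinear_flux_bound:
  assumes e: "0 < e" and m: "1 \<le> m" and s: "sob f g" and M: "L2_norm f \<le> M" "L2_norm g \<le> M"
  shows "\<bar>LBINT x. wt m x * conv (pk e) f x * conv (pk1 e) (\<lambda>y. (f y)^2) x\<bar>
      \<le> 4 * M^3 / m + 16 * M^3 * sqrt (pk_modulus e)"
    and "integrable lborel (\<lambda>x. wt m x * conv (pk e) f x * conv (pk1 e) (\<lambda>y. (f y)^2) x)"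
proof -
  have m0: "0 < m" using m by simp
  have M0: "0 \<le> M" using M(1) L2_norm_nonneg[of f] by linarith
  have f: "L2 f" and g: "L2 g" using s by (auto simp: sob_def)
  have sup: "\<bar>f x\<bar> \<le> 4 * M" for x by (rule smoothing_error(2)[OF e s M])
  have fsq: "L2 (\<lambda>y. (f y)^2)"
    using L2_mult_bounded[OF f L2_meas[OF f] sup] by (simp add: power2_eq_square)
  have f2: "integrable lborel (\<lambda>y. (f y)^2)" using f by (simp add: L2_iff)
  define v where "v = conv (pk e) f"
  define v1 where "v1 = conv (pk1 e) f"
  define F where "F = conv (pk e) (\<lambda>y. (f y)^2)"
  define F1 where "F1 = conv (pk1 e) (\<lambda>y. (f y)^2)"
  define r where "r = (\<lambda>x. F x - (v x)^2)"
  have L: "L2 v" "L2 v1" unfolding v_def v1_def by (intro conv_L2 kernel_kern e f)+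
  have LF: "L2 F" "L2 F1" unfolding F_def F1_def by (intro conv_L2 kernel_kern e fsq)+
  note nv = dispersion_flux_bound(3)[OF e m s M, folded v_def] and nv1 = dispersion_flux_bound(4)[OF e m s M, folded v1_def]
  have r0: "0 \<le> r x" for x unfolding r_def F_def v_def using conv_pk_square_le[OF e f, of x] by simp
  have rsup: "r x \<le> 64 * M^2 * pk_modulus e" for x
    unfolding r_def F_def v_def using smoothing_error(1)[OF e s M, of x] zero_le_power2[of "conv (pk e) f x - f x"] by linarith
  have vsup: "\<bar>v x\<bar> \<le> 4 * M" for x
  proof -
    have kp: "kern (pk e)" by (rule kernel_kern(1)[OF e])
    have "\<bar>v x\<bar> \<le> (LBINT y. \<bar>pk e (x - y) * f y\<bar>)" unfolding v_def conv_def by (rule integral_abs_bound)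
    also have "\<dots> \<le> (LBINT y. 4 * M * pk e (x - y))"
    proof (rule integral_mono)
      show "integrable lborel (\<lambda>y. \<bar>pk e (x - y) * f y\<bar>)"
        by (intro integrable_abs conv_integrable kp wint_L2 f)
      show "integrable lborel (\<lambda>y. 4 * M * pk e (x - y))"
        by (intro integrable_mult_right kern_integrable kern_shift kp)
      show "\<bar>pk e (x - y) * f y\<bar> \<le> 4 * M * pk e (x - y)" for y
        using mult_right_mono[OF sup[of y] pk_nonneg[OF e, of "x - y"]] pk_nonneg[OF e, of "x - y"]
        by (simp add: abs_mult ac_simps)
    qed
    also have "\<dots> = 4 * M" by (simp only: integral_mult_right_zero pk_shift_integral[OF e])
    finally show ?thesis .
  qed
  have vm: "v \<in> borel_measurable borel" by (rule L2_meas[OF L(1)])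
  have Lv2: "L2 (\<lambda>x. v x * v x)" by (rule L2_mult_bounded[OF L(1) vm vsup])
  have Lr: "L2 r" unfolding r_def power2_eq_square by (rule L2_diff[OF LF(1) Lv2])
  have wtb: "\<bar>wt m x\<bar> \<le> 1" for x using wt_props(2,3)[OF m0, of x] by simp
  have wt1b: "\<bar>wt1 m x\<bar> \<le> 1 / m" for x by (rule wt_props(5)[OF m0])
  note wm = wt_measurable
  have m0': "0 \<le> 1 / m" using m0 by simp
  note b = L2_mult3_bounds
  note one = zero_le_one
  show int: "integrable lborel (\<lambda>x. wt m x * conv (pk e) f x * conv (pk1 e) (\<lambda>y. (f y)^2) x)"
    using b(1)[OF L(1) LF(2) wm(1) wtb one] by (simp add: v_def F1_def)
  define I where "I = (LBINT x. wt m x * v x * F1 x)"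
  define J where "J = (LBINT x. wt1 m x * v x * (v x * v x))"
  define K1 where "K1 = (LBINT x. wt1 m x * v x * r x)"
  define K2 where "K2 = (LBINT x. wt m x * v1 x * r x)"
  define P where "P = (LBINT x. wt m x * v1 x * (v x * v x))"
  have dv: "(v has_real_derivative v1 x) (at x)" for x
    unfolding v_def v1_def by (rule conv_kernel_derivs(1)[OF e wint_L2[OF f]])
  have dF: "(F has_real_derivative F1 x) (at x)" for x
    unfolding F_def F1_def by (rule conv_kernel_derivs(1)[OF e wint_L2[OF fsq]])
  have iJ: "integrable lborel (\<lambda>x. wt1 m x * v x * (v x * v x))" by (rule b(1)[OF L(1) Lv2 wm(2) wt1b m0'])
  have iP: "integrable lborel (\<lambda>x. wt m x * v1 x * (v x * v x))" by (rule b(1)[OF L(2) Lv2 wm(1) wtb one])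
  have iK1: "integrable lborel (\<lambda>x. wt1 m x * v x * r x)" by (rule b(1)[OF L(1) Lr wm(2) wt1b m0'])
  have iK2: "integrable lborel (\<lambda>x. wt m x * v1 x * r x)" by (rule b(1)[OF L(2) Lr wm(1) wtb one])
  have iI: "integrable lborel (\<lambda>x. wt m x * v x * F1 x)" by (rule b(1)[OF L(1) LF(2) wm(1) wtb one])
  \<comment> \<open>The derivative of \<open>wt v F\<close>, with \<open>F\<close> split into
    \<open>r + v^2\<close> wherever it is not differentiated; thus \<open>r\<close> is never
    differentiated.\<close>
  have "0 = (LBINT x. (wt1 m x * v x * r x + wt1 m x * v x * (v x * v x)) + (wt m x * v1 x * r x + wt m x * v1 x * (v x * v x)) + wt m x * v x * F1 x)"
  proof (rule integral_total_derivative_zero[symmetric])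
    show "((\<lambda>x. wt m x * v x * F x) has_real_derivative
       (wt1 m x * v x * r x + wt1 m x * v x * (v x * v x)) + (wt m x * v1 x * r x + wt m x * v1 x * (v x * v x)) + wt m x * v x * F1 x) (at x)" for x
      by (rule derivative_eq_intros wt_props(4)[OF m0] dv dF refl)+ (simp add: r_def power2_eq_square algebra_simps)
    show "integrable lborel (\<lambda>x. wt m x * v x * F x)" by (rule b(1)[OF L(1) LF(1) wm(1) wtb one])
  qed (intro Bochner_Integration.integrable_add iJ iP iK1 iK2 iI)
  also have "\<dots> = (K1 + J) + (K2 + P) + I"
    unfolding I_def J_def K1_def K2_def P_def
    by (simp only: Bochner_Integration.integral_add Bochner_Integration.integrable_add iJ iP iK1 iK2 iI)
  finally have e1: "I = - ((K1 + J) + (K2 + P))" by simp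
  \<comment> \<open>Since \<open>v^2 v_x\<close> is a third of the derivative of \<open>v^3\<close>,
    the term \<open>P\<close> is traded for \<open>J\<close>, which carries the slope of the
    weight.\<close>
  have "0 = (LBINT x. wt1 m x * v x * (v x * v x) + 3 * (wt m x * v1 x * (v x * v x)))"
  proof (rule integral_total_derivative_zero[symmetric])
    show "((\<lambda>x. wt m x * v x * (v x * v x)) has_real_derivative
       wt1 m x * v x * (v x * v x) + 3 * (wt m x * v1 x * (v x * v x))) (at x)" for x
      by (rule derivative_eq_intros wt_props(4)[OF m0] dv refl)+ (simp add: algebra_simps)
    show "integrable lborel (\<lambda>x. wt m x * v x * (v x * v x))" by (rule b(1)[OF L(1) Lv2 wm(1) wtb one])
  qed (intro Bochner_Integration.integrable_add integrable_mult_right iJ iP)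
  also have "\<dots> = J + 3 * P"
    unfolding J_def P_def using iJ iP by simp
  finally have e2: "P = - J / 3" by simp
  have tJ: "\<bar>J\<bar> \<le> 4 * M^3 / m"
  proof -
    have nv2: "L2_norm (\<lambda>x. v x * v x) \<le> (4 * M) * L2_norm v"
      by (rule L2_norm_mult_bounded[OF L(1) vm vsup]) (use M0 in simp)
    have "\<bar>J\<bar> \<le> (1 / m) * (L2_norm v * L2_norm (\<lambda>x. v x * v x))"
      unfolding J_def by (rule b(2)[OF L(1) Lv2 wm(2) wt1b m0'])
    also have "\<dots> \<le> (1 / m) * (M * ((4 * M) * M))"
    proof (intro mult_left_mono mult_mono m0' nv M0 L2_norm_nonneg)
      show "L2_norm (\<lambda>x. v x * v x) \<le> 4 * M * M"
        by (rule order_trans[OF nv2]) (intro mult_left_mono nv, use M0 in simp)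
    qed
    also have "\<dots> = 4 * M^3 / m" by (simp add: power3_eq_cube)
    finally show ?thesis .
  qed
  have nr: "L2_norm r \<le> 8 * M^2 * sqrt (pk_modulus e)"
  proof -
    \<comment> \<open>Interpolation between the supremum of \<open>r\<close> and the integral of
      \<open>F\<close>; the square root of the modulus in the final bound originates here.\<close>
    have "(LBINT x. (r x)^2) \<le> (LBINT x. (64 * M^2 * pk_modulus e) * F x)"
    proof (rule integral_mono)
      show "integrable lborel (\<lambda>x. (r x)^2)" using Lr by (simp add: L2_iff)
      show "integrable lborel (\<lambda>x. (64 * M^2 * pk_modulus e) * F x)"
        unfolding F_def by (intro integrable_mult_right conv_integral(1) kern_integrable kernel_kern e f2)
      fix x
      have "r x \<le> F x" by (simp add: r_def)
      then show "(r x)^2 \<le> (64 * M^2 * pk_modulus e) * F x"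
        unfolding power2_eq_square[of "r x"] by (intro mult_mono rsup r0 order_trans[OF r0 rsup])
    qed
    also have "\<dots> = (64 * M^2 * pk_modulus e) * (L2_norm f)^2"
      using conv_integral(2)[OF kern_integrable[OF kernel_kern(1)[OF e]] f2] pk_integral[OF e]
      by (simp add: F_def L2_norm_sq)
    also have "\<dots> \<le> (64 * M^2 * pk_modulus e) * M^2"
      using M L2_norm_nonneg pk_modulus_nonneg[OF e] by (intro mult_left_mono power_mono) auto
    also have "\<dots> = (8 * M^2 * sqrt (pk_modulus e))^2"
      using pk_modulus_nonneg[OF e] by (simp add: power_mult_distrib power2_eq_square)
    finally have "(L2_norm r)^2 \<le> (8 * M^2 * sqrt (pk_modulus e))^2" by (simp add: L2_norm_sq)
    then show ?thesis by (rule power2_le_imp_le) (simp add: pk_modulus_nonneg[OF e])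
  qed
  have K: "M * L2_norm r \<le> 8 * M^3 * sqrt (pk_modulus e)"
    using mult_left_mono[OF nr M0] by (simp add: power2_eq_square power3_eq_cube ac_simps)
  have tK1: "\<bar>K1\<bar> \<le> 8 * M^3 * sqrt (pk_modulus e)"
  proof -
    have "\<bar>K1\<bar> \<le> (1 / m) * (L2_norm v * L2_norm r)" unfolding K1_def by (rule b(2)[OF L(1) Lr wm(2) wt1b m0'])
    also have "\<dots> \<le> 1 * (M * L2_norm r)"
      using m nv M0 L2_norm_nonneg by (intro mult_mono) auto
    finally show ?thesis using K by simp
  qed
  have tK2: "\<bar>K2\<bar> \<le> 8 * M^3 * sqrt (pk_modulus e)"
  proof -
    have "\<bar>K2\<bar> \<le> 1 * (L2_norm v1 * L2_norm r)" unfolding K2_def by (rule b(2)[OF L(2) Lr wm(1) wtb one])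
    also have "\<dots> \<le> 1 * (M * L2_norm r)"
      using nv1 M0 L2_norm_nonneg by (intro mult_mono) auto
    finally show ?thesis using K by simp
  qed
  have "I = - K1 - K2 - (2/3) * J" using e1 e2 by simp
  then have "\<bar>I\<bar> \<le> \<bar>K1\<bar> + \<bar>K2\<bar> + \<bar>J\<bar>" by linarith
  then have "\<bar>I\<bar> \<le> 4 * M^3 / m + 16 * M^3 * sqrt (pk_modulus e)" using tJ tK1 tK2 by linarith
  then show "\<bar>LBINT x. wt m x * conv (pk e) f x * conv (pk1 e) (\<lambda>y. (f y)^2) x\<bar>
      \<le> 4 * M^3 / m + 16 * M^3 * sqrt (pk_modulus e)" unfolding I_def v_def F1_def .
qed

section \<open>Time evolution of the smoothed solution\<close>

lemma kern_L2: assumes "kern k" shows "L2 k"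
proof -
  obtain C where C: "\<And>z. \<bar>k z\<bar> \<le> C / (z^2 + 1)" "C \<ge> 0" by (rule kern_bound[OF assms]) blast
  show ?thesis
  proof (rule L2_bound[OF L2_cmult[OF L2_inverse_weight, of C] kern_measurable[OF assms]])
    show "\<bar>k z\<bar> \<le> \<bar>C * (1 / (z^2 + 1))\<bar>" for z using C(1)[of z] C(2) by simp
  qed
qed

lemma test_fun1_kern: assumes "test_fun1 \<theta>" shows "kern \<theta>"
proof -
  obtain B R where B: "\<And>x. \<bar>\<theta> x\<bar> \<le> B" "\<And>x. R < \<bar>x\<bar> \<Longrightarrow> \<theta> x = 0" "R > 0"
    by (rule test_fun1_bounded[OF assms]) blast
  have B0: "0 \<le> B" by (rule order_trans[OF abs_ge_zero B(1)])
  have "\<bar>\<theta> z\<bar> \<le> (B * (R^2 + 1)) / (z^2 + 1)" for z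
  proof (cases "R < \<bar>z\<bar>")
    case True
    then show ?thesis using B(2) B0 by simp
  next
    case False
    then have "z^2 \<le> R^2" using abs_le_square_iff[of z R] B(3) by simp
    then have "B * (z^2 + 1) \<le> B * (R^2 + 1)" using B0 by (intro mult_left_mono) auto
    then have "B \<le> (B * (R^2 + 1)) / (z^2 + 1)" using one_plus_square_pos[of z] by (simp add: pos_le_divide_eq)
    then show ?thesis using B(1)[of z] by linarith
  qed
  then show ?thesis unfolding kern_def using test_fun1_measurable[OF assms] by blast
qed

lemma continuous_AE_zero:
  fixes f :: "real \<Rightarrow> real"
  assumes "continuous_on UNIV f" "AE x in lborel. f x = 0" shows "f x = 0"
proof (rule ccontr)
  assume "f x \<noteq> 0"
  have op: "open {x. f x \<noteq> 0}" by (intro open_Collect_neq assms continuous_on_const)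
  then obtain d where d: "0 < d" "ball x d \<subseteq> {x. f x \<noteq> 0}"
    using \<open>f x \<noteq> 0\<close> open_contains_ball by blast
  have "AE y in lborel. y \<notin> {x<..<x+d}"
    using assms(2)
  proof eventually_elim
    case (elim y)
    then show ?case using d(2) by (auto simp: subset_iff dist_real_def)
  qed
  then have "emeasure lborel {x<..<x+d} = 0"
    by (subst (asm) AE_iff_measurable[of "{x<..<x+d}"]) auto
  then show False using d(1) by simp
qed

text \<open>A weak derivative determines the function up to a constant and a null set; continuity
  removes the null set, and the primitive of a continuous function is classically
  differentiable.\<close>

lemma weak_deriv_continuous:
  assumes a: "continuous_on UNIV a" and b: "continuous_on UNIV b" and w: "weak_deriv a b"
  shows "(a has_real_derivative b t) (at t)"
proof -
  have "isCont b x" for x using b by (simp add: continuous_on_eq_continuous_at)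
  then obtain B where B: "\<And>x. (B has_real_derivative b x) (at x)"
    using einterval_antiderivative[of "-\<infinity>" "\<infinity>" b]
    by (auto simp: has_real_derivative_iff_has_vector_derivative)
  note lb = loc_int_continuous[OF b]
  have FTC: "(LINT y:{p..q}|lborel. b y) = B q - B p" if "p \<le> q" for p q
    unfolding set_lebesgue_integral_def
    by (rule integral_FTC_atLeastAtMost[OF that has_vector_derivative_at_within[OF
          has_real_derivative_iff_has_vector_derivative[THEN iffD1, OF B]] continuous_on_subset[OF b]]) simp
  have p0: "prim b 0 = 0" by (simp add: prim_def)
  have pB: "prim b x = B x - B 0" for x
  proof (cases "0 \<le> x")
    case True
    then show ?thesis using prim_diff[OF lb True] FTC[OF True] p0 by simp
  next
    case False
    then have "x \<le> 0" by simp
    then show ?thesis using prim_diff[OF lb, of x 0] FTC[of x 0] p0 by simp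
  qed
  obtain c where c: "AE x in lborel. a x = c + prim b x"
    using weak_deriv_imp_prim[OF w loc_int_continuous[OF a] lb] by blast
  have cB: "continuous_on UNIV B" by (meson B DERIV_continuous continuous_at_imp_continuous_on)
  have "a x - (c + B x - B 0) = 0" for x
    by (rule continuous_AE_zero)
       (use c pB in \<open>auto intro!: continuous_intros a cB elim!: eventually_mono\<close>)
  then have "a = (\<lambda>x. c + B x - B 0)" by (auto simp: fun_eq_iff)
  then show ?thesis by (auto intro!: derivative_eq_intros B)
qed

text \<open>\<open>U t\<close> is the continuous representative of \<open>u(\<cdot>, t)\<close>, \<open>g t\<close> its derivative, and \<open>\<delta>\<close> stands for the
\<open>H1\<close> distance between two times.\<close>
locale bo =
  fixes u :: "real \<Rightarrow> real \<Rightarrow> real" and U g :: "real \<Rightarrow> real \<Rightarrow> real" and M :: real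
    and \<delta> :: "real \<Rightarrow> real \<Rightarrow> real"
  assumes sobU: "\<And>t. sob (U t) (g t)" and um: "\<And>t. (\<lambda>x. u x t) \<in> borel_measurable borel"
    and uU: "\<And>t. AE x in lborel. u x t = U t x"
    and nU: "\<And>t. L2_norm (U t) \<le> M" and ng: "\<And>t. L2_norm (g t) \<le> M"
    and dU: "\<And>s t. L2_norm (\<lambda>x. U s x - U t x) \<le> \<delta> s t"
    and dH: "\<And>s t x. \<bar>hilbert (\<lambda>y. u y s) x - hilbert (\<lambda>y. u y t) x\<bar> \<le> 8 * \<delta> s t"
    and d0: "\<And>t. ((\<lambda>s. \<delta> s t) \<longlongrightarrow> 0) (at t)"
    and weak: "BO_weak_solution u"
begin

abbreviation h where "h t \<equiv> hilbert (\<lambda>y. u y t)"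

lemma U_L2: "L2 (U t)"
  using sobU by (simp add: sob_def)

lemma M_nonneg: "0 \<le> M"
  using order_trans[OF L2_norm_nonneg nU] .

lemma delta_nonneg: "0 \<le> \<delta> s t"
  using order_trans[OF L2_norm_nonneg dU] .

lemma U_meas [measurable]: "U t \<in> borel_measurable borel"
  by (rule L2_meas[OF U_L2])

lemma U_sup: "\<bar>U t x\<bar> \<le> 4 * M"
  by (rule smoothing_error(2)[OF zero_less_one sobU nU ng])

lemma U_sq_int: "integrable lborel (\<lambda>x. (U t x)^2)"
  using U_L2 by (simp add: L2_iff)

lemma h_meas [measurable]: "h t \<in> borel_measurable borel"
  by (rule hilbert_measurable[OF sobU um uU])

lemma h_bound: "\<bar>h t x\<bar> \<le> 8 * M"
proof -
  have "\<bar>h t x\<bar> \<le> 4 * (L2_norm (U t) + L2_norm (g t))" by (rule hilbert_bound[OF sobU um uU])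
  also have "\<dots> \<le> 4 * (M + M)" by (intro mult_left_mono add_mono nU ng) simp
  finally show ?thesis by simp
qed

lemma h_wint: "wint (h t)"
  by (rule wint_bounded[OF h_meas h_bound])

lemma continuous_modulus:
  assumes "\<And>s t. \<bar>a s - a t\<bar> \<le> C * \<delta> s t" shows "continuous_on UNIV a"
proof (rule continuous_at_imp_continuous_on, rule ballI)
  fix t
  have "((\<lambda>s. a s - a t) \<longlongrightarrow> 0) (at t)"
  proof (rule Lim_null_comparison)
    show "\<forall>\<^sub>F s in at t. norm (a s - a t) \<le> C * \<delta> s t" using assms by (intro always_eventually allI) simp
    show "((\<lambda>s. C * \<delta> s t) \<longlongrightarrow> 0) (at t)" using tendsto_mult[OF tendsto_const d0, of C t] by simp
  qed
  then show "isCont a t" unfolding isCont_def by (rule LIM_zero_cancel)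
qed

lemma pairing_modulus:
  assumes k: "L2 k"
  shows "\<bar>(LBINT x. U s x * k x) - (LBINT x. U t x * k x)\<bar> \<le> L2_norm k * \<delta> s t"
proof -
  have "(LBINT x. U s x * k x) - (LBINT x. U t x * k x) = (LBINT x. (U s x - U t x) * k x)"
    using L2_mult_integrable[OF U_L2 k] by (simp add: left_diff_distrib)
  then have "\<bar>(LBINT x. U s x * k x) - (LBINT x. U t x * k x)\<bar> \<le> L2_norm (\<lambda>x. U s x - U t x) * L2_norm k"
    using L2_Cauchy_Schwarz[OF L2_diff[OF U_L2 U_L2] k] by simp
  also have "\<dots> \<le> \<delta> s t * L2_norm k" by (intro mult_right_mono dU L2_norm_nonneg)
  finally show ?thesis by (simp add: mult.commute)
qed

lemma square_pairing_integrable: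
  assumes "k \<in> borel_measurable borel" "\<And>x. \<bar>k x\<bar> \<le> B" "0 \<le> B"
  shows "integrable lborel (\<lambda>x. (U t x)^2 * k x)"
  using L2_mult3_bounds(1)[OF U_L2 U_L2 assms, of t t] by (simp add: power2_eq_square ac_simps)

lemma square_pairing_modulus:
  assumes k: "k \<in> borel_measurable borel" "\<And>x. \<bar>k x\<bar> \<le> B" "0 \<le> B"
  shows "\<bar>(LBINT x. (U s x)^2 * k x) - (LBINT x. (U t x)^2 * k x)\<bar> \<le> (2 * B * M) * \<delta> s t"
proof -
  note L = L2_diff[OF U_L2[of s] U_L2[of t]]
  note i1 = L2_mult3_bounds[OF L U_L2[of s] k] and i2 = L2_mult3_bounds[OF L U_L2[of t] k]
  have "(LBINT x. (U s x)^2 * k x) - (LBINT x. (U t x)^2 * k x) = (LBINT x. (U s x)^2 * k x - (U t x)^2 * k x)"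
    using square_pairing_integrable[OF k] by simp
  also have "\<dots> = (LBINT x. k x * (U s x - U t x) * U s x + k x * (U s x - U t x) * U t x)"
    by (intro Bochner_Integration.integral_cong refl) (simp add: power2_eq_square algebra_simps)
  also have "\<dots> = (LBINT x. k x * (U s x - U t x) * U s x) + (LBINT x. k x * (U s x - U t x) * U t x)"
    by (rule Bochner_Integration.integral_add[OF i1(1) i2(1)])
  finally have "\<bar>(LBINT x. (U s x)^2 * k x) - (LBINT x. (U t x)^2 * k x)\<bar> \<le> B * (L2_norm (\<lambda>x. U s x - U t x) * L2_norm (U s)) + B * (L2_norm (\<lambda>x. U s x - U t x) * L2_norm (U t))"
    using order_trans[OF abs_triangle_ineq add_mono[OF i1(2) i2(2)]] by simp
  also have "\<dots> \<le> B * (\<delta> s t * M) + B * (\<delta> s t * M)"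
  proof -
    have d: "L2_norm (\<lambda>x. U s x - U t x) * L2_norm (U r) \<le> \<delta> s t * M" for r
      by (rule mult_mono[OF dU nU delta_nonneg L2_norm_nonneg])
    show ?thesis by (rule add_mono[OF mult_left_mono[OF d k(3)] mult_left_mono[OF d k(3)]])
  qed
  also have "\<dots> = (2 * B * M) * \<delta> s t" by simp
  finally show ?thesis .
qed

lemma hilbert_pairing_modulus:
  assumes k: "kern k"
  shows "\<bar>(LBINT x. h s x * k x) - (LBINT x. h t x * k x)\<bar> \<le> (8 * (LBINT x. \<bar>k x\<bar>)) * \<delta> s t"
proof -
  have i: "integrable lborel (\<lambda>x. h t x * k x)" for t
    using kern_mult_integrable[OF k h_wint, of t] by (simp add: mult.commute)
  have "(LBINT x. h s x * k x) - (LBINT x. h t x * k x) = (LBINT x. (h s x - h t x) * k x)"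
    using i by (simp add: left_diff_distrib)
  then have "\<bar>(LBINT x. h s x * k x) - (LBINT x. h t x * k x)\<bar> \<le> (LBINT x. \<bar>(h s x - h t x) * k x\<bar>)"
    using integral_abs_bound[of lborel "\<lambda>x. (h s x - h t x) * k x"] by simp
  also have "\<dots> \<le> (LBINT x. (8 * \<delta> s t) * \<bar>k x\<bar>)"
  proof (rule integral_mono)
    show "integrable lborel (\<lambda>x. \<bar>(h s x - h t x) * k x\<bar>)"
      using i[of s] i[of t] by (simp add: left_diff_distrib)
    show "integrable lborel (\<lambda>x. (8 * \<delta> s t) * \<bar>k x\<bar>)"
      by (intro integrable_mult_right integrable_abs kern_integrable k)
    show "\<bar>(h s x - h t x) * k x\<bar> \<le> (8 * \<delta> s t) * \<bar>k x\<bar>" for x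
      unfolding abs_mult by (intro mult_right_mono dH) simp
  qed
  finally show ?thesis by (simp add: ac_simps)
qed

text \<open>The weak formulation tested with \<open>\<psi> x * \<eta> t\<close>. For fixed
  \<open>\<psi>\<close> it is an ordinary weak differential equation in time alone.\<close>

lemma test_pairing_weak_deriv:
  assumes p: "test_fun1 \<psi>"
  defines "a \<equiv> \<lambda>t. LBINT x. U t x * \<psi> x"
    and "b \<equiv> \<lambda>t. (LBINT x. h t x * deriv (deriv \<psi>) x) + (1/2) * (LBINT x. (U t x)^2 * deriv \<psi> x)"
  shows "weak_deriv a b" "continuous_on UNIV a" "continuous_on UNIV b"
proof -
  note p1 = test_fun1_deriv[OF p] and p2 = test_fun1_deriv[OF test_fun1_deriv[OF p]]
  note sp = p[unfolded test_fun1_def, THEN conjunct1]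
  obtain B R where B: "\<And>x. \<bar>deriv \<psi> x\<bar> \<le> B" "\<And>x. R < \<bar>x\<bar> \<Longrightarrow> deriv \<psi> x = 0" "R > 0"
    by (rule test_fun1_bounded[OF p1]) blast
  have B0: "0 \<le> B" by (rule order_trans[OF abs_ge_zero B(1)])
  note m1 = test_fun1_measurable[OF p1]
  have [measurable]: "\<psi> \<in> borel_measurable borel" "deriv \<psi> \<in> borel_measurable borel" "deriv (deriv \<psi>) \<in> borel_measurable borel"
    using test_fun1_measurable p p1 p2 by auto
  note [measurable] = um
  show ca: "continuous_on UNIV a"
    unfolding a_def by (rule continuous_modulus[OF pairing_modulus[OF kern_L2[OF test_fun1_kern[OF p]]]])
  have c1: "continuous_on UNIV (\<lambda>t. LBINT x. h t x * deriv (deriv \<psi>) x)"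
    by (rule continuous_modulus[OF hilbert_pairing_modulus[OF test_fun1_kern[OF p2]]])
  have c2: "continuous_on UNIV (\<lambda>t. LBINT x. (U t x)^2 * deriv \<psi> x)"
    by (rule continuous_modulus[OF square_pairing_modulus[OF m1 B(1) B0]])
  show cb: "continuous_on UNIV b" unfolding b_def by (intro continuous_intros c1 c2)
  show "weak_deriv a b"
    unfolding weak_deriv_def
  proof (intro allI impI)
    fix \<eta> assume e: "test_fun1 \<eta>"
    have se: "smooth1 \<eta>" using e by (simp add: test_fun1_def)
    have dt: "deriv (\<lambda>s. \<psi> x * \<eta> s) t = \<psi> x * deriv \<eta> t" for x t
      by (rule DERIV_imp_deriv[OF DERIV_cmult[OF smooth1_deriv(2)[OF se]]])
    have dx: "deriv (\<lambda>y. \<psi> y * \<eta> t) = (\<lambda>y. deriv \<psi> y * \<eta> t)" for t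
      using DERIV_imp_deriv[OF DERIV_cmult_right[OF smooth1_deriv(2)[OF sp]]] by auto
    have dxx: "deriv (deriv (\<lambda>y. \<psi> y * \<eta> t)) = (\<lambda>y. deriv (deriv \<psi>) y * \<eta> t)" for t
      unfolding dx using DERIV_imp_deriv[OF DERIV_cmult_right[OF smooth1_deriv(2)[OF smooth1_deriv(1)[OF sp]]]] by auto
    have ia: "integrable lborel (\<lambda>x. U t x * \<psi> x)" for t
      by (rule L2_mult_integrable[OF U_L2 kern_L2[OF test_fun1_kern[OF p]]])
    have ih: "integrable lborel (\<lambda>x. h t x * deriv (deriv \<psi>) x)" for t
      using kern_mult_integrable[OF test_fun1_kern[OF p2] h_wint, of t] by (simp add: mult.commute)
    note isq = square_pairing_integrable[OF m1 B(1) B0]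
    have inner: "(LBINT x. - u x t * deriv (\<lambda>s. \<psi> x * \<eta> s) t - h t x * deriv (deriv (\<lambda>y. \<psi> y * \<eta> t)) x
        - (u x t)^2 / 2 * deriv (\<lambda>y. \<psi> y * \<eta> t) x) = - (a t * deriv \<eta> t + b t * \<eta> t)" for t
    proof -
      have "(LBINT x. - u x t * deriv (\<lambda>s. \<psi> x * \<eta> s) t - h t x * deriv (deriv (\<lambda>y. \<psi> y * \<eta> t)) x
        - (u x t)^2 / 2 * deriv (\<lambda>y. \<psi> y * \<eta> t) x)
        = (LBINT x. (- deriv \<eta> t) * (U t x * \<psi> x) - \<eta> t * (h t x * deriv (deriv \<psi>) x) - (\<eta> t / 2) * ((U t x)^2 * deriv \<psi> x))"
        unfolding dt dx dxx
      proof (rule integral_cong_AE)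
        show "AE x in lborel. - u x t * (\<psi> x * deriv \<eta> t) - h t x * deriv (\<lambda>y. deriv \<psi> y * \<eta> t) x - (u x t)^2 / 2 * (deriv \<psi> x * \<eta> t)
          = (- deriv \<eta> t) * (U t x * \<psi> x) - \<eta> t * (h t x * deriv (deriv \<psi>) x) - (\<eta> t / 2) * ((U t x)^2 * deriv \<psi> x)"
          unfolding dxx[unfolded dx]
          using uU[of t] by eventually_elim (simp add: algebra_simps)
      qed (unfold dxx[unfolded dx], measurable)
      also have "\<dots> = (- deriv \<eta> t) * a t - \<eta> t * (LBINT x. h t x * deriv (deriv \<psi>) x) - (\<eta> t / 2) * (LBINT x. (U t x)^2 * deriv \<psi> x)"
        using ia ih isq by (simp add: a_def)
      also have "\<dots> = - (a t * deriv \<eta> t + b t * \<eta> t)" by (simp add: b_def algebra_simps)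
      finally show ?thesis .
    qed
    have "(LBINT t. - (a t * deriv \<eta> t + b t * \<eta> t)) = 0"
      using weak test_fun2_prod[OF p e] unfolding BO_weak_solution_def inner[symmetric] by blast
    moreover have "integrable lborel (\<lambda>t. a t * deriv \<eta> t)" "integrable lborel (\<lambda>t. b t * \<eta> t)"
      using loc_int_test_integrable[OF loc_int_continuous[OF ca] test_fun1_deriv[OF e]]
        loc_int_test_integrable[OF loc_int_continuous[OF cb] e] by auto
    ultimately show "(LBINT t. a t * deriv \<eta> t) = - (LBINT t. b t * \<eta> t)" by simp
  qed
qed

definition V :: "real \<Rightarrow> real \<Rightarrow> real \<Rightarrow> real" where "V e t x = conv (pk e) (U t) x"
text \<open>The right-hand side of the equation after convolution with \<open>pk e\<close>: the
  kernel \<open>qk2\<close> stands for the smoothed dispersive term, and the nonlinearity is in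
  divergence form.\<close>

definition G :: "real \<Rightarrow> real \<Rightarrow> real \<Rightarrow> real" where
  "G e t x = conv (qk2 e) (U t) x - (1/2) * conv (pk1 e) (\<lambda>y. (U t y)^2) x"

lemma V_modulus:
  assumes e: "0 < e" shows "\<bar>V e s x - V e t x\<bar> \<le> L2_norm (pk e) * \<delta> s t"
proof -
  note k = kern_L2[OF kernel_kern(1)[OF e]]
  show ?thesis
    using pairing_modulus[OF L2_translates(1)[OF k, of x], of s t] L2_translates(3)[OF k, of x]
    by (simp add: V_def conv_def mult.commute)
qed

lemma G_continuous:
  assumes e: "0 < e" shows "continuous_on UNIV (\<lambda>t. G e t x)"
proof -
  have c1: "continuous_on UNIV (\<lambda>t. conv (qk2 e) (U t) x)"
    unfolding conv_def mult.commute[of "qk2 e _"]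
    by (rule continuous_modulus[OF pairing_modulus[OF L2_translates(1)[OF kern_L2[OF kernel_kern(5)[OF e]]]]])
  obtain B where B: "\<And>z. \<bar>pk1 e z\<bar> \<le> B" by (rule kern_bounded[OF kernel_kern(2)[OF e]]) blast
  have B0: "0 \<le> B" by (rule order_trans[OF abs_ge_zero B])
  have c2: "continuous_on UNIV (\<lambda>t. conv (pk1 e) (\<lambda>y. (U t y)^2) x)"
    unfolding conv_def mult.commute[of "pk1 e _"]
    by (rule continuous_modulus[OF square_pairing_modulus[OF _ B B0]]) measurable
  show ?thesis unfolding G_def by (intro continuous_intros c1 c2)
qed

text \<open>The equation for cut-off Poisson kernels passes to the limit in its weak form in time.
  As \<open>V\<close> and \<open>G\<close> are continuous in time, the weak derivative is
  classical.\<close>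

lemma V_time_derivative:
  assumes e: "0 < e" shows "((\<lambda>t. V e t x) has_real_derivative G e t x) (at t)"
proof (rule weak_deriv_continuous)
  show cV: "continuous_on UNIV (\<lambda>t. V e t x)" by (rule continuous_modulus[OF V_modulus[OF e]])
  show cG: "continuous_on UNIV (\<lambda>t. G e t x)" by (rule G_continuous[OF e])
  note ps = pk_shift_smooth[OF e, of x]
  obtain \<theta> \<kappa> where t: "\<And>n::nat. test_fun1 (\<theta> n)" "kern \<kappa>"
    "\<And>n y. \<bar>\<theta> n y\<bar> \<le> \<kappa> y" "\<And>n y. \<bar>deriv (\<theta> n) y\<bar> \<le> \<kappa> y" "\<And>n y. \<bar>deriv (deriv (\<theta> n)) y\<bar> \<le> \<kappa> y"
    "\<And>y. (\<lambda>n. \<theta> n y) \<longlonglongrightarrow> pk e (x - y)" "\<And>y. (\<lambda>n. deriv (\<theta> n) y) \<longlonglongrightarrow> - pk1 e (x - y)"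
    "\<And>y. (\<lambda>n. deriv (deriv (\<theta> n)) y) \<longlonglongrightarrow> pk2 e (x - y)"
    by (rule test_cutoff[OF ps(1), unfolded ps(3), unfolded ps(2)]) (use ps in auto)
  note tm = test_fun1_measurable[OF t(1)] test_fun1_measurable[OF test_fun1_deriv[OF t(1)]]
    test_fun1_measurable[OF test_fun1_deriv[OF test_fun1_deriv[OF t(1)]]]
  define a where "a = (\<lambda>n t. LBINT y. U t y * \<theta> n y)"
  define b where "b = (\<lambda>n t. (LBINT y. h t y * deriv (deriv (\<theta> n)) y) + (1/2) * (LBINT y. (U t y)^2 * deriv (\<theta> n) y))"
  have ab: "weak_deriv (a n) (b n)" "continuous_on UNIV (a n)" "continuous_on UNIV (b n)" for n
    unfolding a_def b_def by (rule test_pairing_weak_deriv[OF t(1)])+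
  have la: "(\<lambda>n. a n t) \<longlonglongrightarrow> V e t x" for t
    unfolding a_def V_def conv_def mult.commute[of "pk e _"]
    by (rule dominated_kern_limit[OF t(2) wint_L2[OF U_L2] tm(1) _ t(3,6)]) measurable
  have lb: "(\<lambda>n. b n t) \<longlonglongrightarrow> G e t x" for t
  proof -
    have "(\<lambda>n. LBINT y. h t y * deriv (deriv (\<theta> n)) y) \<longlonglongrightarrow> (LBINT y. h t y * pk2 e (x - y))"
      by (rule dominated_kern_limit[OF t(2) h_wint tm(3) _ t(5,8)]) measurable
    also have "(LBINT y. h t y * pk2 e (x - y)) = conv (qk2 e) (U t) x"
      using poisson_hilbert2[OF e sobU um uU, of t x] by (simp add: conv_def mult.commute)
    finally have l1: "(\<lambda>n. LBINT y. h t y * deriv (deriv (\<theta> n)) y) \<longlonglongrightarrow> conv (qk2 e) (U t) x" .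
    have "(\<lambda>n. LBINT y. (U t y)^2 * deriv (\<theta> n) y) \<longlonglongrightarrow> (LBINT y. (U t y)^2 * (- pk1 e (x - y)))"
      by (rule dominated_kern_limit[OF t(2) wint_integrable[OF U_sq_int] tm(2) _ t(4,7)]) measurable
    also have "(LBINT y. (U t y)^2 * (- pk1 e (x - y))) = - conv (pk1 e) (\<lambda>y. (U t y)^2) x"
      by (simp add: conv_def mult.commute)
    finally have l2: "(\<lambda>n. LBINT y. (U t y)^2 * deriv (\<theta> n) y) \<longlonglongrightarrow> - conv (pk1 e) (\<lambda>y. (U t y)^2) x" .
    show ?thesis
      unfolding b_def G_def using tendsto_add[OF l1 tendsto_mult[OF tendsto_const l2, of "1/2"]] by simp
  qed
  obtain K where K: "\<And>z. \<bar>\<kappa> z\<bar> \<le> K" by (rule kern_bounded[OF t(2)]) blast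
  have K0: "0 \<le> K" by (rule order_trans[OF abs_ge_zero K])
  have kpos: "0 \<le> \<kappa> z" for z by (rule order_trans[OF abs_ge_zero t(3)])
  \<comment> \<open>This bound and the next are uniform in \<open>n\<close> and \<open>t\<close>;
    multiplied by the compactly supported \<open>\<eta>\<close> they dominate the time
    integrals.\<close>
  have ba: "\<bar>a n t\<bar> \<le> M * L2_norm \<kappa>" for n t
  proof -
    have L: "L2 (\<theta> n)" by (rule kern_L2[OF test_fun1_kern[OF t(1)]])
    have "\<bar>a n t\<bar> \<le> L2_norm (U t) * L2_norm (\<theta> n)"
      unfolding a_def by (rule L2_Cauchy_Schwarz[OF U_L2 L])
    also have "\<dots> \<le> M * L2_norm \<kappa>"
    proof (intro mult_mono nU M_nonneg L2_norm_nonneg)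
      show "L2_norm (\<theta> n) \<le> L2_norm \<kappa>"
        unfolding L2_norm_def
      proof (intro real_sqrt_le_mono integral_mono)
        show "(\<theta> n y)^2 \<le> (\<kappa> y)^2" for y using t(3)[of n y] kpos[of y] abs_le_square_iff[of "\<theta> n y" "\<kappa> y"] by simp
      qed (use L kern_L2[OF t(2)] in \<open>auto simp: L2_iff\<close>)
    qed
    finally show ?thesis .
  qed
  have bb: "\<bar>b n t\<bar> \<le> 8 * M * (LBINT y. \<kappa> y) + K * (M * M)" for n t
  proof -
    have "\<bar>LBINT y. h t y * deriv (deriv (\<theta> n)) y\<bar> \<le> (LBINT y. \<bar>h t y * deriv (deriv (\<theta> n)) y\<bar>)"
      by (rule integral_abs_bound)
    also have "\<dots> \<le> (LBINT y. (8 * M) * \<kappa> y)"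
    proof (rule integral_mono)
      show "integrable lborel (\<lambda>y. \<bar>h t y * deriv (deriv (\<theta> n)) y\<bar>)"
        using kern_mult_integrable[OF test_fun1_kern[OF test_fun1_deriv[OF test_fun1_deriv[OF t(1)]]] h_wint]
        by (intro integrable_abs) (simp add: mult.commute)
      show "integrable lborel (\<lambda>y. (8 * M) * \<kappa> y)" by (intro integrable_mult_right kern_integrable t(2))
      show "\<bar>h t y * deriv (deriv (\<theta> n)) y\<bar> \<le> (8 * M) * \<kappa> y" for y
        unfolding abs_mult using M_nonneg by (intro mult_mono h_bound t(5)) auto
    qed
    finally have b1: "\<bar>LBINT y. h t y * deriv (deriv (\<theta> n)) y\<bar> \<le> 8 * M * (LBINT y. \<kappa> y)" by simp
    have dK: "\<bar>deriv (\<theta> n) y\<bar> \<le> K" for y using t(4)[of n y] K[of y] by linarith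
    have "\<bar>LBINT y. deriv (\<theta> n) y * U t y * U t y\<bar> \<le> K * (L2_norm (U t) * L2_norm (U t))"
      by (rule L2_mult3_bounds(2)[OF U_L2 U_L2 tm(2) dK K0])
    also have "\<dots> \<le> K * (M * M)" by (intro mult_left_mono mult_mono nU M_nonneg L2_norm_nonneg K0)
    finally have b2: "\<bar>LBINT y. (U t y)^2 * deriv (\<theta> n) y\<bar> \<le> K * (M * M)"
      by (simp add: power2_eq_square ac_simps)
    have "\<bar>b n t\<bar> \<le> \<bar>LBINT y. h t y * deriv (deriv (\<theta> n)) y\<bar> + (1/2) * \<bar>LBINT y. (U t y)^2 * deriv (\<theta> n) y\<bar>"
      unfolding b_def by (rule order_trans[OF abs_triangle_ineq]) (simp add: abs_mult)
    also have "\<dots> \<le> 8 * M * (LBINT y. \<kappa> y) + 1 * (K * (M * M))"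
      by (intro add_mono mult_mono b1 b2) auto
    finally show ?thesis by simp
  qed
  show "weak_deriv (\<lambda>t. V e t x) (\<lambda>t. G e t x)"
    unfolding weak_deriv_def
  proof (intro allI impI)
    fix \<eta> assume et: "test_fun1 \<eta>"
    note em = test_fun1_measurable[OF et] test_fun1_measurable[OF test_fun1_deriv[OF et]]
    note [measurable] = em
    have [measurable]: "a n \<in> borel_measurable borel" "b n \<in> borel_measurable borel" for n
      by (rule borel_measurable_continuous_onI[OF ab(2)] borel_measurable_continuous_onI[OF ab(3)])+
    have [measurable]: "(\<lambda>t. V e t x) \<in> borel_measurable borel" "(\<lambda>t. G e t x) \<in> borel_measurable borel"
      by (rule borel_measurable_continuous_onI[OF cV] borel_measurable_continuous_onI[OF cG])+
    have A: "(\<lambda>n. LBINT t. a n t * deriv \<eta> t) \<longlonglongrightarrow> (LBINT t. V e t x * deriv \<eta> t)"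
    proof (rule integral_dominated_convergence[where w = "\<lambda>t. (M * L2_norm \<kappa>) * \<bar>deriv \<eta> t\<bar>"])
      show "integrable lborel (\<lambda>t. (M * L2_norm \<kappa>) * \<bar>deriv \<eta> t\<bar>)"
        by (intro integrable_mult_right integrable_abs kern_integrable test_fun1_kern test_fun1_deriv et)
      show "AE t in lborel. norm (a n t * deriv \<eta> t) \<le> (M * L2_norm \<kappa>) * \<bar>deriv \<eta> t\<bar>" for n
        unfolding real_norm_def abs_mult by (intro AE_I2 mult_right_mono ba) simp
      show "AE t in lborel. (\<lambda>n. a n t * deriv \<eta> t) \<longlonglongrightarrow> V e t x * deriv \<eta> t"
        by (intro AE_I2 tendsto_mult tendsto_const la)
    qed measurable
    have "(\<lambda>n. LBINT t. b n t * \<eta> t) \<longlonglongrightarrow> (LBINT t. G e t x * \<eta> t)"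
    proof (rule integral_dominated_convergence[where w = "\<lambda>t. (8 * M * (LBINT y. \<kappa> y) + K * (M * M)) * \<bar>\<eta> t\<bar>"])
      show "integrable lborel (\<lambda>t. (8 * M * (LBINT y. \<kappa> y) + K * (M * M)) * \<bar>\<eta> t\<bar>)"
        by (intro integrable_mult_right integrable_abs kern_integrable test_fun1_kern et)
      show "AE t in lborel. norm (b n t * \<eta> t) \<le> (8 * M * (LBINT y. \<kappa> y) + K * (M * M)) * \<bar>\<eta> t\<bar>" for n
        unfolding real_norm_def abs_mult by (intro AE_I2 mult_right_mono bb) simp
      show "AE t in lborel. (\<lambda>n. b n t * \<eta> t) \<longlonglongrightarrow> G e t x * \<eta> t"
        by (intro AE_I2 tendsto_mult tendsto_const lb)
    qed measurable
    then have B: "(\<lambda>n. - (LBINT t. b n t * \<eta> t)) \<longlonglongrightarrow> - (LBINT t. G e t x * \<eta> t)" by (rule tendsto_minus)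
    have E: "(LBINT t. a n t * deriv \<eta> t) = - (LBINT t. b n t * \<eta> t)" for n
      using ab(1)[of n] et by (simp add: weak_deriv_def)
    show "(LBINT t. V e t x * deriv \<eta> t) = - (LBINT t. G e t x * \<eta> t)"
      by (rule LIMSEQ_unique[OF A[unfolded E] B])
  qed
qed

end

section \<open>The weighted energy\<close>

lemma measurable_continuous_pair:
  fixes f :: "real \<times> real \<Rightarrow> real"
  assumes "continuous_on UNIV f" shows "f \<in> borel_measurable (lborel \<Otimes>\<^sub>M lborel)"
proof -
  have bm: "f \<in> borel_measurable (borel \<Otimes>\<^sub>M borel)"
    using borel_measurable_continuous_onI[OF assms] by (simp add: borel_prod)
  have eq: "sets (lborel \<Otimes>\<^sub>M lborel) = sets (borel \<Otimes>\<^sub>M (borel :: real measure) :: (real \<times> real) measure)"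
    by (intro sets_pair_measure_cong) simp_all
  show ?thesis unfolding measurable_cong_sets[OF eq refl] by (rule bm)
qed

context bo
begin

text \<open>\<open>V\<close> is Lipschitz in \<open>x\<close> with a constant independent of time
  and continuous in time for each \<open>x\<close>. Joint continuity supplies the product
  measurability required by Fubini.\<close>

lemma V_jointly_continuous:
  assumes e: "0 < e" shows "continuous_on UNIV (\<lambda>p. V e (fst p) (snd p))"
proof (rule continuous_at_imp_continuous_on, rule ballI)
  fix p :: "real \<times> real"
  define C where "C = L2_norm (pk1 e) * M"
  have lip: "\<bar>V e t x - V e t y\<bar> \<le> C * \<bar>x - y\<bar>" for t x y
  proof -
    have k: "L2 (pk1 e)" by (rule kern_L2[OF kernel_kern(2)[OF e]])
    have "\<bar>conv (pk1 e) (U t) z\<bar> \<le> C" for z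
    proof -
      have "\<bar>conv (pk1 e) (U t) z\<bar> \<le> L2_norm (\<lambda>y. pk1 e (z - y)) * L2_norm (U t)"
        unfolding conv_def by (rule L2_Cauchy_Schwarz[OF L2_translates(1)[OF k] U_L2])
      also have "\<dots> \<le> C"
        unfolding C_def L2_translates(3)[OF k] by (intro mult_left_mono nU L2_norm_nonneg)
      finally show ?thesis .
    qed
    then have "norm (conv (pk e) (U t) x - conv (pk e) (U t) y) \<le> C * norm (x - y)"
      by (intro field_differentiable_bound[OF convex_UNIV, where f' = "conv (pk1 e) (U t)"])
         (auto intro: conv_kernel_derivs(1)[OF e wint_L2[OF U_L2]])
    then show ?thesis by (simp add: V_def)
  qed
  have ct: "continuous_on UNIV (\<lambda>t. V e t x)" for x by (rule continuous_modulus[OF V_modulus[OF e]])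
  have "((\<lambda>q. V e (fst q) (snd q) - V e (fst p) (snd p)) \<longlongrightarrow> 0) (at p)"
  proof (rule Lim_null_comparison)
    have "\<bar>V e (fst q) (snd q) - V e (fst p) (snd p)\<bar> \<le> C * \<bar>snd q - snd p\<bar> + \<bar>V e (fst q) (snd p) - V e (fst p) (snd p)\<bar>" for q
      using lip[of "fst q" "snd q" "snd p"]
        abs_triangle_ineq[of "V e (fst q) (snd q) - V e (fst q) (snd p)" "V e (fst q) (snd p) - V e (fst p) (snd p)"]
      by simp
    then show "\<forall>\<^sub>F q in at p. norm (V e (fst q) (snd q) - V e (fst p) (snd p))
      \<le> C * \<bar>snd q - snd p\<bar> + \<bar>V e (fst q) (snd p) - V e (fst p) (snd p)\<bar>"
      by (intro always_eventually allI) simp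
    have "continuous_on UNIV (\<lambda>q. C * \<bar>snd q - snd p\<bar> + \<bar>V e (fst q) (snd p) - V e (fst p) (snd p)\<bar>)"
      by (intro continuous_intros continuous_on_compose2[OF ct]) auto
    then have "((\<lambda>q. C * \<bar>snd q - snd p\<bar> + \<bar>V e (fst q) (snd p) - V e (fst p) (snd p)\<bar>)
       \<longlongrightarrow> C * \<bar>snd p - snd p\<bar> + \<bar>V e (fst p) (snd p) - V e (fst p) (snd p)\<bar>) (at p)"
      by (simp only: continuous_on_eq_continuous_at[OF open_UNIV] isCont_def) (rule bspec, assumption, simp)
    then show "((\<lambda>q. C * \<bar>snd q - snd p\<bar> + \<bar>V e (fst q) (snd p) - V e (fst p) (snd p)\<bar>) \<longlongrightarrow> 0) (at p)"
      by simp
  qed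
  then show "isCont (\<lambda>q. V e (fst q) (snd q)) p" unfolding isCont_def by (rule LIM_zero_cancel)
qed

text \<open>The shift \<open>c\<close> in time serves the difference quotients from which
  measurability of \<open>G\<close> is obtained.\<close>

lemma V_measurable2:
  assumes e: "0 < e" shows "(\<lambda>p. V e (fst p + c) (snd p)) \<in> borel_measurable (lborel \<Otimes>\<^sub>M lborel)"
proof (rule measurable_continuous_pair)
  have "continuous_on UNIV (\<lambda>p::real \<times> real. (fst p + c, snd p))" by (intro continuous_intros)
  from continuous_on_compose2[OF V_jointly_continuous[OF e] this]
  show "continuous_on UNIV (\<lambda>p. V e (fst p + c) (snd p))" by simp
qed

lemma G_measurable2:
  assumes e: "0 < e" shows "(\<lambda>p. G e (fst p) (snd p)) \<in> borel_measurable (lborel \<Otimes>\<^sub>M lborel)"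
proof (rule borel_measurable_LIMSEQ_real)
  \<comment> \<open>\<open>G\<close> is a pointwise limit of difference quotients of \<open>V\<close> in time.\<close>
  have V0: "(\<lambda>p. V e (fst p) (snd p)) \<in> borel_measurable (lborel \<Otimes>\<^sub>M lborel)"
    using V_measurable2[OF e, of 0] by simp
  show "(\<lambda>p. (V e (fst p + 1 / real (Suc n)) (snd p) - V e (fst p) (snd p)) / (1 / real (Suc n))) \<in> borel_measurable (lborel \<Otimes>\<^sub>M lborel)" for n
    by (intro borel_measurable_divide borel_measurable_diff V_measurable2[OF e] V0 borel_measurable_const)
  fix p :: "real \<times> real"
  have l: "((\<lambda>h. (V e (fst p + h) (snd p) - V e (fst p) (snd p)) / h) \<longlongrightarrow> G e (fst p) (snd p)) (at 0)"
    using V_time_derivative[OF e, of "snd p" "fst p"] by (simp add: DERIV_def)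
  have "(\<lambda>n. 1 / real (Suc n)) \<longlonglongrightarrow> 0" by (rule LIMSEQ_Suc[OF lim_1_over_n])
  then have "filterlim (\<lambda>n. 1 / real (Suc n)) (at 0) sequentially"
    unfolding filterlim_at by (simp del: of_nat_Suc)
  from filterlim_compose[OF l this]
  show "(\<lambda>n. (V e (fst p + 1 / real (Suc n)) (snd p) - V e (fst p) (snd p)) / (1 / real (Suc n))) \<longlonglongrightarrow> G e (fst p) (snd p)" .
qed

lemma flux_bound:
  assumes e: "0 < e" and m: "1 \<le> m"
  shows "\<bar>LBINT x. wt m x * V e t x * G e t x\<bar> \<le> (2 * M^2 + 2 * M^3) / m + 8 * M^3 * sqrt (pk_modulus e)"
    and "integrable lborel (\<lambda>x. wt m x * V e t x * G e t x)"
proof -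
  note d = dispersion_flux_bound(1,2)[OF e m sobU nU ng, of t] and n = nonlinear_flux_bound[OF e m sobU nU ng, of t]
  have eq: "(\<lambda>x. wt m x * V e t x * G e t x) = (\<lambda>x. wt m x * conv (pk e) (U t) x * conv (qk2 e) (U t) x
     - (1/2) * (wt m x * conv (pk e) (U t) x * conv (pk1 e) (\<lambda>y. (U t y)^2) x))"
    by (rule ext) (simp add: V_def G_def algebra_simps)
  show "integrable lborel (\<lambda>x. wt m x * V e t x * G e t x)" unfolding eq using d(2) n(2) by simp
  define A where "A = (LBINT x. wt m x * conv (pk e) (U t) x * conv (qk2 e) (U t) x)"
  define B where "B = (LBINT x. wt m x * conv (pk e) (U t) x * conv (pk1 e) (\<lambda>y. (U t y)^2) x)"
  have I: "(LBINT x. wt m x * V e t x * G e t x) = A - (1/2) * B"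
    unfolding eq A_def B_def using d(2) n(2) by simp
  have A: "\<bar>A\<bar> \<le> 2 * M^2 / m" using d(1) by (simp add: A_def)
  have B: "\<bar>B\<bar> \<le> 4 * M^3 / m + 16 * M^3 * sqrt (pk_modulus e)" using n(1) by (simp add: B_def)
  have "\<bar>A - (1/2) * B\<bar> \<le> \<bar>A\<bar> + (1/2) * \<bar>B\<bar>" by linarith
  also have "\<dots> \<le> 2 * M^2 / m + (1/2) * (4 * M^3 / m + 16 * M^3 * sqrt (pk_modulus e))"
    by (intro add_mono mult_left_mono A B) simp
  also have "\<dots> = (2 * M^2 + 2 * M^3) / m + 8 * M^3 * sqrt (pk_modulus e)"
    by (simp add: add_divide_distrib)
  finally show "\<bar>LBINT x. wt m x * V e t x * G e t x\<bar> \<le> (2 * M^2 + 2 * M^3) / m + 8 * M^3 * sqrt (pk_modulus e)"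
    unfolding I .
qed

text \<open>This \<open>C\<close> may deteriorate with \<open>e\<close>, through the kernel norms
  \<open>Cq\<close> and \<open>Cp\<close>; it only has to be uniform in time to justify Fubini. The
  quantitative estimate is \<open>flux_bound\<close>.\<close>

lemma flux_abs_bound:
  assumes e: "0 < e" and m: "1 \<le> m"
  obtains C where "\<And>t. (LBINT x. \<bar>wt m x * V e t x * G e t x\<bar>) \<le> C"
proof -
  have m0: "0 < m" using m by simp
  define Cq where "Cq = (LBINT z. \<bar>qk2 e z\<bar>)"
  define Cp where "Cp = (LBINT z. \<bar>pk1 e z\<bar>)"
  have C0: "0 \<le> Cq" "0 \<le> Cp" by (auto simp: Cq_def Cp_def)
  have "(LBINT x. \<bar>wt m x * V e t x * G e t x\<bar>) \<le> M * (Cq * M) + M * (Cp * (4 * M * M))" for t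
  proof -
    have fsq: "L2 (\<lambda>y. (U t y)^2)" "L2_norm (\<lambda>y. (U t y)^2) \<le> 4 * M * M"
    proof -
      show "L2 (\<lambda>y. (U t y)^2)"
        using L2_mult_bounded[OF U_L2 U_meas U_sup, of t t] by (simp add: power2_eq_square)
      have "L2_norm (\<lambda>y. U t y * U t y) \<le> (4 * M) * L2_norm (U t)"
        by (rule L2_norm_mult_bounded[OF U_L2 U_meas U_sup]) (simp add: M_nonneg)
      also have "\<dots> \<le> 4 * M * M" by (intro mult_left_mono nU) (simp add: M_nonneg)
      finally show "L2_norm (\<lambda>y. (U t y)^2) \<le> 4 * M * M" by (simp add: power2_eq_square)
    qed
    define A where "A = conv (qk2 e) (U t)"
    define B where "B = conv (pk1 e) (\<lambda>y. (U t y)^2)"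
    have LV: "L2 (V e t)" unfolding V_def[abs_def] by (rule conv_L2(1)[OF kernel_kern(1)[OF e] U_L2])
    have nV: "L2_norm (V e t) \<le> M"
      using dispersion_flux_bound(3)[OF e m sobU nU ng, of t] by (simp add: V_def[abs_def])
    have LA: "L2 A" and LB: "L2 B" unfolding A_def B_def
      by (rule conv_L2(1)[OF kernel_kern(5)[OF e] U_L2] conv_L2(1)[OF kernel_kern(2)[OF e] fsq(1)])+
    have nA: "L2_norm A \<le> Cq * M"
      unfolding A_def Cq_def
      by (rule order_trans[OF conv_L2(2)[OF kernel_kern(5)[OF e] U_L2]]) (intro mult_left_mono nU, simp)
    have nB: "L2_norm B \<le> Cp * (4 * M * M)"
      unfolding B_def Cp_def
      by (rule order_trans[OF conv_L2(2)[OF kernel_kern(2)[OF e] fsq(1)]]) (intro mult_left_mono fsq(2), simp)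
    have bd: "(LBINT x. \<bar>V e t x\<bar> * \<bar>Z x\<bar>) \<le> M * N" if "L2 Z" "L2_norm Z \<le> N" for Z N
    proof -
      have "(LBINT x. \<bar>V e t x\<bar> * \<bar>Z x\<bar>) \<le> L2_norm (V e t) * L2_norm Z"
        using L2_Cauchy_Schwarz[OF L2_abs(1)[OF LV] L2_abs(1)[OF that(1)]]
        unfolding L2_abs(2) by (rule order_trans[OF abs_ge_self])
      also have "\<dots> \<le> M * N" by (intro mult_mono nV that(2) M_nonneg L2_norm_nonneg)
      finally show ?thesis .
    qed
    have iZ: "integrable lborel (\<lambda>x. \<bar>V e t x\<bar> * \<bar>Z x\<bar>)" if "L2 Z" for Z
      by (rule L2_mult_integrable[OF L2_abs(1)[OF LV] L2_abs(1)[OF that]])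
    have "(LBINT x. \<bar>wt m x * V e t x * G e t x\<bar>) \<le> (LBINT x. \<bar>V e t x\<bar> * \<bar>A x\<bar> + \<bar>V e t x\<bar> * \<bar>B x\<bar>)"
    proof (rule integral_mono)
      show "integrable lborel (\<lambda>x. \<bar>wt m x * V e t x * G e t x\<bar>)"
        by (rule integrable_abs[OF flux_bound(2)[OF e m]])
      show "integrable lborel (\<lambda>x. \<bar>V e t x\<bar> * \<bar>A x\<bar> + \<bar>V e t x\<bar> * \<bar>B x\<bar>)"
        by (intro Bochner_Integration.integrable_add iZ LA LB)
      fix x
      have "\<bar>G e t x\<bar> \<le> \<bar>A x\<bar> + \<bar>B x\<bar>"
        unfolding G_def A_def[symmetric] B_def[symmetric] by linarith
      then have "\<bar>V e t x\<bar> * \<bar>G e t x\<bar> \<le> \<bar>V e t x\<bar> * (\<bar>A x\<bar> + \<bar>B x\<bar>)" by (rule mult_left_mono) simp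
      moreover have "\<bar>wt m x\<bar> * (\<bar>V e t x\<bar> * \<bar>G e t x\<bar>) \<le> \<bar>V e t x\<bar> * \<bar>G e t x\<bar>"
        using wt_props(2,3)[OF m0, of x] by (intro mult_left_le_one_le) auto
      ultimately show "\<bar>wt m x * V e t x * G e t x\<bar> \<le> \<bar>V e t x\<bar> * \<bar>A x\<bar> + \<bar>V e t x\<bar> * \<bar>B x\<bar>"
        unfolding abs_mult distrib_left mult.assoc by (rule order_trans[rotated])
    qed
    also have "\<dots> = (LBINT x. \<bar>V e t x\<bar> * \<bar>A x\<bar>) + (LBINT x. \<bar>V e t x\<bar> * \<bar>B x\<bar>)"
      by (rule Bochner_Integration.integral_add[OF iZ[OF LA] iZ[OF LB]])
    also have "\<dots> \<le> M * (Cq * M) + M * (Cp * (4 * M * M))"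
      by (rule add_mono[OF bd[OF LA nA] bd[OF LB nB]])
    finally show ?thesis .
  qed
  then show ?thesis by (rule that)
qed

text \<open>For each \<open>x\<close> the derivative of \<open>V^2\<close> in time is
  \<open>2 V G\<close>. It is integrated over \<open>[0, T]\<close> at fixed \<open>x\<close>, and
  Fubini turns the result into the time integral of the flux.\<close>

lemma V_energy_increment:
  assumes e: "0 < e" and m: "1 \<le> m" and T: "0 \<le> T"
  shows "(LBINT x. wt m x * (V e T x)^2) \<le> (LBINT x. wt m x * (V e 0 x)^2)
     + 2 * T * ((2 * M^2 + 2 * M^3) / m + 8 * M^3 * sqrt (pk_modulus e))"
proof -
  have m0: "0 < m" using m by simp
  define Q where "Q = (2 * M^2 + 2 * M^3) / m + 8 * M^3 * sqrt (pk_modulus e)"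
  define K where "K = (\<lambda>t x. indicator {0..T} t * (2 * (wt m x * V e t x * G e t x)))"
  note [measurable] = V_measurable2[OF e, of 0, simplified] G_measurable2[OF e]
  have Km: "case_prod K \<in> borel_measurable (lborel \<Otimes>\<^sub>M lborel)"
    unfolding K_def case_prod_beta by measurable
  obtain C where C: "\<And>t. (LBINT x. \<bar>wt m x * V e t x * G e t x\<bar>) \<le> C" by (rule flux_abs_bound[OF e m]) blast
  have iK: "integrable (lborel \<Otimes>\<^sub>M lborel) (case_prod K)"
  proof (rule lborel_pair.Fubini_integrable[OF Km])
    show "integrable lborel (\<lambda>t. LBINT x. norm (case_prod K (t, x)))"
    proof (rule Bochner_Integration.integrable_bound[OF integrable_mult_right[OF integrable_indicator_Icc[of 0 T], of "2 * C"]])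
      show "(\<lambda>t. LBINT x. norm (case_prod K (t, x))) \<in> borel_measurable lborel" using Km by measurable
      have "(LBINT x. norm (case_prod K (t, x))) = indicator {0..T} t * (2 * (LBINT x. \<bar>wt m x * V e t x * G e t x\<bar>))" for t
        unfolding K_def by (simp add: abs_mult)
      then have "(LBINT x. norm (case_prod K (t, x))) \<le> 2 * C * indicator {0..T} t" for t
        using C[of t] by (auto simp: indicator_def)
      then show "AE t in lborel. norm (LBINT x. norm (case_prod K (t, x))) \<le> norm (2 * C * indicator {0..T} t)"
        by (intro AE_I2) (auto intro: order_trans[OF _ abs_ge_self])
    qed
    show "AE t in lborel. integrable lborel (\<lambda>x. case_prod K (t, x))"
      using flux_bound(2)[OF e m] by (simp add: K_def)
  qed
  have time: "(LBINT t. K t x) = wt m x * (V e T x)^2 - wt m x * (V e 0 x)^2" for x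
  proof -
    have d: "((\<lambda>t. wt m x * (V e t x)^2) has_real_derivative 2 * (wt m x * V e t x * G e t x)) (at t)" for t
      by (rule derivative_eq_intros V_time_derivative[OF e] refl)+ (simp add: power2_eq_square)
    have c: "continuous_on UNIV (\<lambda>t. 2 * (wt m x * V e t x * G e t x))"
      by (intro continuous_intros G_continuous[OF e] continuous_modulus[OF V_modulus[OF e]])
    have "(LBINT t. indicator {0..T} t *\<^sub>R (2 * (wt m x * V e t x * G e t x))) = wt m x * (V e T x)^2 - wt m x * (V e 0 x)^2"
      by (rule integral_FTC_atLeastAtMost[OF T has_vector_derivative_at_within[OF
          has_real_derivative_iff_has_vector_derivative[THEN iffD1, OF d]] continuous_on_subset[OF c]]) simp
    then show ?thesis by (simp add: K_def)
  qed
  have iV: "integrable lborel (\<lambda>x. wt m x * (V e t x)^2)" for t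
  proof -
    have LV: "L2 (V e t)" unfolding V_def[abs_def] by (rule conv_L2(1)[OF kernel_kern(1)[OF e] U_L2])
    have wb: "\<bar>wt m x\<bar> \<le> 1" for x using wt_props(2,3)[OF m0, of x] by simp
    show ?thesis using L2_mult3_bounds(1)[OF LV LV wt_measurable(1) wb zero_le_one]
      by (simp add: power2_eq_square mult.assoc)
  qed
  have "(LBINT x. wt m x * (V e T x)^2) - (LBINT x. wt m x * (V e 0 x)^2) = (LBINT x. (LBINT t. K t x))"
    unfolding time using iV by simp
  also have "\<dots> = (LBINT t. (LBINT x. K t x))" by (rule lborel_pair.Fubini_integral[OF iK])
  also have "\<dots> \<le> (LBINT t. (2 * Q) * indicator {0..T} t)"
  proof (rule integral_mono)
    show "integrable lborel (\<lambda>t. LBINT x. K t x)"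
      using lborel_pair.integrable_fst'[OF iK] by simp
    show "integrable lborel (\<lambda>t. (2 * Q) * indicator {0..T} t)"
      by (intro integrable_mult_right integrable_indicator_Icc)
    show "(LBINT x. K t x) \<le> (2 * Q) * indicator {0..T} t" for t
    proof -
      have "(LBINT x. K t x) = indicator {0..T} t * (2 * (LBINT x. wt m x * V e t x * G e t x))"
        unfolding K_def by simp
      moreover have "(LBINT x. wt m x * V e t x * G e t x) \<le> Q"
        unfolding Q_def by (rule order_trans[OF abs_ge_self flux_bound(1)[OF e m]])
      ultimately show ?thesis by (auto simp: indicator_def)
    qed
  qed
  also have "\<dots> = 2 * T * Q" using T by simp
  finally show ?thesis unfolding Q_def by simp
qed

section \<open>Smoothing and the initial weighted energy\<close>

lemma wt_poisson_le:
  assumes e: "0 < e" and m: "0 < m"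
  shows "(LBINT x. wt m x * pk e (x - y)) \<le> wt m y + e / m"
proof -
  define q where "q = m + e"
  have q: "0 < q" "m \<le> q" using e m by (auto simp: q_def)
  have ipk: "integrable lborel (\<lambda>x. pk e (x - y))"
    using lborel_integrable_real_affine[OF kern_integrable[OF kernel_kern(1)[OF e]], of 1 "-y"] by simp
  have one: "(LBINT x. pk e (x - y)) = 1"
    using lborel_integral_real_affine[of 1 "pk e" "-y"] pk_integral[OF e] by simp
  have "wt m x * pk e (x - y) = pk e (x - y) - (pi * m) * (pk m x * pk e (x - y))" for x
  proof -
    have "m^2 / (x^2 + m^2) = pi * m * pk m x" by (simp add: pk_def power2_eq_square)
    then show ?thesis unfolding wt_props(1)[OF m] by (simp add: algebra_simps)
  qed
  \<comment> \<open>The complement of the weight is \<open>pi * m * pk m\<close>, so the semigroup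
    law computes its Poisson average exactly, at height \<open>q = m + e\<close>.\<close>
  then have "(LBINT x. wt m x * pk e (x - y)) = 1 - pi * m * pk q y"
    using ipk pk_semigroup[OF e m, of y] one by (simp add: q_def)
  also have "\<dots> = (y^2 + q * e) / (y^2 + q^2)"
  proof -
    have D: "0 < y^2 + q^2" by (rule kernel_denom(1)[OF q(1)])
    have "pi * m * pk q y = m * q / (y^2 + q^2)" by (simp add: pk_def)
    moreover have "y^2 + q * e = (y^2 + q^2) - m * q" by (simp add: q_def power2_eq_square algebra_simps)
    moreover have "(y^2 + q^2) / (y^2 + q^2) = 1" using D by (intro divide_self) linarith
    ultimately show ?thesis by (simp only: diff_divide_distrib)
  qed
  also have "\<dots> = y^2 / (y^2 + q^2) + q * e / (y^2 + q^2)" by (rule add_divide_distrib)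
  also have "\<dots> \<le> wt m y + e / m"
  proof (rule add_mono)
    have "m^2 \<le> q^2" using q m by (intro power_mono) auto
    then show "y^2 / (y^2 + q^2) \<le> wt m y"
      unfolding wt_def using kernel_denom(1)[OF m, of y] kernel_denom(1)[OF q(1), of y]
      by (intro divide_left_mono mult_pos_pos) auto
    have "q * e / (y^2 + q^2) \<le> q * e / q^2"
      using q e kernel_denom(1)[OF q(1), of y] by (intro divide_left_mono mult_pos_pos) auto
    also have "\<dots> = e / q" using q by (simp add: power2_eq_square)
    also have "\<dots> \<le> e / m" using q m e by (intro divide_left_mono) auto
    finally show "q * e / (y^2 + q^2) \<le> e / m" .
  qed
  finally show ?thesis .
qed

lemma wt_U_integrable: "0 < m \<Longrightarrow> integrable lborel (\<lambda>x. wt m x * (U t x)^2)"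
proof -
  assume m: "0 < m"
  have wb: "\<bar>wt m x\<bar> \<le> 1" for x using wt_props(2,3)[OF m, of x] by simp
  show ?thesis using L2_mult3_bounds(1)[OF U_L2 U_L2 wt_measurable(1) wb zero_le_one, of t t]
    by (simp add: power2_eq_square mult.assoc)
qed

text \<open>Jensen's inequality puts the square inside the average, and the kernel is then
  transferred to the weight, which changes by at most \<open>e / m\<close>.\<close>

lemma V_initial_energy:
  assumes e: "0 < e" and m: "0 < m"
  shows "(LBINT x. wt m x * (V e t x)^2) \<le> (LBINT x. wt m x * (U t x)^2) + e / m * M^2"
proof -
  note kp = kern_integrable[OF kernel_kern(1)[OF e]]
  have wb: "\<bar>wt m x\<bar> \<le> 1" for x using wt_props(2,3)[OF m, of x] by simp
  have LV: "L2 (V e t)" unfolding V_def[abs_def] by (rule conv_L2(1)[OF kernel_kern(1)[OF e] U_L2])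
  have "(LBINT x. wt m x * (V e t x)^2) \<le> (LBINT x. wt m x * conv (pk e) (\<lambda>y. (U t y)^2) x)"
  proof (rule integral_mono)
    show "integrable lborel (\<lambda>x. wt m x * (V e t x)^2)"
      using L2_mult3_bounds(1)[OF LV LV wt_measurable(1) wb zero_le_one] by (simp add: power2_eq_square mult.assoc)
    show "integrable lborel (\<lambda>x. wt m x * conv (pk e) (\<lambda>y. (U t y)^2) x)"
    proof (rule Bochner_Integration.integrable_bound[OF conv_integral(1)[OF kp U_sq_int]])
      show "(\<lambda>x. wt m x * conv (pk e) (\<lambda>y. (U t y)^2) x) \<in> borel_measurable lborel"
        using borel_measurable_integrable[OF conv_integral(1)[OF kp U_sq_int]] by measurable
      show "AE x in lborel. norm (wt m x * conv (pk e) (\<lambda>y. (U t y)^2) x) \<le> norm (conv (pk e) (\<lambda>y. (U t y)^2) x)"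
        unfolding real_norm_def abs_mult using wb by (intro AE_I2 mult_left_le_one_le) auto
    qed
    show "wt m x * (V e t x)^2 \<le> wt m x * conv (pk e) (\<lambda>y. (U t y)^2) x" for x
      unfolding V_def by (intro mult_left_mono conv_pk_square_le[OF e U_L2] wt_props(2)[OF m])
  qed
  also have "\<dots> = (LBINT y. (U t y)^2 * (LBINT x. wt m x * pk e (x - y)))"
    by (rule conv_adjoint[OF kp U_sq_int wt_measurable(1) wb])
  also have "\<dots> \<le> (LBINT y. wt m y * (U t y)^2 + e / m * (U t y)^2)"
  proof (rule integral_mono)
    have W: "0 \<le> (LBINT x. wt m x * pk e (x - y))" for y
      by (intro integral_nonneg_AE AE_I2 mult_nonneg_nonneg wt_props(2)[OF m] pk_nonneg[OF e])
    show i: "integrable lborel (\<lambda>y. wt m y * (U t y)^2 + e / m * (U t y)^2)"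
      by (intro Bochner_Integration.integrable_add wt_U_integrable m integrable_mult_right U_sq_int)
    show le: "(U t y)^2 * (LBINT x. wt m x * pk e (x - y)) \<le> wt m y * (U t y)^2 + e / m * (U t y)^2" for y
      using mult_left_mono[OF wt_poisson_le[OF e m, of y], of "(U t y)^2"] by (simp add: algebra_simps)
    show "integrable lborel (\<lambda>y. (U t y)^2 * (LBINT x. wt m x * pk e (x - y)))"
    proof (rule Bochner_Integration.integrable_bound[OF i])
      show "(\<lambda>y. (U t y)^2 * (LBINT x. wt m x * pk e (x - y))) \<in> borel_measurable lborel" by measurable
      have "0 \<le> (U t y)^2 * (LBINT x. wt m x * pk e (x - y))" for y
        by (intro mult_nonneg_nonneg W) simp
      then show "AE y in lborel. norm ((U t y)^2 * (LBINT x. wt m x * pk e (x - y))) \<le> norm (wt m y * (U t y)^2 + e / m * (U t y)^2)"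
        unfolding real_norm_def using le by (intro AE_I2) (smt (verit))
    qed
  qed
  also have "\<dots> = (LBINT y. wt m y * (U t y)^2) + e / m * (L2_norm (U t))^2"
    using wt_U_integrable[OF m, of t] U_sq_int[of t] by (simp add: L2_norm_sq)
  also have "\<dots> \<le> (LBINT y. wt m y * (U t y)^2) + e / m * M^2"
    using e m nU[of t] L2_norm_nonneg by (intro add_left_mono mult_left_mono power_mono) auto
  finally show ?thesis .
qed

section \<open>Removal of the smoothing\<close>

lemma V_tendsto: "(\<lambda>n. V (1 / real (Suc n)) t x) \<longlonglongrightarrow> U t x"
proof -
  have "(\<lambda>n. (V (1 / real (Suc n)) t x - U t x)^2) \<longlonglongrightarrow> 0"
  proof (rule Lim_null_comparison)
    show "\<forall>\<^sub>F n in sequentially. norm ((V (1 / real (Suc n)) t x - U t x)^2) \<le> 64 * M^2 * pk_modulus (1 / real (Suc n))"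
    proof (intro always_eventually allI)
      fix n
      have e: "0 < 1 / real (Suc n)" by simp
      show "norm ((V (1 / real (Suc n)) t x - U t x)^2) \<le> 64 * M^2 * pk_modulus (1 / real (Suc n))"
        using smoothing_error(1)[OF e sobU nU ng, of t x] conv_pk_square_le[OF e U_L2, of t x] by (simp add: V_def)
    qed
    show "(\<lambda>n. 64 * M^2 * pk_modulus (1 / real (Suc n))) \<longlonglongrightarrow> 0"
      using tendsto_mult[OF tendsto_const pk_modulus_tendsto, of "64 * M^2"] by simp
  qed
  then have "(\<lambda>n. sqrt ((V (1 / real (Suc n)) t x - U t x)^2)) \<longlonglongrightarrow> sqrt 0" by (rule tendsto_real_sqrt)
  then have "(\<lambda>n. V (1 / real (Suc n)) t x - U t x) \<longlonglongrightarrow> 0" by (simp add: tendsto_rabs_zero_iff)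
  then show ?thesis by (rule LIM_zero_cancel)
qed

text \<open>At time \<open>T\<close> only an upper bound is wanted, so Fatou's lemma and pointwise
  convergence suffice; at time \<open>0\<close> the smoothed energy was already compared with the
  unsmoothed one.\<close>

lemma energy_estimate:
  assumes m: "1 \<le> m" and T: "0 \<le> T"
  shows "(LBINT x. wt m x * (U T x)^2) \<le> (LBINT x. wt m x * (U 0 x)^2) + (4 * M^2 + 4 * M^3) * (T / m)"
proof -
  have m0: "0 < m" using m by simp
  define E where "E = (\<lambda>n. 1 / real (Suc n))"
  have E: "0 < E n" for n by (simp add: E_def)
  define I0 where "I0 = (LBINT x. wt m x * (U 0 x)^2)"
  have I0: "0 \<le> I0" unfolding I0_def by (intro integral_nonneg_AE AE_I2 mult_nonneg_nonneg wt_props(2)[OF m0]) simp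
  define A where "A = (\<lambda>n. (I0 + E n / m * M^2) + 2 * T * ((2 * M^2 + 2 * M^3) / m + 8 * M^3 * sqrt (pk_modulus (E n))))"
  define L where "L = I0 + (4 * M^2 + 4 * M^3) * (T / m)"
  have Elim: "E \<longlonglongrightarrow> 0" unfolding E_def by (rule LIMSEQ_Suc[OF lim_1_over_n])
  have Plim: "(\<lambda>n. pk_modulus (E n)) \<longlonglongrightarrow> 0" unfolding E_def by (rule pk_modulus_tendsto)
  have Vlim: "(\<lambda>n. V (E n) T x) \<longlonglongrightarrow> U T x" for x unfolding E_def by (rule V_tendsto)
  have Alim: "A \<longlonglongrightarrow> L"
  proof -
    have "A \<longlonglongrightarrow> (I0 + 0 / m * M^2) + 2 * T * ((2 * M^2 + 2 * M^3) / m + 8 * M^3 * sqrt 0)"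
      unfolding A_def using m0
      by (intro tendsto_intros Elim tendsto_real_sqrt Plim) auto
    also have "(I0 + 0 / m * M^2) + 2 * T * ((2 * M^2 + 2 * M^3) / m + 8 * M^3 * sqrt 0) = L"
      using m0 by (simp add: L_def field_simps)
    finally show ?thesis .
  qed
  have L0: "0 \<le> L" unfolding L_def using I0 M_nonneg T m0 by (intro add_nonneg_nonneg mult_nonneg_nonneg) auto
  have le: "(LBINT x. wt m x * (V (E n) T x)^2) \<le> A n" for n
    using V_energy_increment[OF E m T, of n] V_initial_energy[OF E m0, of n 0] by (simp add: A_def I0_def)
  have nn: "(\<integral>\<^sup>+x. ennreal (wt m x * (V (E n) T x)^2) \<partial>lborel) \<le> ennreal (A n)" for n
  proof -
    have LV: "L2 (V (E n) T)" unfolding V_def[abs_def] by (rule conv_L2(1)[OF kernel_kern(1)[OF E] U_L2])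
    have wb: "\<bar>wt m x\<bar> \<le> 1" for x using wt_props(2,3)[OF m0, of x] by simp
    have "integrable lborel (\<lambda>x. wt m x * (V (E n) T x)^2)"
      using L2_mult3_bounds(1)[OF LV LV wt_measurable(1) wb zero_le_one] by (simp add: power2_eq_square mult.assoc)
    then have "(\<integral>\<^sup>+x. ennreal (wt m x * (V (E n) T x)^2) \<partial>lborel) = ennreal (LBINT x. wt m x * (V (E n) T x)^2)"
      by (rule nn_integral_eq_integral) (intro AE_I2 mult_nonneg_nonneg wt_props(2)[OF m0] zero_le_power2)
    then show ?thesis using le[of n] by (simp add: ennreal_leI)
  qed
  have Vm: "V (E n) T \<in> borel_measurable borel" for n
    unfolding V_def[abs_def] by (rule L2_meas[OF conv_L2(1)[OF kernel_kern(1)[OF E] U_L2]])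
  have "ennreal (LBINT x. wt m x * (U T x)^2) = (\<integral>\<^sup>+x. ennreal (wt m x * (U T x)^2) \<partial>lborel)"
    by (rule nn_integral_eq_integral[OF wt_U_integrable[OF m0], symmetric])
       (intro AE_I2 mult_nonneg_nonneg wt_props(2)[OF m0] zero_le_power2)
  also have "\<dots> = (\<integral>\<^sup>+x. liminf (\<lambda>n. ennreal (wt m x * (V (E n) T x)^2)) \<partial>lborel)"
  proof (rule nn_integral_cong)
    fix x
    have "(\<lambda>n. ennreal (wt m x * (V (E n) T x)^2)) \<longlonglongrightarrow> ennreal (wt m x * (U T x)^2)"
      by (intro tendsto_ennrealI tendsto_mult tendsto_const tendsto_power Vlim)
    then show "ennreal (wt m x * (U T x)^2) = liminf (\<lambda>n. ennreal (wt m x * (V (E n) T x)^2))"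
      by (simp add: lim_imp_Liminf)
  qed
  also have "\<dots> \<le> liminf (\<lambda>n. \<integral>\<^sup>+x. ennreal (wt m x * (V (E n) T x)^2) \<partial>lborel)"
    by (rule nn_integral_liminf) (use Vm in measurable)
  also have "\<dots> \<le> liminf (\<lambda>n. ennreal (A n))"
    by (rule Liminf_mono) (simp add: nn)
  also have "\<dots> = ennreal L"
    by (rule lim_imp_Liminf) (auto intro: tendsto_ennrealI Alim)
  finally show ?thesis using L0 unfolding L_def I0_def by (simp add: ennreal_le_iff)
qed

lemma left_mass_bound:
  assumes m: "1 \<le> m" and T: "0 \<le> T"
  shows "(LINT x:{..- m}|lborel. (u x T)^2) \<le> 2 * ((LBINT x. wt m x * (U 0 x)^2) + (4 * M^2 + 4 * M^3) * (T / m))"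
proof -
  have m0: "0 < m" using m by simp
  note [measurable] = um
  have "(LINT x:{..- m}|lborel. (u x T)^2) = (LBINT x. indicator {..- m} x * (U T x)^2)"
    unfolding set_lebesgue_integral_def real_scaleR_def
  proof (rule integral_cong_AE)
    show "AE x in lborel. indicator {..- m} x * (u x T)^2 = indicator {..- m} x * (U T x)^2"
      using uU[of T] by eventually_elim simp
  qed measurable
  also have "\<dots> \<le> (LBINT x. 2 * (wt m x * (U T x)^2))"
  proof (rule integral_mono)
    show "integrable lborel (\<lambda>x. indicator {..- m} x * (U T x)^2)"
      using integrable_mult_indicator[OF _ U_sq_int, of "{..- m}" T] by simp
    show "integrable lborel (\<lambda>x. 2 * (wt m x * (U T x)^2))" by (intro integrable_mult_right wt_U_integrable m0)
    fix x
    show "indicator {..- m} x * (U T x)^2 \<le> 2 * (wt m x * (U T x)^2)"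
    proof (cases "x \<le> - m")
      case True
      then have "m^2 \<le> x^2" using m0 abs_le_square_iff[of m x] by simp
      then have "1 \<le> 2 * wt m x" unfolding wt_def using kernel_denom(1)[OF m0, of x] by (simp add: pos_le_divide_eq)
      from mult_right_mono[OF this zero_le_power2[of "U T x"]] show ?thesis using True by simp
    qed (simp add: wt_props(2)[OF m0])
  qed
  also have "\<dots> = 2 * (LBINT x. wt m x * (U T x)^2)" by (rule integral_mult_right_zero)
  also have "\<dots> \<le> 2 * ((LBINT x. wt m x * (U 0 x)^2) + (4 * M^2 + 4 * M^3) * (T / m))"
    by (intro mult_left_mono energy_estimate m T) simp
  finally show ?thesis .
qed

lemma wt_energy_tendsto: "((\<lambda>m. LBINT x. wt m x * (U 0 x)^2) \<longlongrightarrow> 0) at_top"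
proof -
  have "((\<lambda>m. LBINT x. wt m x * (U 0 x)^2) \<longlongrightarrow> (\<integral>x. 0 \<partial>(lborel :: real measure))) at_top"
  proof (rule integral_dominated_convergence_at_top[where w = "\<lambda>x. (U 0 x)^2"])
    show "integrable lborel (\<lambda>x. (U 0 x)^2)" by (rule U_sq_int)
    show "AE x in lborel. ((\<lambda>m. wt m x * (U 0 x)^2) \<longlongrightarrow> 0) at_top"
    proof (rule AE_I2)
      fix x :: real
      have "((\<lambda>m. wt m x) \<longlongrightarrow> 0) at_top" unfolding wt_def by real_asymp
      from tendsto_mult[OF this tendsto_const[of "(U 0 x)^2"]]
      show "((\<lambda>m. wt m x * (U 0 x)^2) \<longlongrightarrow> 0) at_top" by simp
    qed
    show "\<forall>\<^sub>F m in at_top. AE x in lborel. norm (wt m x * (U 0 x)^2) \<le> (U 0 x)^2"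
      using eventually_gt_at_top[of 0]
    proof eventually_elim
      case (elim m)
      show ?case using wt_props(2,3)[OF elim] by (intro AE_I2) (simp add: abs_mult mult_left_le_one_le)
    qed
  qed measurable
  then show ?thesis by simp
qed

end

lemma bo_solution_locale:
  assumes C: "C_Linf_H1 u" and w: "BO_weak_solution u"
  obtains U g M where "bo u U g M (\<lambda>s t. H1_norm (\<lambda>x. u x s - u x t))"
proof -
  define d where "d = (\<lambda>s t. H1_norm (\<lambda>x. u x s - u x t))"
  have H: "H1 (\<lambda>x. u x t)" for t using C by (simp add: C_Linf_H1_def)
  then have um: "(\<lambda>x. u x t) \<in> borel_measurable borel" for t by (simp add: H1_def L2_iff)
  obtain M where M: "\<And>t. H1_norm (\<lambda>x. u x t) \<le> M" using C unfolding C_Linf_H1_def by blast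
  have "\<forall>t. \<exists>p. sob (fst p) (snd p) \<and> (AE x in lborel. u x t = fst p x) \<and> L2_norm (fst p) \<le> M \<and> L2_norm (snd p) \<le> M"
  proof
    fix t
    obtain F g where F: "sob F g" "AE x in lborel. u x t = F x" "L2_norm F \<le> H1_norm (\<lambda>x. u x t)" "L2_norm g \<le> H1_norm (\<lambda>x. u x t)"
      by (rule H1_norm_representative[OF H])
    show "\<exists>p. sob (fst p) (snd p) \<and> (AE x in lborel. u x t = fst p x) \<and> L2_norm (fst p) \<le> M \<and> L2_norm (snd p) \<le> M"
      by (rule exI[of _ "(F, g)"]) (simp add: F(1,2) order_trans[OF F(3) M] order_trans[OF F(4) M])
  qed
  from choice[OF this] obtain P where P: "\<And>t. sob (fst (P t)) (snd (P t)) \<and> (AE x in lborel. u x t = fst (P t) x)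
      \<and> L2_norm (fst (P t)) \<le> M \<and> L2_norm (snd (P t)) \<le> M" by auto
  define U where "U = (\<lambda>t. fst (P t))"
  define g where "g = (\<lambda>t. snd (P t))"
  have U: "sob (U t) (g t)" "AE x in lborel. u x t = U t x" "L2_norm (U t) \<le> M" "L2_norm (g t) \<le> M" for t
    using P[of t] by (simp_all add: U_def g_def)
  have "bo u U g M d"
  proof (rule bo.intro)
    fix s t
    \<comment> \<open>The norm of the difference involves its own choice of weak derivative, which
      need not be the difference of the chosen ones. Hence the difference gets its own
      representative, tied to \<open>U s - U t\<close> only almost everywhere.\<close>
    obtain F f where F: "sob F f" "AE x in lborel. u x s - u x t = F x" "L2_norm F \<le> d s t" "L2_norm f \<le> d s t"
      unfolding d_def by (rule H1_norm_representative[OF H1_diff[OF H H]])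
    have ae: "AE x in lborel. U s x - U t x = F x"
      using U(2)[of s] U(2)[of t] F(2) by eventually_elim simp
    have "L2 (\<lambda>x. U s x - U t x)" "L2 F" using U(1) F(1) by (auto simp: sob_def intro: L2_diff)
    then have "L2_norm (\<lambda>x. U s x - U t x) = L2_norm F" by (rule L2_norm_cong_AE) (rule ae)
    then show "L2_norm (\<lambda>x. U s x - U t x) \<le> d s t" using F(3) by simp
    fix x
    have "hilbert (\<lambda>y. u y s) x - hilbert (\<lambda>y. u y t) x = hilbert (\<lambda>y. u y s - u y t) x"
      by (rule hilbert_sob_diff[OF U(1) um U(2) U(1) um U(2), symmetric])
    moreover have "\<bar>hilbert (\<lambda>y. u y s - u y t) x\<bar> \<le> 4 * (L2_norm F + L2_norm f)"
      by (rule hilbert_bound[OF F(1) borel_measurable_diff[OF um um] F(2)])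
    moreover have "4 * (L2_norm F + L2_norm f) \<le> 4 * (d s t + d s t)"
      by (intro mult_left_mono add_mono F) simp
    ultimately show "\<bar>hilbert (\<lambda>y. u y s) x - hilbert (\<lambda>y. u y t) x\<bar> \<le> 8 * d s t" by simp
  next
    show "((\<lambda>s. d s t) \<longlongrightarrow> 0) (at t)" for t using C by (simp add: C_Linf_H1_def d_def)
  qed (rule U um w)+
  from this[unfolded d_def] show ?thesis by (rule that)
qed

theorem theorem1p5:
  fixes u :: "real \<Rightarrow> real \<Rightarrow> real" and u0 :: "real \<Rightarrow> real"
    and C1 \<eta> :: real
  assumes "H1 u0"
    and "C_Linf_H1 u"
    and "BO_weak_solution u"
    and "AE x in lborel. u x 0 = u0 x"
    and "C1 > 0" and "\<eta> > 0"
  shows "((\<lambda>t. sqrt (LINT x:{..- C1 * t * (ln t) powr (1 + \<eta>)}|lborel. (u x t)^2))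
           \<longlongrightarrow> 0) at_top"
proof -
  obtain U g M where "bo u U g M (\<lambda>s t. H1_norm (\<lambda>x. u x s - u x t))"
    by (rule bo_solution_locale[OF assms(2,3)])
  then interpret bo u U g M "\<lambda>s t. H1_norm (\<lambda>x. u x s - u x t)" .
  define m where "m = (\<lambda>t. C1 * t * (ln t) powr (1 + \<eta>))"
  have mlim: "filterlim m at_top at_top"
    unfolding m_def using assms(5,6) by real_asymp
  \<comment> \<open>For large \<open>t\<close> the quotient is the reciprocal of
    \<open>C1 * (ln t) powr (1 + \<eta>)\<close>.\<close>
  have ratio: "((\<lambda>t. t / m t) \<longlongrightarrow> 0) at_top"
    unfolding m_def using assms(5,6) by real_asymp
  have "((\<lambda>t. LINT x:{..- m t}|lborel. (u x t)^2) \<longlongrightarrow> 0) at_top"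
  proof (rule tendsto_sandwich[OF _ _ tendsto_const])
    show "\<forall>\<^sub>F t in at_top. 0 \<le> (LINT x:{..- m t}|lborel. (u x t)^2)"
      unfolding set_lebesgue_integral_def by (intro always_eventually allI integral_nonneg_AE AE_I2) simp
    have "\<forall>\<^sub>F t in at_top. 1 \<le> m t" using mlim by (simp add: filterlim_at_top)
    then show "\<forall>\<^sub>F t in at_top. (LINT x:{..- m t}|lborel. (u x t)^2)
        \<le> 2 * ((LBINT x. wt (m t) x * (U 0 x)^2) + (4 * M^2 + 4 * M^3) * (t / m t))"
      \<comment> \<open>Each \<open>t\<close> uses its own weight: \<open>m t\<close> is fixed over
        the whole evolution from \<open>0\<close> to \<open>t\<close>, so no derivative of
        \<open>m\<close> in time arises.\<close>
      using eventually_ge_at_top[of 0] by eventually_elim (rule left_mass_bound)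
    have "((\<lambda>t. 2 * ((LBINT x. wt (m t) x * (U 0 x)^2) + (4 * M^2 + 4 * M^3) * (t / m t)))
       \<longlongrightarrow> 2 * (0 + (4 * M^2 + 4 * M^3) * 0)) at_top"
      by (intro tendsto_mult tendsto_add tendsto_const ratio filterlim_compose[OF wt_energy_tendsto mlim])
    then show "((\<lambda>t. 2 * ((LBINT x. wt (m t) x * (U 0 x)^2) + (4 * M^2 + 4 * M^3) * (t / m t))) \<longlongrightarrow> 0) at_top"
      by simp
  qed
  from tendsto_real_sqrt[OF this] show ?thesis by (simp add: m_def)
qed

end
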